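(* For every domain $\omega\Subset\Omega$, the set of all real eigenvalues of $Q'$ in $\omega$ is a closed subset of $\mathbb{R}$.
   Context: Fix $n\ge2$, $1<p<\infty$, a domain $\Omega\subseteq\mathbb{R}^n$. $H:\Omega\times\mathbb{R}^n\to[0,\infty)$: for a.e. $x$, $H(x,\cdot)$ is a norm; $x\mapsto H(x,\xi)$ measurable; for each domain $\omega\Subset\Omega$ there are $0<\kappa_\omega\le\nu_\omega$ with $\kappa_\omega|\xi|\le H(x,\xi)\le\nu_\omega|\xi|$ for a.e. $x\in\omega$; for a.e. $x$, $(\mathbb{R}^n,H(x,\cdot))$ is uniformly convex and $H(x,\cdot)$ is differentiable on $\mathbb{R}^n\setminus\{0\}$. $\mathcal{A}(x,\xi)=\nabla_\xi(H(x,\xi)^p/p)$. $V\in M^q_{loc}(p;\Omega)=\bigcap_{\omega\Subset\Omega}M^q(p;\omega)$ (over subdomains), where $f\in M^q(p;\omega)$ iff $\sup_{y\in\omega,0<r<\mathrm{diam}\,\omega}r^{-n/q'}\int_{\omega\cap B_r(y)}|f|<\infty$ if $p<n$, $q>n/p$; the same with $(\log(\mathrm{diam}\,\omega/r))^{q/n'}$ replacing $r^{-n/q'}$ if $p=n$, $q>n$; $f\in L^1(\omega)$ if $p>n$. $Q'[u]=-\mathrm{div}\,\mathcal{A}(x,\nabla u)+V|u|^{p-2}u$. A real $\lambda$ is an eigenvalue of $Q'$ in $\omega$ if there is $v\in W^{1,p}_0(\omega)\setminus\{0\}$ with $\int_\omega\mathcal{A}(x,\nabla v)\cdot\nabla\varphi+\int_\omega(V-\lambda)|v|^{p-2}v\varphi=0$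 for all $\varphi\in C_c^\infty(\omega)$. *)

theory Defs
  imports "HOL-Analysis.Analysis"
begin

definition is_domain :: "'a::euclidean_space set \<Rightarrow> bool" where
  "is_domain U \<longleftrightarrow> open U \<and> connected U \<and> U \<noteq> {}"

definition compactly_in :: "'a::euclidean_space set \<Rightarrow> 'a set \<Rightarrow> bool" where
  "compactly_in w U \<longleftrightarrow> compact (closure w) \<and> closure w \<subseteq> U"

definition pd :: "'a::euclidean_space \<Rightarrow> ('a \<Rightarrow> real) \<Rightarrow> 'a \<Rightarrow> real" where
  "pd b f x = (THE D. ((\<lambda>t. f (x + t *\<^sub>R b)) has_real_derivative D) (at 0))"

fun dpartial :: "'a::euclidean_space list \<Rightarrow> ('a \<Rightarrow> real) \<Rightarrow> 'a \<Rightarrow> real" where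
  "dpartial [] f = f"
| "dpartial (b # bs) f = pd b (dpartial bs f)"

definition smooth_fun :: "('a::euclidean_space \<Rightarrow> real) \<Rightarrow> bool" where
  "smooth_fun f \<longleftrightarrow> (\<forall>bs. set bs \<subseteq> Basis \<longrightarrow>
      continuous_on UNIV (dpartial bs f) \<and>
      (\<forall>x. \<forall>b\<in>Basis. ((\<lambda>t. dpartial bs f (x + t *\<^sub>R b)) has_real_derivative
                           pd b (dpartial bs f) x) (at 0)))"

definition test_fun :: "'a::euclidean_space set \<Rightarrow> ('a \<Rightarrow> real) \<Rightarrow> bool" where
  "test_fun w f \<longleftrightarrow> smooth_fun f \<and> compact (closure {x. f x \<noteq> 0}) \<and> closure {x. f x \<noteq> 0} \<subseteq> w"

definition grad :: "('a::euclidean_space \<Rightarrow> real) \<Rightarrow> 'a \<Rightarrow> 'a" where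
  "grad f x = (\<Sum>b\<in>Basis. pd b f x *\<^sub>R b)"

definition Lp_fun :: "real \<Rightarrow> 'a::euclidean_space set \<Rightarrow> ('a \<Rightarrow> real) \<Rightarrow> bool" where
  "Lp_fun p w u \<longleftrightarrow> u \<in> borel_measurable (lebesgue_on w) \<and>
     integrable (lebesgue_on w) (\<lambda>x. \<bar>u x\<bar> powr p)"

definition Lp_vec :: "real \<Rightarrow> 'a::euclidean_space set \<Rightarrow> ('a \<Rightarrow> 'a) \<Rightarrow> bool" where
  "Lp_vec p w g \<longleftrightarrow> g \<in> borel_measurable (lebesgue_on w) \<and>
     integrable (lebesgue_on w) (\<lambda>x. norm (g x) powr p)"

definition weak_grad :: "'a::euclidean_space set \<Rightarrow> ('a \<Rightarrow> real) \<Rightarrow> ('a \<Rightarrow> 'a) \<Rightarrow> bool" where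
  "weak_grad w u g \<longleftrightarrow>
     (\<forall>phi. test_fun w phi \<longrightarrow> (\<forall>b\<in>Basis.
        (LINT x|lebesgue_on w. u x * pd b phi x) = - (LINT x|lebesgue_on w. (g x \<bullet> b) * phi x)))"

definition W1p :: "real \<Rightarrow> 'a::euclidean_space set \<Rightarrow> ('a \<Rightarrow> real) \<Rightarrow> ('a \<Rightarrow> 'a) \<Rightarrow> bool" where
  "W1p p w u g \<longleftrightarrow> Lp_fun p w u \<and> Lp_vec p w g \<and> weak_grad w u g"

definition W1p0 :: "real \<Rightarrow> 'a::euclidean_space set \<Rightarrow> ('a \<Rightarrow> real) \<Rightarrow> ('a \<Rightarrow> 'a) \<Rightarrow> bool" where
  "W1p0 p w u g \<longleftrightarrow> W1p p w u g \<and>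
     (\<exists>phis :: nat \<Rightarrow> 'a \<Rightarrow> real. (\<forall>k. test_fun w (phis k)) \<and>
        (\<lambda>k. LINT x|lebesgue_on w. \<bar>phis k x - u x\<bar> powr p) \<longlonglongrightarrow> 0 \<and>
        (\<lambda>k. LINT x|lebesgue_on w. norm (grad (phis k) x - g x) powr p) \<longlonglongrightarrow> 0)"

definition is_norm_fun :: "('a::euclidean_space \<Rightarrow> real) \<Rightarrow> bool" where
  "is_norm_fun N \<longleftrightarrow> (\<forall>u. N u \<ge> 0) \<and> (\<forall>u. N u = 0 \<longleftrightarrow> u = 0) \<and>
     (\<forall>c u. N (c *\<^sub>R u) = \<bar>c\<bar> * N u) \<and> (\<forall>u v. N (u + v) \<le> N u + N v)"

definition unif_convex :: "('a::euclidean_space \<Rightarrow> real) \<Rightarrow> bool" where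
  "unif_convex N \<longleftrightarrow> (\<forall>e. 0 < e \<and> e \<le> 2 \<longrightarrow> (\<exists>d>0. \<forall>u v.
      N u \<le> 1 \<and> N v \<le> 1 \<and> N (u - v) \<ge> e \<longrightarrow> N ((1/2) *\<^sub>R (u + v)) \<le> 1 - d))"

definition Aop :: "('a::euclidean_space \<Rightarrow> 'a \<Rightarrow> real) \<Rightarrow> real \<Rightarrow> 'a \<Rightarrow> 'a \<Rightarrow> 'a" where
  "Aop H p x xi = (THE v. ((\<lambda>eta. H x eta powr p / p) has_derivative (\<lambda>h. v \<bullet> h)) (at xi))"

definition morrey :: "real \<Rightarrow> real \<Rightarrow> 'a::euclidean_space set \<Rightarrow> ('a \<Rightarrow> real) \<Rightarrow> bool" where
  "morrey p q w f \<longleftrightarrow>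
     (let n = real DIM('a); q' = q / (q - 1); n' = n / (n - 1) in
      if p < n then n / p < q \<and> integrable (lebesgue_on w) f \<and>
        (\<exists>C. \<forall>y\<in>w. \<forall>r. 0 < r \<and> r < diameter w \<longrightarrow>
           r powr (- n / q') * (LINT x|lebesgue_on (w \<inter> ball y r). \<bar>f x\<bar>) \<le> C)
      else if p = n then n < q \<and> integrable (lebesgue_on w) f \<and>
        (\<exists>C. \<forall>y\<in>w. \<forall>r. 0 < r \<and> r < diameter w \<longrightarrow>
           (ln (diameter w / r)) powr (q / n') * (LINT x|lebesgue_on (w \<inter> ball y r). \<bar>f x\<bar>) \<le> C)
      else integrable (lebesgue_on w) f)"

definition morrey_loc :: "real \<Rightarrow> real \<Rightarrow> 'a::euclidean_space set \<Rightarrow> ('a \<Rightarrow> real) \<Rightarrow> bool" where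
  "morrey_loc p q U f \<longleftrightarrow> (\<forall>w. is_domain w \<and> compactly_in w U \<longrightarrow> morrey p q w f)"

definition is_eigenvalue :: "('a::euclidean_space \<Rightarrow> 'a \<Rightarrow> real) \<Rightarrow> real \<Rightarrow> ('a \<Rightarrow> real) \<Rightarrow> 'a set \<Rightarrow> real \<Rightarrow> bool" where
  "is_eigenvalue H p V w lam \<longleftrightarrow>
     (\<exists>v g. W1p0 p w v g \<and> \<not> (AE x in lebesgue_on w. v x = 0) \<and>
        (\<forall>phi. test_fun w phi \<longrightarrow>
           (LINT x|lebesgue_on w. Aop H p x (g x) \<bullet> grad phi x)
         + (LINT x|lebesgue_on w. (V x - lam) * (\<bar>v x\<bar> powr (p - 2)) * v x * phi x) = 0))"

end

theory Submission
  imports Defs "HOL-Complex_Analysis.Great_Picard"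
begin

text \<open>
  Let $\lambda_k \to \lambda$ be eigenvalues with eigenfunctions $v_k$ normalised in $L^p$. Testing the equation
  with $v_k$ bounds the gradients, provided $\int |V| |u|^p \le \delta \int |\nabla u|^p + C_\delta \int |u|^p$ on
  $W^{1,p}_0$. This inequality compares $u$ with its averages over balls of a small radius: the difference is
  a truncated Riesz potential of $\nabla u$, and a Schur test with a weight adapted to the Morrey condition (a power of
  the distance for $p \ne n$, a power of its logarithm for $p = n$) bounds it in $L^p(|V|)$. The same argument with Lebesgue
  measure gives Rellich compactness, so that a subsequence of $(v_k)$ is Cauchy in $L^p$ and then in $L^p(|V|)$.
  Testing the equations of $v_i$ and $v_j$ with $v_i - v_j$ gives
  $\int (A(\nabla v_i) - A(\nabla v_j)) \cdot (\nabla v_i - \nabla v_j) \to 0$, and strict monotonicity with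
  coercivity of $A$ makes the gradients converge strongly; no weak compactness is needed. The
  limit is an eigenfunction for $\lambda$.
\<close>

section \<open>Integral inequalities and convergence\<close>

text \<open>Three obstacles shape the argument. The Morrey condition controls only the mass of |V|
  on balls, so integrability of V |v|^(p-2) v phi for v in W^{1,p}_0 is itself a consequence of the
  inequality that bounds the gradients. It has to be settled before an integral is split, since a
  non-integrable function has Bochner integral 0. The modulus of convexity of H (x, .) may
  degenerate as x varies; what almost all points share are the constants kappa and nu. Information
  on gradients is therefore first obtained pointwise, at bounded values. No limit is known
  beforehand, so eigenfunctions are compared along pairs of indices, and the convergence lemmas used
  for this are stated for arbitrary filters. The smallness of delta serves twice: with (1 + L) delta
  = kappa^p / 2, where L bounds all |lambda_k|, the gradient term is absorbed, and with delta
  tending to 0, convergence in L^p becomes convergence with weight |V|. Products are estimated by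
  Young's inequality with a free parameter, which takes over the role of Hoelder's
  inequality.\<close>

lemma powr_add_le:
  fixes a b p :: real
  assumes "0 \<le> a" "0 \<le> b" "0 \<le> p"
  shows "(a + b) powr p \<le> 2 powr p * (a powr p + b powr p)"
proof -
  have "(a + b) powr p \<le> (2 * max a b) powr p"
    using assms by (intro powr_mono2) auto
  also have "\<dots> = 2 powr p * max a b powr p"
    using assms by (simp add: powr_mult)
  also have "max a b powr p \<le> a powr p + b powr p"
    by (auto simp: max_def)
  finally show ?thesis by (simp add: mult_left_mono)
qed

lemma norm_add_powr_le:
  assumes "0 \<le> p"
  shows "norm (a + b) powr p \<le> 2 powr p * (norm a powr p + norm b powr p)"
  using powr_mono2[OF assms _ norm_triangle_ineq[of a b]] powr_add_le[of "norm a" "norm b" p] assms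
  by auto

lemma norm_diff_powr_le:
  assumes "0 \<le> p"
  shows "norm (a - b) powr p \<le> 2 powr p * (norm a powr p + norm b powr p)"
  using norm_add_powr_le[OF assms, of a "-b"] by simp

text \<open>Splitting at b = e a: below this line the first summand dominates, above it a <= b / e
  and the second one does. The sharp constants of conjugate exponents are avoided; later only the
  freedom in e counts.\<close>

lemma Young_powr:
  fixes a b e p :: real
  assumes "0 \<le> a" "0 \<le> b" "0 < e" "1 < p"
  shows "a powr (p - 1) * b \<le> e * a powr p + e powr (1 - p) * b powr p"
proof (cases "b \<le> e * a")
  case True
  have "a powr (p - 1) * b \<le> a powr (p - 1) * (e * a)"
    using True by (intro mult_left_mono) auto
  also have "\<dots> = e * a powr p"
    using assms powr_add[of a "p - 1" 1] by (cases "a = 0") auto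
  also have "\<dots> \<le> e * a powr p + e powr (1 - p) * b powr p" by simp
  finally show ?thesis .
next
  case False
  then have ab: "a \<le> b / e" using assms by (simp add: field_simps)
  have b: "b > 0" using False assms
    by (metis dual_order.strict_trans2 mult_nonneg_nonneg order_less_imp_le linorder_not_le)
  have "a powr (p - 1) * b \<le> (b / e) powr (p - 1) * b"
    using ab assms by (intro mult_right_mono powr_mono2) auto
  also have "\<dots> = e powr (1 - p) * b powr p"
    using assms b powr_add[of b "p - 1" 1] powr_minus[of e "p - 1"] by (simp add: powr_divide field_simps)
  also have "\<dots> \<le> e * a powr p + e powr (1 - p) * b powr p" using assms by simp
  finally show ?thesis .
qed

lemma powr_le_one_add:
  fixes a s :: real
  assumes "0 \<le> a" "1 \<le> s"
  shows "a \<le> 1 + a powr s"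
  using assms powr_mono[of 1 s a] by (cases "a \<le> 1") (auto simp: add_increasing2)

text \<open>The same splitting, at a = e. Taken with a large e, it bounds the integral of |u| over a
  set of small measure in terms of the p-norm of u.\<close>

lemma le_add_powr:
  fixes a e s :: real
  assumes "0 \<le> a" "0 < e" "1 < s"
  shows "a \<le> e + e powr (1 - s) * a powr s"
proof (cases "a \<le> e")
  case True
  then show ?thesis by (simp add: add_increasing2)
next
  case False
  then have "a = a powr (1 - s) * a powr s" using assms by (simp flip: powr_add)
  also have "\<dots> \<le> e powr (1 - s) * a powr s"
    using False assms by (intro mult_right_mono powr_mono2') auto
  finally show ?thesis using assms by simp
qed

text \<open>Both claims come from the nonnegative integral: a bound on the Bochner integral alone
  would be empty, since a non-integrable limit has integral 0. The bound is only required
  eventually, which suits estimates that hold on tails.\<close>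

lemma integrable_Fatou:
  fixes f :: "nat \<Rightarrow> 'a \<Rightarrow> real"
  assumes int: "\<And>k. integrable M (f k)" and nn: "\<And>k x. 0 \<le> f k x" and F: "F \<in> borel_measurable M"
    and lim: "AE x in M. (\<lambda>k. f k x) \<longlonglongrightarrow> F x"
    and B: "eventually (\<lambda>k. integral\<^sup>L M (f k) \<le> B) sequentially"
  shows "integrable M F" "integral\<^sup>L M F \<le> B"
proof -
  note [measurable] = F
  have [measurable]: "f k \<in> borel_measurable M" for k using int by auto
  obtain k0 where "integral\<^sup>L M (f k0) \<le> B" using B eventually_sequentially by auto
  then have B0: "0 \<le> B" by (rule order_trans[rotated]) (rule integral_nonneg_AE, simp add: nn)
  have Fnn: "AE x in M. 0 \<le> F x" using lim
    by eventually_elim (rule LIMSEQ_le_const, auto simp: nn)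
  have "(\<integral>\<^sup>+x. ennreal (F x) \<partial>M) = (\<integral>\<^sup>+x. liminf (\<lambda>k. ennreal (f k x)) \<partial>M)"
    using lim by (intro nn_integral_cong_AE, eventually_elim)
      (metis lim_imp_Liminf trivial_limit_sequentially tendsto_ennrealI)
  also have "\<dots> \<le> liminf (\<lambda>k. \<integral>\<^sup>+x. ennreal (f k x) \<partial>M)"
    by (rule nn_integral_liminf) measurable
  also have "\<dots> = liminf (\<lambda>k. ennreal (integral\<^sup>L M (f k)))"
    using int nn by (simp add: nn_integral_eq_integral)
  also have "\<dots> \<le> ennreal B"
    by (rule Liminf_le) (use B in \<open>auto elim!: eventually_mono simp: ennreal_leI\<close>)
  finally have *: "(\<integral>\<^sup>+x. ennreal (F x) \<partial>M) \<le> ennreal B" .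
  show iF: "integrable M F"
    using * Fnn by (intro integrableI_nonneg F) (auto simp: less_top[symmetric] top_unique)
  show "integral\<^sup>L M F \<le> B"
    using * B0 by (simp add: nn_integral_eq_integral[OF iF Fnn])
qed

text \<open>The limit function is \<open>lim\<close> of the subsequence at every point; it is
  measurable, including on the null set where the subsequence diverges.\<close>

lemma L1_Cauchy_AE_limit:
  fixes u :: "nat \<Rightarrow> 'a \<Rightarrow> 'b::euclidean_space"
  assumes int: "\<And>n. integrable M (u n)"
    and C: "\<And>e. e > 0 \<Longrightarrow> \<exists>N. \<forall>i\<ge>N. \<forall>j\<ge>N. (LINT x|M. norm (u i x - u j x)) < e"
  obtains r l where "strict_mono (r::nat\<Rightarrow>nat)" "l \<in> borel_measurable M"
    "AE x in M. (\<lambda>i. u (r i) x) \<longlonglongrightarrow> l x"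
proof -
  obtain r where r: "strict_mono (r::nat\<Rightarrow>nat)" "AE x in M. Cauchy (\<lambda>i. u (r i) x)"
    using cauchy_L1_AE_cauchy_subseq[of M u] int C by metis
  have [measurable]: "u n \<in> borel_measurable M" for n using int by auto
  show thesis
  proof (rule that[OF r(1)])
    show "(\<lambda>x. lim (\<lambda>i. u (r i) x)) \<in> borel_measurable M"
      by (rule borel_measurable_lim_metric) measurable
    show "AE x in M. (\<lambda>i. u (r i) x) \<longlonglongrightarrow> lim (\<lambda>i. u (r i) x)"
      using r(2) by eventually_elim (simp add: Cauchy_convergent convergent_LIMSEQ_iff[symmetric])
  qed
qed

lemma integrable_norm_powr_diff:
  fixes u v :: "'a \<Rightarrow> 'b::euclidean_space"
  assumes [measurable]: "u \<in> borel_measurable M" "v \<in> borel_measurable M"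
    and "integrable M (\<lambda>x. norm (u x) powr p)" "integrable M (\<lambda>x. norm (v x) powr p)" and p: "0 \<le> p"
  shows "integrable M (\<lambda>x. norm (u x - v x) powr p)"
proof (rule Bochner_Integration.integrable_bound)
  show "integrable M (\<lambda>x. 2 powr p * (norm (u x) powr p + norm (v x) powr p))" using assms by auto
qed (auto simp: norm_diff_powr_le p)

text \<open>Completeness with the limit already identified as an almost everywhere limit of a
  subsequence, so that different modes of convergence share one limit function.\<close>

lemma Lp_Cauchy_limit:
  fixes u :: "nat \<Rightarrow> 'a \<Rightarrow> 'b::euclidean_space"
  assumes meas[measurable]: "\<And>n. u n \<in> borel_measurable M" "l \<in> borel_measurable M"
    and int: "\<And>n. integrable M (\<lambda>x. norm (u n x) powr p)" and p: "0 < p"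
    and C: "\<And>e. e > 0 \<Longrightarrow> \<exists>N. \<forall>i\<ge>N. \<forall>j\<ge>N. (LINT x|M. norm (u i x - u j x) powr p) < e"
    and r: "strict_mono (r::nat\<Rightarrow>nat)" and lim: "AE x in M. (\<lambda>i. u (r i) x) \<longlonglongrightarrow> l x"
  shows "integrable M (\<lambda>x. norm (l x) powr p)" "(\<lambda>n. LINT x|M. norm (u n x - l x) powr p) \<longlonglongrightarrow> 0"
proof -
  have id: "integrable M (\<lambda>x. norm (u i x - u j x) powr p)" for i j
    using integrable_norm_powr_diff[OF meas(1) meas(1) int int, of i j] p by simp
  \<comment> \<open>Fatou in the second index, along the subsequence, turns the Cauchy estimate into
    an estimate against the limit.\<close>
  have key: "integrable M (\<lambda>x. norm (u i x - l x) powr p) \<and> (LINT x|M. norm (u i x - l x) powr p) \<le> e"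
    if N: "\<forall>i\<ge>N. \<forall>j\<ge>N. (LINT x|M. norm (u i x - u j x) powr p) < e" and "i \<ge> N" for N i e
  proof -
    have A: "AE x in M. (\<lambda>j. norm (u i x - u (r j) x) powr p) \<longlonglongrightarrow> norm (u i x - l x) powr p"
      using lim by eventually_elim (intro tendsto_powr2 tendsto_intros, use p in auto)
    have B: "eventually (\<lambda>j. (LINT x|M. norm (u i x - u (r j) x) powr p) \<le> e) sequentially"
      using eventually_ge_at_top[of N] by eventually_elim
        (use N \<open>i \<ge> N\<close> seq_suble[OF r] in \<open>meson order_trans less_imp_le\<close>)
    show ?thesis
      using integrable_Fatou[OF id _ _ A B] by auto
  qed
  obtain N where "\<forall>i\<ge>N. \<forall>j\<ge>N. (LINT x|M. norm (u i x - u j x) powr p) < 1" using C[of 1] by auto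
  from key[OF this, of N] have "integrable M (\<lambda>x. norm (u N x - l x) powr p)" by auto
  from integrable_norm_powr_diff[OF _ _ int[of N] this] p
  show "integrable M (\<lambda>x. norm (l x) powr p)" by simp
  show "(\<lambda>n. LINT x|M. norm (u n x - l x) powr p) \<longlonglongrightarrow> 0"
  proof (rule LIMSEQ_I)
    fix e :: real assume "e > 0"
    then obtain N where N: "\<forall>i\<ge>N. \<forall>j\<ge>N. (LINT x|M. norm (u i x - u j x) powr p) < e/2" using C[of "e/2"] by auto
    then have "norm ((LINT x|M. norm (u n x - l x) powr p) - 0) < e" if "n \<ge> N" for n
      using key[OF N that] \<open>e > 0\<close> by (simp add: integral_nonneg)
    then show "\<exists>no. \<forall>n\<ge>no. norm ((LINT x|M. norm (u n x - l x) powr p) - 0) < e" by blast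
  qed
qed

lemma Lp_tendsto_AE_subseq:
  fixes u :: "nat \<Rightarrow> 'a \<Rightarrow> 'b::euclidean_space"
  assumes int: "\<And>n. integrable M (\<lambda>x. norm (u n x - l x) powr p)" and p: "0 < p"
    and lim: "(\<lambda>n. LINT x|M. norm (u n x - l x) powr p) \<longlonglongrightarrow> 0"
  obtains r where "strict_mono (r::nat\<Rightarrow>nat)" "AE x in M. (\<lambda>i. u (r i) x) \<longlonglongrightarrow> l x"
proof -
  obtain r where r: "strict_mono (r::nat\<Rightarrow>nat)" "AE x in M. (\<lambda>i. norm (u (r i) x - l x) powr p) \<longlonglongrightarrow> 0"
    using tendsto_L1_AE_subseq[of M "\<lambda>n x. norm (u n x - l x) powr p"] int lim by auto
  have "AE x in M. (\<lambda>i. u (r i) x) \<longlonglongrightarrow> l x"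
    using r(2)
  proof eventually_elim
    case (elim x)
    from tendsto_powr2[OF this, of "\<lambda>_. 1/p" "1/p"] p
    have "(\<lambda>i. norm (u (r i) x - l x)) \<longlonglongrightarrow> 0" by (simp add: powr_powr)
    then show ?case using tendsto_norm_zero_iff LIM_zero_iff by blast
  qed
  then show thesis using that r by blast
qed

text \<open>Truncation at height $R$: on $\{h_k \le R\}$ use dominated convergence, elsewhere
  $h_k \le R^{1-s} h_k^s$.\<close>
lemma tendsto_L1_of_AE_bounded_powr:
  fixes h :: "nat \<Rightarrow> 'a \<Rightarrow> real"
  assumes W: "integrable M W" "\<And>x. 0 \<le> W x"
    and meas[measurable]: "\<And>k. h k \<in> borel_measurable M" and nn: "\<And>k x. 0 \<le> h k x"
    and lim: "AE x in M. (\<lambda>k. h k x) \<longlonglongrightarrow> 0" and s: "1 < s"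
    and int: "\<And>k. integrable M (\<lambda>x. W x * h k x powr s)"
    and B: "\<And>k. (LINT x|M. W x * h k x powr s) \<le> B"
  shows "\<And>k. integrable M (\<lambda>x. W x * h k x)" "(\<lambda>k. LINT x|M. W x * h k x) \<longlonglongrightarrow> 0"
proof -
  have [measurable]: "W \<in> borel_measurable M" using W by auto
  show ii: "integrable M (\<lambda>x. W x * h k x)" for k
  proof (rule Bochner_Integration.integrable_bound)
    show "integrable M (\<lambda>x. W x + W x * h k x powr s)" using W int by auto
    show "AE x in M. norm (W x * h k x) \<le> norm (W x + W x * h k x powr s)"
    proof (rule AE_I2)
      fix x show "norm (W x * h k x) \<le> norm (W x + W x * h k x powr s)"
        using mult_left_mono[OF powr_le_one_add[OF nn, of s k x] W(2)] W nn s
        by (auto simp: algebra_simps abs_mult)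
    qed
  qed auto
  show "(\<lambda>k. LINT x|M. W x * h k x) \<longlonglongrightarrow> 0"
  proof (rule LIMSEQ_I)
    fix e :: real assume e: "e > 0"
    define B' where "B' = max B 1"
    have "((\<lambda>R. R powr (1 - s) * B') \<longlongrightarrow> 0 * B') at_top"
      using s by (intro tendsto_mult tendsto_neg_powr filterlim_ident tendsto_const) auto
    then have "eventually (\<lambda>R. R powr (1 - s) * B' < e/2) at_top"
      using e by (intro order_tendstoD) auto
    then obtain R0 where R0: "\<And>R. R \<ge> R0 \<Longrightarrow> R powr (1 - s) * B' < e/2"
      by (auto simp: eventually_at_top_linorder)
    define R where "R = max R0 1"
    have R: "R > 0" "R powr (1 - s) * B' < e/2" using R0[of R] by (auto simp: R_def)
    define t where "t k x = W x * min (h k x) R" for k x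
    have [measurable]: "t k \<in> borel_measurable M" for k unfolding t_def by measurable
    have tl: "(\<lambda>k. integral\<^sup>L M (t k)) \<longlonglongrightarrow> integral\<^sup>L M (\<lambda>x. 0)"
    proof (rule integral_dominated_convergence[where w="\<lambda>x. W x * R"])
      show "AE x in M. (\<lambda>k. t k x) \<longlonglongrightarrow> 0"
        using lim
      proof eventually_elim
        case (elim x)
        have "(\<lambda>k. t k x) \<longlonglongrightarrow> W x * min 0 R" unfolding t_def
          by (intro tendsto_intros elim)
        then show ?case using R by simp
      qed
      show "AE x in M. norm (t k x) \<le> W x * R" for k
        using W(2) nn R by (auto simp: t_def abs_mult intro!: AE_I2 mult_left_mono)
    qed (use W in auto)
    then obtain N where N: "\<And>k. k \<ge> N \<Longrightarrow> \<bar>integral\<^sup>L M (t k)\<bar> < e/2"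
      using LIMSEQ_D[OF tl, of "e/2"] e by auto
    have "norm ((LINT x|M. W x * h k x) - 0) < e" if k: "k \<ge> N" for k
    proof -
      have it: "integrable M (t k)"
      proof (rule Bochner_Integration.integrable_bound[OF ii[of k]])
        show "AE x in M. norm (t k x) \<le> norm (W x * h k x)"
          using W(2) nn R by (auto simp: t_def abs_mult intro!: AE_I2 mult_left_mono)
      qed simp
      have pw: "W x * h k x \<le> t k x + R powr (1 - s) * (W x * h k x powr s)" for x
      proof (cases "h k x \<le> R")
        case True then show ?thesis using W(2) by (simp add: t_def)
      next
        case False
        then have "h k x = h k x powr (1 - s) * h k x powr s" using R by (simp flip: powr_add)
        also have "\<dots> \<le> R powr (1 - s) * h k x powr s"
          using False R s by (intro mult_right_mono powr_mono2') auto
        finally have "W x * h k x \<le> W x * (R powr (1 - s) * h k x powr s)" using W(2) by (rule mult_left_mono)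
        moreover have "0 \<le> t k x" using W(2) nn R by (simp add: t_def)
        ultimately show ?thesis by (simp add: algebra_simps)
      qed
      have "(LINT x|M. W x * h k x) \<le> (LINT x|M. t k x + R powr (1 - s) * (W x * h k x powr s))"
        by (intro integral_mono ii pw Bochner_Integration.integrable_add it integrable_mult_right int)
      also have "\<dots> = integral\<^sup>L M (t k) + R powr (1 - s) * (LINT x|M. W x * h k x powr s)"
        using it int by simp
      also have "\<dots> \<le> integral\<^sup>L M (t k) + R powr (1 - s) * B'"
        using B[of k] by (intro add_left_mono mult_left_mono) (auto simp: B'_def)
      also have "\<dots> < e" using N[OF k] R by auto
      finally show ?thesis using W(2) nn by (simp add: integral_nonneg)
    qed
    then show "\<exists>no. \<forall>k\<ge>no. norm ((LINT x|M. W x * h k x) - 0) < e" by blast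
  qed
qed

section \<open>Norms in the role of the integrand\<close>

text \<open>\<open>Aop\<close> with the point x frozen, so that the convexity arguments concern a
  single norm.\<close>

definition flux :: "('a::euclidean_space \<Rightarrow> real) \<Rightarrow> real \<Rightarrow> 'a \<Rightarrow> 'a" where
  "flux N p xi = (THE v. ((\<lambda>eta. N eta powr p / p) has_derivative (\<lambda>h. v \<bullet> h)) (at xi))"

lemma Aop_eq_flux: "Aop H p x = flux (H x) p"
  by (rule ext) (simp add: Aop_def flux_def)

lemma linear_real_eq_inner:
  fixes f :: "'a::euclidean_space \<Rightarrow> real"
  assumes "linear f"
  shows "f h = (\<Sum>b\<in>Basis. f b *\<^sub>R b) \<bullet> h"
proof -
  have "f h = f (\<Sum>b\<in>Basis. (h \<bullet> b) *\<^sub>R b)" by (simp add: euclidean_representation)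
  also have "\<dots> = (\<Sum>b\<in>Basis. (h \<bullet> b) * f b)" by (simp add: linear_sum[OF assms] linear_cmul[OF assms])
  also have "\<dots> = (\<Sum>b\<in>Basis. f b *\<^sub>R b) \<bullet> h" by (simp add: inner_sum_left mult.commute inner_commute[of h])
  finally show ?thesis .
qed

text \<open>On the closed half-line: if one end point is 0, the claim reduces to s^p <= s for s
  between 0 and 1.\<close>

lemma powr_convex_nonneg:
  fixes a b t p :: real
  assumes "0 \<le> a" "0 \<le> b" "0 \<le> t" "t \<le> 1" "1 \<le> p"
  shows "((1 - t) * a + t * b) powr p \<le> (1 - t) * a powr p + t * b powr p"
proof -
  have m: "(s * c) powr p \<le> s * c powr p" if "0 \<le> s" "s \<le> 1" "0 \<le> c" for s c :: real
    using powr_mono'[of 1 p s] that assms by (auto simp: powr_mult intro!: mult_right_mono)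
  consider "a = 0" | "b = 0" | "0 < a" "0 < b" using assms by linarith
  then show ?thesis
  proof cases
    case 3
    then show ?thesis using convex_onD[OF powr_convex[of p], of t a b] assms by auto
  qed (use m[of t b] m[of "1 - t" a] assms in auto)
qed

text \<open>One fibre of the integrand. The constants are parameters because, on a subdomain with
  compact closure, the same pair serves almost all points.\<close>

locale finsler_norm =
  fixes N :: "'a::euclidean_space \<Rightarrow> real" and p kappa nu :: real
  assumes p: "1 < p" and norm_fun: "is_norm_fun N" and uc: "unif_convex N"
    and diff: "\<And>xi. xi \<noteq> 0 \<Longrightarrow> N differentiable (at xi)"
    and kappa: "0 < kappa" and lower: "\<And>xi. kappa * norm xi \<le> N xi" and upper: "\<And>xi. N xi \<le> nu * norm xi"
begin

abbreviation "A \<equiv> flux N p"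

lemma nonneg: "0 \<le> N u" and zero_iff: "N u = 0 \<longleftrightarrow> u = 0" and scale: "N (c *\<^sub>R u) = \<bar>c\<bar> * N u"
  and triangle: "N (u + v) \<le> N u + N v"
  using norm_fun by (auto simp: is_norm_fun_def)

lemma pos: "u \<noteq> 0 \<Longrightarrow> 0 < N u"
  using nonneg[of u] zero_iff[of u] by linarith

lemma nu_pos: "0 < nu"
proof -
  obtain b :: 'a where "b \<in> Basis" using nonempty_Basis by blast
  then show ?thesis using lower[of b] upper[of b] kappa by (auto simp: norm_Basis)
qed

lemma N_uminus: "N (- u) = N u" using scale[of "-1" u] by simp

lemma N_diff: "\<bar>N u - N v\<bar> \<le> nu * norm (u - v)"
  using triangle[of "u - v" v] triangle[of "v - u" u] upper[of "u - v"] upper[of "v - u"] by (simp add: norm_minus_commute)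

lemma continuous_N: "continuous_on UNIV N"
proof -
  have "nu-lipschitz_on UNIV N"
    using N_diff nu_pos by (intro lipschitz_onI) (auto simp: dist_norm)
  then show ?thesis by (rule lipschitz_on_continuous_on)
qed

section \<open>The energy N^p / p and its gradient\<close>

lemma continuous_on_energy: "continuous_on UNIV (\<lambda>u. N u powr p / p)"
  using p by (intro continuous_intros continuous_on_powr' continuous_N) (auto simp: nonneg)

lemma convex_energy:
  assumes "0 \<le> t" "t \<le> 1"
  shows "N ((1 - t) *\<^sub>R u + t *\<^sub>R v) powr p / p \<le> (1 - t) * (N u powr p / p) + t * (N v powr p / p)"
proof -
  have "N ((1 - t) *\<^sub>R u + t *\<^sub>R v) \<le> (1 - t) * N u + t * N v"
    using triangle[of "(1 - t) *\<^sub>R u" "t *\<^sub>R v"] assms by (simp add: scale)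
  then have "N ((1 - t) *\<^sub>R u + t *\<^sub>R v) powr p \<le> ((1 - t) * N u + t * N v) powr p"
    using p nonneg by (intro powr_mono2) auto
  also have "\<dots> \<le> (1 - t) * N u powr p + t * N v powr p"
    using powr_convex_nonneg[of "N u" "N v" t p] assms p nonneg by auto
  finally show ?thesis using p by (simp add: field_simps)
qed

text \<open>Away from 0 this is the chain rule. At 0 the norm has a kink, but N^p = O(|y|^p) with p
  > 1 flattens it and the gradient there is 0.\<close>

lemma gradient_exists: "\<exists>v. ((\<lambda>eta. N eta powr p / p) has_derivative (\<lambda>h. v \<bullet> h)) (at xi)"
proof (cases "xi = 0")
  case False
  then obtain f' where f': "(N has_derivative f') (at xi)" using diff unfolding differentiable_def by blast
  have "((\<lambda>eta. N eta powr p / p) has_derivative (\<lambda>h. f' h * (p * N xi powr (p - 1)) / p)) (at xi)"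
  proof -
    have "((\<lambda>x. x powr p) has_real_derivative p * N xi powr (p - 1)) (at (N xi))"
      using pos[OF False] by (rule has_real_derivative_powr)
    then have "((\<lambda>x. x powr p) has_derivative (\<lambda>h. h * (p * N xi powr (p - 1)))) (at (N xi))"
      by (simp add: has_field_derivative_def mult.commute[of _ "p * _"])
    from has_derivative_compose[OF f' this] show ?thesis
      by (rule bounded_linear.has_derivative[OF bounded_linear_divide])
  qed
  moreover have "linear (\<lambda>h. f' h * (p * N xi powr (p - 1)) / p)"
    using calculation by (rule has_derivative_linear)
  ultimately show ?thesis using linear_real_eq_inner by (metis (no_types, lifting) ext)
next
  case True
  have "((\<lambda>eta. N eta powr p / p) has_derivative (\<lambda>h. 0)) (at 0)"
  proof (rule has_derivativeI_sandwich[of 1 _ _ _ _ "\<lambda>y. nu powr p / p * norm y powr (p - 1)"])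
    show "((\<lambda>y::'a. nu powr p / p * norm y powr (p - 1)) \<longlongrightarrow> 0) (at 0)"
    proof -
      have "((\<lambda>y::'a. norm y powr (p - 1)) \<longlongrightarrow> norm (0::'a) powr (p - 1)) (at 0)"
        using p by (intro tendsto_powr2 tendsto_intros) auto
      from tendsto_mult_left[OF this, of "nu powr p / p"] show ?thesis by simp
    qed
    fix y :: 'a assume "y \<noteq> 0"
    have "N y powr p \<le> (nu * norm y) powr p" using p nonneg upper by (intro powr_mono2) auto
    also have "\<dots> = nu powr p * norm y powr (p - 1) * norm y"
      using nu_pos powr_add[of "norm y" "p - 1" 1] \<open>y \<noteq> 0\<close> by (simp add: powr_mult)
    finally show "norm (N y powr p / p - N 0 powr p / p - 0) / norm (y - 0) \<le> nu powr p / p * norm y powr (p - 1)"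
      using p \<open>y \<noteq> 0\<close> zero_iff[of 0] by (simp add: field_simps)
  qed auto
  then show ?thesis using True by (intro exI[of _ 0]) simp
qed

lemma flux_unique:
  assumes "((\<lambda>eta. N eta powr p / p) has_derivative (\<lambda>h. v \<bullet> h)) (at xi)"
  shows "A xi = v"
  unfolding flux_def
proof (rule the_equality)
  show "((\<lambda>eta. N eta powr p / p) has_derivative (\<lambda>h. v \<bullet> h)) (at xi)" by (fact assms)
  fix u assume "((\<lambda>eta. N eta powr p / p) has_derivative (\<lambda>h. u \<bullet> h)) (at xi)"
  from has_derivative_unique[OF this assms] have "u \<bullet> h = v \<bullet> h" for h by metis
  then show "u = v" by (metis inner_commute vector_eq_rdot)
qed

lemma has_derivative_energy: "((\<lambda>eta. N eta powr p / p) has_derivative (\<lambda>h. A xi \<bullet> h)) (at xi)"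
  using gradient_exists flux_unique by metis

lemma energy_directional: "((\<lambda>t. N (xi + t *\<^sub>R eta) powr p / p) has_real_derivative A xi \<bullet> eta) (at 0)"
proof -
  have "((\<lambda>t. xi + t *\<^sub>R eta) has_derivative (\<lambda>t. t *\<^sub>R eta)) (at 0)"
    by (auto intro!: derivative_eq_intros)
  from has_derivative_compose[OF this, of "\<lambda>eta. N eta powr p / p" "\<lambda>h. A xi \<bullet> h"] has_derivative_energy
  show ?thesis by (simp add: has_field_derivative_def mult_commute_abs)
qed

text \<open>Stated for sequences because the flux is later shown measurable in x as a countable
  limit of such quotients.\<close>

lemma difference_quotients:
  assumes "\<And>j. t j \<noteq> 0" "t \<longlonglongrightarrow> 0"
  shows "(\<lambda>j. (N (xi + t j *\<^sub>R eta) powr p / p - N xi powr p / p) / t j) \<longlonglongrightarrow> A xi \<bullet> eta"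
proof -
  have "((\<lambda>t. (N (xi + t *\<^sub>R eta) powr p / p - N xi powr p / p) / t) \<longlongrightarrow> A xi \<bullet> eta) (at 0)"
    using energy_directional[of xi eta] by (simp add: DERIV_def)
  then show ?thesis
    by (rule filterlim_compose) (use assms in \<open>auto simp: filterlim_at\<close>)
qed

text \<open>Convexity makes the difference quotient nondecreasing in t > 0, so the directional
  derivative, its limit at 0, is a lower bound for every quotient.\<close>

lemma quotient_ge:
  assumes t: "0 < t"
  shows "A xi \<bullet> eta \<le> (N (xi + t *\<^sub>R eta) powr p / p - N xi powr p / p) / t"
proof -
  \<comment> \<open>A null sequence inside (0, t); the shift by 2 keeps it away from the end
    points.\<close>
  define s where "s j = t / real (j + 2)" for j
  have s: "0 < s j" "s j \<noteq> 0" "s j / t = 1 / real (j + 2)" for j using t by (auto simp: s_def)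
  have "(\<lambda>j. t * inverse (real (j + 2))) \<longlonglongrightarrow> t * 0"
    by (intro tendsto_intros LIMSEQ_ignore_initial_segment[OF lim_inverse_n])
  then have s0: "s \<longlonglongrightarrow> 0" by (simp add: s_def[abs_def] divide_inverse)
  have "(N (xi + s j *\<^sub>R eta) powr p / p - N xi powr p / p) / s j \<le> (N (xi + t *\<^sub>R eta) powr p / p - N xi powr p / p) / t" for j
  proof -
    define th where "th = s j / t"
    have "(1 - th) *\<^sub>R xi + th *\<^sub>R (xi + t *\<^sub>R eta) = xi + s j *\<^sub>R eta"
      using t by (simp add: th_def algebra_simps)
    then have "N (xi + s j *\<^sub>R eta) powr p / p \<le> (1 - th) * (N xi powr p / p) + th * (N (xi + t *\<^sub>R eta) powr p / p)"
      using convex_energy[of th xi "xi + t *\<^sub>R eta"] s[of j] t by (simp add: th_def)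
    then have "N (xi + s j *\<^sub>R eta) powr p / p - N xi powr p / p \<le> th * (N (xi + t *\<^sub>R eta) powr p / p - N xi powr p / p)"
      by (simp add: algebra_simps diff_divide_distrib)
    then have "(N (xi + s j *\<^sub>R eta) powr p / p - N xi powr p / p) / s j \<le> th * (N (xi + t *\<^sub>R eta) powr p / p - N xi powr p / p) / s j"
      using s(1)[of j] by (simp add: divide_right_mono)
    also have "\<dots> = (N (xi + t *\<^sub>R eta) powr p / p - N xi powr p / p) / t" using s(2)[of j] by (simp add: th_def)
    finally show ?thesis .
  qed
  then show ?thesis using difference_quotients[OF s(2) s0, of xi eta] by (intro LIMSEQ_le_const2) auto
qed

lemma gradient_inequality: "A xi \<bullet> (eta - xi) \<le> N eta powr p / p - N xi powr p / p"
  using quotient_ge[of 1 xi "eta - xi"] by simp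

text \<open>Euler's identity for a p-homogeneous function: along the ray through xi the energy is (1
  + t)^p times its value, at least for t > -1, which suffices for the derivative at 0.\<close>

lemma flux_self: "A xi \<bullet> xi = N xi powr p"
proof -
  have "((\<lambda>t::real. (1 + t) powr p * (N xi powr p / p)) has_real_derivative p * (1 + 0) powr (p - 1) * 1 * (N xi powr p / p)) (at 0)"
    by (auto intro!: derivative_eq_intros)
  then have 1: "((\<lambda>t::real. (1 + t) powr p * (N xi powr p / p)) has_real_derivative N xi powr p) (at 0)"
    using p by simp
  have "((\<lambda>t. N (xi + t *\<^sub>R xi) powr p / p) has_real_derivative N xi powr p) (at 0)"
  proof (rule DERIV_cong_ev[THEN iffD2, OF refl _ refl 1])
    have "eventually (\<lambda>t::real. t > -1) (nhds 0)" using eventually_nhds_in_open[of "{-1<..}" "0::real"] by simp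
    then show "eventually (\<lambda>t. N (xi + t *\<^sub>R xi) powr p / p = (1 + t) powr p * (N xi powr p / p)) (nhds 0)"
    proof eventually_elim
      case (elim t)
      have "xi + t *\<^sub>R xi = (1 + t) *\<^sub>R xi" by (simp add: algebra_simps)
      then show ?case using elim nonneg by (simp add: scale powr_mult)
    qed
  qed
  then show ?thesis using DERIV_unique energy_directional by blast
qed

text \<open>The quotients at 0 decay like t^(p-1), so A 0 . h <= 0 for every h; the choice h = A 0
  finishes.\<close>

lemma flux_zero: "A 0 = 0"
proof -
  have "A 0 \<bullet> h \<le> 0" for h
  proof -
    have 1: "((\<lambda>t. t powr (p - 1) * (N h powr p / p)) \<longlongrightarrow> 0) (at_right 0)"
    proof -
      have "((\<lambda>t::real. t powr (p - 1)) \<longlongrightarrow> 0 powr (p - 1)) (at_right 0)"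
        using p by (intro tendsto_powr2 tendsto_intros) (auto intro!: eventually_at_rightI[of 0 1])
      from tendsto_mult_right[OF this, of "N h powr p / p"] show ?thesis by simp
    qed
    have "eventually (\<lambda>t. A 0 \<bullet> h \<le> t powr (p - 1) * (N h powr p / p)) (at_right 0)"
    proof (rule eventually_at_rightI[of 0 1])
      fix t :: real assume t: "t \<in> {0<..<1}"
      have "A 0 \<bullet> h \<le> (N (t *\<^sub>R h) powr p / p) / t"
        using quotient_ge[of t 0 h] t zero_iff[of 0] by simp
      also have "\<dots> = t powr (p - 1) * (N h powr p / p)"
        using t nonneg by (simp add: scale powr_mult powr_diff)
      finally show "A 0 \<bullet> h \<le> t powr (p - 1) * (N h powr p / p)" .
    qed simp
    from tendsto_lowerbound[OF 1 this] show ?thesis by simp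
  qed
  from this[of "A 0"] show ?thesis by (metis inner_eq_zero_iff inner_ge_zero order_antisym)
qed

text \<open>A dual-norm estimate: with eta rescaled to the length of xi, the energies in the
  gradient inequality cancel, and Euler's identity gives the bound.\<close>

lemma flux_le: "A xi \<bullet> eta \<le> N xi powr (p - 1) * N eta"
proof (cases "xi = 0 \<or> eta = 0")
  case True then show ?thesis using flux_zero nonneg by auto
next
  case False
  then have P: "0 < N xi" "0 < N eta" using pos by auto
  define z where "z = (N xi / N eta) *\<^sub>R eta"
  have "N z = N xi" using P by (simp add: z_def scale)
  then have "A xi \<bullet> z \<le> N xi powr p" using gradient_inequality[of xi z] flux_self[of xi] by (simp add: inner_diff_right)
  then have "N xi * (A xi \<bullet> eta) \<le> N xi powr p * N eta" using P by (simp add: z_def field_simps)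
  also have "N xi powr p = N xi * N xi powr (p - 1)" using P by (simp add: powr_diff)
  finally show ?thesis using P by (simp add: mult.assoc)
qed

text \<open>Tested with eta = A xi, the dual estimate becomes a Euclidean one; nu enters with
  exponent p - 1 through N xi and once more through N (A xi).\<close>

lemma norm_flux_le: "norm (A xi) \<le> nu powr p * norm xi powr (p - 1)"
proof -
  have "norm (A xi) * norm (A xi) \<le> N xi powr (p - 1) * N (A xi)"
    using flux_le[of xi "A xi"] by (simp add: power2_norm_eq_inner flip: power2_eq_square)
  also have "\<dots> \<le> (nu * norm xi) powr (p - 1) * (nu * norm (A xi))"
    using p nonneg upper nu_pos by (intro mult_mono powr_mono2) auto
  also have "\<dots> = nu powr p * norm xi powr (p - 1) * norm (A xi)"
    using nu_pos by (simp add: powr_mult powr_diff)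
  finally show ?thesis
    by (cases "A xi = 0") (auto simp: mult_le_cancel_right)
qed

text \<open>For different lengths, strict convexity of s^p decides. For equal lengths both vectors
  lie on one sphere, and uniform convexity after rescaling to the unit sphere puts the midpoint
  strictly inside.\<close>

lemma strictly_convex:
  assumes "xi \<noteq> eta"
  shows "2 * (N ((1/2) *\<^sub>R (xi + eta)) powr p) < N xi powr p + N eta powr p"
proof -
  let ?m = "N ((1/2) *\<^sub>R (xi + eta))"
  have m: "?m \<le> (N xi + N eta) / 2" using triangle[of xi eta] by (simp add: scale)
  \<comment> \<open>Strict midpoint convexity of s^p from the mean value theorem on the two halves,
    since the derivative p s^(p-1) is strictly increasing.\<close>
  have J: "((a + b) / 2) powr p < (a powr p + b powr p) / 2" if ab: "0 \<le> a" "a < b" for a b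
  proof -
    have sm: "c powr (p - 1) < d powr (p - 1)" if "0 \<le> c" "c < d" for c d :: real
      using that p by (intro powr_less_mono2) auto
    define m where "m = (a + b) / 2"
    have am: "a < m" "m < b" "0 \<le> m" using ab by (auto simp: m_def)
    have mvt: "\<exists>z. c < z \<and> z < d \<and> d powr p - c powr p = (d - c) * (p * z powr (p - 1))" if "0 \<le> c" "c < d" for c d :: real
    proof -
      have "\<exists>l z. c < z \<and> z < d \<and> ((\<lambda>x. x powr p) has_real_derivative l) (at z) \<and> d powr p - c powr p = (d - c) * l"
        using that p by (intro MVT) (auto intro!: continuous_intros continuous_on_powr' simp: real_differentiable_def intro!: exI has_real_derivative_powr)
      then obtain l z where z: "c < z" "z < d" "((\<lambda>x. x powr p) has_real_derivative l) (at z)" "d powr p - c powr p = (d - c) * l" by blast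
      moreover have "l = p * z powr (p - 1)" using z that has_real_derivative_powr[of z p] DERIV_unique by force
      ultimately show ?thesis by auto
    qed
    obtain z1 where z1: "a < z1" "z1 < m" "m powr p - a powr p = (m - a) * (p * z1 powr (p - 1))" using mvt[of a m] am ab by auto
    obtain z2 where z2: "m < z2" "z2 < b" "b powr p - m powr p = (b - m) * (p * z2 powr (p - 1))" using mvt[of m b] am ab by auto
    have "z1 powr (p - 1) < z2 powr (p - 1)" using z1 z2 ab by (intro sm) auto
    then have "(b - m) * (p * z1 powr (p - 1)) < (b - m) * (p * z2 powr (p - 1))"
      using p am by simp
    moreover have "m - a = b - m" by (simp add: m_def field_simps)
    ultimately have "m powr p - a powr p < b powr p - m powr p" using z1(3) z2(3) by metis
    then show ?thesis unfolding m_def[symmetric] by simp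
  qed
  show ?thesis
  proof (cases "N xi = N eta")
    case False
    have "?m powr p \<le> ((N xi + N eta) / 2) powr p" using m p nonneg by (intro powr_mono2) auto
    also have "\<dots> < (N xi powr p + N eta powr p) / 2"
      using J[of "N xi" "N eta"] J[of "N eta" "N xi"] False nonneg by (cases "N xi < N eta") (auto simp: add.commute)
    finally show ?thesis by simp
  next
    case True
    define R where "R = N xi"
    have "R \<noteq> 0" using True assms zero_iff unfolding R_def by metis
    then have R: "R > 0" using nonneg[of xi] by (simp add: R_def)
    define u where "u = (1 / R) *\<^sub>R xi" define v where "v = (1 / R) *\<^sub>R eta"
    have Nu: "N u = 1" "N v = 1" using R True by (auto simp: u_def v_def scale R_def)
    have uv: "u - v = (1 / R) *\<^sub>R (xi - eta)" by (simp add: u_def v_def scaleR_diff_right)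
    have e: "0 < N (u - v)" using R assms by (intro pos) (auto simp: uv)
    have "N (u - v) \<le> 2" using triangle[of u "- v"] Nu N_uminus[of v] by simp
    then obtain d where "d > 0" "\<And>u' v'. N u' \<le> 1 \<and> N v' \<le> 1 \<and> N (u' - v') \<ge> N (u - v) \<Longrightarrow> N ((1/2) *\<^sub>R (u' + v')) \<le> 1 - d"
      using uc e unfolding unif_convex_def by metis
    then have "N ((1/2) *\<^sub>R (u + v)) < 1" using Nu by (smt (verit))
    moreover have "(1/2) *\<^sub>R (u + v) = (1 / R) *\<^sub>R ((1/2) *\<^sub>R (xi + eta))" by (simp add: u_def v_def scaleR_add_right mult.commute)
    ultimately have "?m < R" using R by (simp add: scale)
    then have "?m powr p < R powr p" using p nonneg by (intro powr_less_mono2) auto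
    then show ?thesis using True by (simp add: R_def)
  qed
qed

text \<open>The gradient inequalities at both ends, evaluated at the midpoint, are added; strict
  midpoint convexity leaves a positive remainder.\<close>

lemma strictly_monotone:
  assumes "xi \<noteq> eta"
  shows "0 < (A xi - A eta) \<bullet> (xi - eta)"
proof -
  let ?m = "(1/2) *\<^sub>R (xi + eta)"
  have 1: "?m - xi = (1/2) *\<^sub>R (eta - xi)" "?m - eta = - ((1/2) *\<^sub>R (eta - xi))"
    by (auto simp: algebra_simps simp flip: scaleR_add_left)
  have "A xi \<bullet> (eta - xi) / 2 \<le> N ?m powr p / p - N xi powr p / p"
    using gradient_inequality[of xi ?m] unfolding 1 by simp
  moreover have "- (A eta \<bullet> (eta - xi)) / 2 \<le> N ?m powr p / p - N eta powr p / p"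
    using gradient_inequality[of eta ?m] unfolding 1 by simp
  moreover have "2 * (N ?m powr p / p) < N xi powr p / p + N eta powr p / p"
    using strictly_convex[OF assms] p by (simp add: field_simps)
  ultimately show ?thesis by (simp add: inner_diff_left inner_diff_right)
qed

lemma monotone: "0 \<le> (A xi - A eta) \<bullet> (xi - eta)"
  using strictly_monotone[of xi eta] by (cases "xi = eta") auto

text \<open>A z . h is the infimum over t > 0 of difference quotients that are continuous in z, and
  an infimum of continuous functions is upper semicontinuous. Applied to h and -h, this gives
  continuity of the gradient.\<close>

lemma flux_usc:
  assumes "0 < e"
  shows "eventually (\<lambda>z. A z \<bullet> h < A xi \<bullet> h + e) (nhds xi)"
proof -
  define t where "t j = inverse (real (Suc j))" for j
  have t: "0 < t j" "t j \<noteq> 0" for j by (auto simp: t_def)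
  have t0: "t \<longlonglongrightarrow> 0" unfolding t_def by (rule LIMSEQ_inverse_real_of_nat)
  have "eventually (\<lambda>j. (N (xi + t j *\<^sub>R h) powr p / p - N xi powr p / p) / t j < A xi \<bullet> h + e) sequentially"
    using difference_quotients[OF t(2) t0, of xi h] assms by (intro order_tendstoD) auto
  then obtain j where j: "(N (xi + t j *\<^sub>R h) powr p / p - N xi powr p / p) / t j < A xi \<bullet> h + e"
    by (meson eventually_sequentially le_refl)
  have "isCont (\<lambda>u. N u powr p / p) u" for u
    using continuous_on_energy by (simp add: continuous_on_eq_continuous_at)
  then have c: "((\<lambda>u. N u powr p / p) \<longlongrightarrow> N u powr p / p) (nhds u)" for u
    by (intro tendsto_at_iff_tendsto_nhds[THEN iffD1]) (simp add: isCont_def)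
  have "((\<lambda>z. z + t j *\<^sub>R h) \<longlongrightarrow> xi + t j *\<^sub>R h) (nhds xi)"
    by (intro tendsto_intros filterlim_ident)
  from tendsto_divide[OF tendsto_diff[OF filterlim_compose[OF c this] c] tendsto_const t(2)]
  have "((\<lambda>z. (N (z + t j *\<^sub>R h) powr p / p - N z powr p / p) / t j) \<longlongrightarrow> (N (xi + t j *\<^sub>R h) powr p / p - N xi powr p / p) / t j) (nhds xi)"
    by simp
  then have "eventually (\<lambda>z. (N (z + t j *\<^sub>R h) powr p / p - N z powr p / p) / t j < A xi \<bullet> h + e) (nhds xi)"
    using j by (rule order_tendstoD)
  then show ?thesis
    by eventually_elim (use quotient_ge[OF t(1)] in \<open>blast intro: le_less_trans\<close>)
qed

lemma tendsto_flux: "(A \<longlongrightarrow> A xi) (nhds xi)"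
proof -
  have "((\<lambda>z. A z \<bullet> h) \<longlongrightarrow> A xi \<bullet> h) (nhds xi)" for h
  proof (rule tendstoI)
    fix e :: real assume "0 < e"
    from flux_usc[OF this, of h xi] flux_usc[OF this, of "-h" xi]
    show "eventually (\<lambda>z. dist (A z \<bullet> h) (A xi \<bullet> h) < e) (nhds xi)"
      by eventually_elim (auto simp: dist_real_def)
  qed
  then show ?thesis by (subst tendsto_componentwise_iff) auto
qed

lemma continuous_flux: "continuous_on UNIV A"
  using tendsto_flux by (simp add: continuous_on_eq_continuous_at isCont_def tendsto_at_iff_tendsto_nhds)

text \<open>Obtained by differentiating N(z)^p = c^p N(z / c)^p. This homogeneity of degree p - 1 is
  what lets eigenfunctions be normalised.\<close>

lemma flux_scale:
  assumes c: "0 < c"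
  shows "A (c *\<^sub>R xi) = c powr (p - 1) *\<^sub>R A xi"
proof (rule flux_unique)
  have d: "((\<lambda>z. (1 / c) *\<^sub>R z) has_derivative (\<lambda>h. (1 / c) *\<^sub>R h)) (at (c *\<^sub>R xi))"
    by (auto intro!: derivative_eq_intros)
  have "((\<lambda>eta. N eta powr p / p) has_derivative (\<lambda>h. A xi \<bullet> h)) (at ((1 / c) *\<^sub>R c *\<^sub>R xi))"
    using has_derivative_energy c by simp
  from has_derivative_mult_right[OF has_derivative_compose[OF d this], of "c powr p"]
  have "((\<lambda>z. c powr p * (N ((1 / c) *\<^sub>R z) powr p / p)) has_derivative (\<lambda>h. c powr p * (A xi \<bullet> ((1 / c) *\<^sub>R h)))) (at (c *\<^sub>R xi))" .
  moreover have "(\<lambda>z. c powr p * (N ((1 / c) *\<^sub>R z) powr p / p)) = (\<lambda>z. N z powr p / p)"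
    using c nonneg by (auto simp: scale powr_divide)
  moreover have "(\<lambda>h. c powr p * (A xi \<bullet> ((1 / c) *\<^sub>R h))) = (\<lambda>h. (c powr (p - 1) *\<^sub>R A xi) \<bullet> h)"
    using c by (auto simp: powr_diff)
  ultimately show "((\<lambda>eta. N eta powr p / p) has_derivative (\<lambda>h. (c powr (p - 1) *\<^sub>R A xi) \<bullet> h)) (at (c *\<^sub>R xi))"
    by simp
qed

text \<open>A continuous positive function on a compact set of pairs has a positive minimum. The
  bound m depends on R and on the norm, hence on the point x; this dependence forces the later
  detour through almost everywhere convergence.\<close>

lemma monotone_uniform:
  assumes "0 < e"
  obtains m where "0 < m" "\<And>xi eta. norm xi \<le> R \<Longrightarrow> norm eta \<le> R \<Longrightarrow> e \<le> norm (xi - eta) \<Longrightarrow> m \<le> (A xi - A eta) \<bullet> (xi - eta)"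
proof -
  define K where "K = (cball 0 R \<times> cball 0 R) \<inter> {z::'a\<times>'a. e \<le> norm (fst z - snd z)}"
  have K: "compact K" unfolding K_def
    by (intro compact_Int_closed compact_Times compact_cball closed_Collect_le continuous_intros)
  have c1: "continuous_on K (\<lambda>z. A (fst z))" "continuous_on K (\<lambda>z. A (snd z))"
    by (auto intro!: continuous_on_compose2[OF continuous_flux] continuous_intros)
  have c: "continuous_on K (\<lambda>z. (A (fst z) - A (snd z)) \<bullet> (fst z - snd z))"
    by (intro continuous_intros c1)
  show thesis
  proof (cases "K = {}")
    case True
    then show ?thesis using that[of 1] by (force simp: K_def)
  next
    case False
    obtain z where z: "z \<in> K" "\<And>y. y \<in> K \<Longrightarrow> (A (fst z) - A (snd z)) \<bullet> (fst z - snd z) \<le> (A (fst y) - A (snd y)) \<bullet> (fst y - snd y)"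
      using continuous_attains_inf[OF K False c] by blast
    then have "fst z \<noteq> snd z" using assms by (auto simp: K_def)
    then show ?thesis
      by (intro that[of "(A (fst z) - A (snd z)) \<bullet> (fst z - snd z)"] strictly_monotone) (use z(2) in \<open>force simp: K_def\<close>)+
  qed
qed

text \<open>Expanding the product by Euler's identity leaves two cross terms; each may use up a
  quarter of N xi^p, so half of it survives.\<close>

lemma coercive:
  "kappa powr p / 2 * norm xi powr p
     \<le> (A xi - A eta) \<bullet> (xi - eta) + ((1/4) powr (1 - p) + 4 powr (1 / (p - 1))) * nu powr p * norm eta powr p"
proof -
  \<comment> \<open>Solves E^(1-p) = 1/4: in the second cross term it is xi that receives the
    coefficient e^(1-p) of Young's inequality.\<close>
  define E where "E = (4::real) powr (1 / (p - 1))"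
  have E: "E > 0" "E powr (1 - p) = 1/4"
  proof -
    have "E powr (1 - p) = 4 powr (- 1)" using p unfolding E_def powr_powr
      by (intro arg_cong[where f="\<lambda>x. 4 powr x"]) (simp add: field_simps)
    then show "E powr (1 - p) = 1/4" by (simp add: powr_minus)
  qed (simp add: E_def)
  have "A xi \<bullet> eta \<le> (1/4) * N xi powr p + (1/4) powr (1 - p) * N eta powr p"
    using flux_le[of xi eta] Young_powr[of "N xi" "N eta" "1/4" p] p nonneg by auto
  moreover have "A eta \<bullet> xi \<le> E * N eta powr p + (1/4) * N xi powr p"
    using flux_le[of eta xi] Young_powr[of "N eta" "N xi" E p] p nonneg E by auto
  moreover have "(A xi - A eta) \<bullet> (xi - eta) = N xi powr p + N eta powr p - A xi \<bullet> eta - A eta \<bullet> xi"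
    by (simp add: inner_diff_left inner_diff_right flux_self)
  moreover have "0 \<le> N eta powr p" by simp
  ultimately have 1: "N xi powr p / 2 \<le> (A xi - A eta) \<bullet> (xi - eta) + ((1/4) powr (1 - p) + E) * N eta powr p"
    unfolding distrib_right by linarith
  have 2: "kappa powr p * norm xi powr p \<le> N xi powr p"
    using lower[of xi] kappa p powr_mono2[of p "kappa * norm xi" "N xi"] by (simp add: powr_mult)
  have "N eta powr p \<le> nu powr p * norm eta powr p"
    using upper[of eta] nu_pos p powr_mono2[of p "N eta" "nu * norm eta"] nonneg by (simp add: powr_mult)
  then have "((1/4) powr (1 - p) + E) * N eta powr p \<le> ((1/4) powr (1 - p) + E) * (nu powr p * norm eta powr p)"
    using E by (intro mult_left_mono) auto
  with 1 2 show ?thesis unfolding E_def by (simp add: algebra_simps)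
qed

end

section \<open>Ball averages and the Schur test\<close>

text \<open>Jensen's inequality through the tangent line of s^p. Only an upper bound on the mass and
  a lower bound on the integral of f enter, and the right-hand side may be infinite.\<close>

lemma power_mean_nn_integral:
  fixes f :: "'a \<Rightarrow> real"
  assumes nu: "emeasure nu (space nu) \<le> ennreal I" "0 < I" and [measurable]: "f \<in> borel_measurable nu"
    and nn: "\<And>x. 0 \<le> f x" and D: "0 \<le> D" "ennreal D \<le> (\<integral>\<^sup>+x. ennreal (f x) \<partial>nu)" and p: "1 < p"
  shows "ennreal (D powr p) \<le> ennreal (I powr (p - 1)) * (\<integral>\<^sup>+x. ennreal (f x powr p) \<partial>nu)"
proof (cases "D = 0")
  case False
  \<comment> \<open>For mass I and integral D the mean value is the tangent point at which the
    estimate is sharp.\<close>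
  define c where "c = D / I"
  have c: "0 < c" using D False nu by (simp add: c_def)
  have tangent: "p * c powr (p - 1) * a \<le> a powr p + (p - 1) * c powr p" if "0 \<le> a" for a
  proof -
    have "a * c powr (p - 1) \<le> a powr p / p + (c powr (p - 1)) powr (p / (p - 1)) / (p / (p - 1))"
      using p that by (intro Youngs_inequality) (auto simp: field_simps)
    also have "(c powr (p - 1)) powr (p / (p - 1)) = c powr p" using p by (simp add: powr_powr)
    finally have "p * (a * c powr (p - 1)) \<le> p * (a powr p / p + c powr p / (p / (p - 1)))"
      using p by (intro mult_left_mono) auto
    also have "\<dots> = a powr p + (p - 1) * c powr p" using p by (simp add: field_simps)
    finally show ?thesis by (simp add: mult_ac)
  qed
  define S where "S = (\<integral>\<^sup>+x. ennreal (f x powr p) \<partial>nu)"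
  have "ennreal (p * c powr (p - 1) * D) \<le> ennreal (p * c powr (p - 1)) * (\<integral>\<^sup>+x. ennreal (f x) \<partial>nu)"
    using D p by (simp add: ennreal_mult mult_left_mono)
  also have "\<dots> = (\<integral>\<^sup>+x. ennreal (p * c powr (p - 1) * f x) \<partial>nu)"
    using p nn by (subst nn_integral_cmult[symmetric]) (auto simp: ennreal_mult[symmetric])
  also have "\<dots> \<le> (\<integral>\<^sup>+x. ennreal (f x powr p) + ennreal ((p - 1) * c powr p) \<partial>nu)"
    using tangent nn p by (intro nn_integral_mono) (auto simp: ennreal_plus[symmetric] simp del: ennreal_plus intro!: ennreal_leI)
  also have "\<dots> = S + ennreal ((p - 1) * c powr p) * emeasure nu (space nu)"
    by (simp add: nn_integral_add S_def)
  also have "\<dots> \<le> S + ennreal ((p - 1) * c powr p) * ennreal I"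
    using nu by (intro add_left_mono mult_left_mono) auto
  also have "\<dots> = S + ennreal ((p - 1) * c powr p * I)"
    using p nu by (simp add: ennreal_mult)
  finally have main: "ennreal (p * c powr (p - 1) * D) \<le> S + ennreal ((p - 1) * c powr p * I)" .
  show ?thesis
  proof (cases S)
    case (real s)
    have D': "D = c * I" using nu by (simp add: c_def)
    have cc: "c powr (p - 1) * c = c powr p" using c by (simp add: powr_diff)
    have "p * c powr (p - 1) * D = p * (c powr p * I)"
      unfolding D' using cc by (simp add: mult_ac)
    with main have "p * (c powr p * I) \<le> s + (p - 1) * c powr p * I"
      using real p nu by (simp add: ennreal_plus[symmetric] del: ennreal_plus)
    then have "c powr p * I \<le> s" by (simp add: algebra_simps)
    then have "I powr (p - 1) * (c powr p * I) \<le> I powr (p - 1) * s" by (intro mult_left_mono) auto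
    moreover have "I powr (p - 1) * (c powr p * I) = D powr p"
      using c nu by (simp add: D' powr_mult powr_diff)
    ultimately have "D powr p \<le> I powr (p - 1) * s" by simp
    then show ?thesis
      using real nu by (simp add: S_def[symmetric] ennreal_mult[symmetric] ennreal_leI)
  next
    case top
    then show ?thesis using nu by (simp add: S_def[symmetric] ennreal_mult_top)
  qed
qed simp

section \<open>Ball averages and the truncated Riesz potential\<close>

lemma ball_in_sets_borel [measurable]: "ball (c::'a::euclidean_space) r \<in> sets borel"
  by simp

lemma nn_integral_ball_affine:
  fixes f :: "'a::euclidean_space \<Rightarrow> ennreal"
  assumes [measurable]: "f \<in> borel_measurable borel" and t: "0 < t"
  shows "(\<integral>\<^sup>+z. indicator (ball 0 r) z * f (x + t *\<^sub>R z) \<partial>lborel)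
     = ennreal (t powr - real DIM('a)) * (\<integral>\<^sup>+y. indicator (ball 0 (t * r)) y * f (x + y) \<partial>lborel)"
proof -
  have "(\<integral>\<^sup>+y. indicator (ball 0 (t * r)) y * f (x + y) \<partial>lborel)
      = (\<integral>\<^sup>+y. ennreal (t ^ DIM('a)) * (indicator (ball 0 (t * r)) (t *\<^sub>R y) * f (x + t *\<^sub>R y)) \<partial>lborel)"
    using t by (subst lborel_affine[of t 0]) (simp_all add: nn_integral_density nn_integral_distr)
  also have "\<dots> = (\<integral>\<^sup>+y. ennreal (t ^ DIM('a)) * (indicator (ball 0 r) y * f (x + t *\<^sub>R y)) \<partial>lborel)"
    using t by (intro nn_integral_cong) (auto simp: indicator_def)
  also have "\<dots> = ennreal (t ^ DIM('a)) * (\<integral>\<^sup>+y. indicator (ball 0 r) y * f (x + t *\<^sub>R y) \<partial>lborel)"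
    by (rule nn_integral_cmult) measurable
  finally show ?thesis
    using t by (simp add: mult.assoc[symmetric] ennreal_mult[symmetric] powr_realpow[symmetric] powr_add[symmetric])
qed

lemma nn_integral_lborel_translate:
  fixes f :: "'a::euclidean_space \<Rightarrow> ennreal"
  assumes [measurable]: "f \<in> borel_measurable borel"
  shows "(\<integral>\<^sup>+y. f (x + y) \<partial>lborel) = (\<integral>\<^sup>+y. f y \<partial>lborel)"
  by (subst (2) lborel_affine[of 1 x]) (simp_all add: nn_integral_density nn_integral_distr)

text \<open>The ball is kept at the origin and the integrand translated, so that measurability in x
  and the substitution y = t z apply directly.\<close>

definition ball_avg :: "real \<Rightarrow> ('a::euclidean_space \<Rightarrow> real) \<Rightarrow> 'a \<Rightarrow> real" where
  "ball_avg r u x = (LINT z|lborel. indicator (ball 0 r) z * u (x + z)) / (unit_ball_vol (real DIM('a)) * r ^ DIM('a))"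

lemma borel_measurable_ball_avg [measurable]:
  assumes [measurable]: "u \<in> borel_measurable borel"
  shows "ball_avg r u \<in> borel_measurable borel"
  unfolding ball_avg_def[abs_def] by measurable

lemma measure_ball_unit_ball_vol:
  assumes "0 \<le> r"
  shows "measure lborel (ball (c::'a::euclidean_space) r) = unit_ball_vol (real DIM('a)) * r ^ DIM('a)"
  using emeasure_ball[OF assms, of c] by (simp add: measure_def assms)

lemma integrable_ball_continuous:
  fixes u :: "'a::euclidean_space \<Rightarrow> real"
  assumes "continuous_on UNIV u"
  shows "integrable lborel (\<lambda>z. indicator (ball 0 r) z * u (x + z))"
proof -
  have [measurable]: "u \<in> borel_measurable borel" using assms by (rule borel_measurable_continuous_onI)
  have "integrable lborel (\<lambda>z. indicator (cball 0 r) z *\<^sub>R u (x + z))"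
    by (rule borel_integrable_compact) (auto intro!: continuous_on_compose2[OF assms] continuous_intros)
  then show ?thesis
    by (rule Bochner_Integration.integrable_bound) (auto simp: indicator_def)
qed

text \<open>The fundamental theorem along the segment from x to x + z, kept as a nonnegative
  integral so that it can enter Tonelli's theorem.\<close>

lemma segment_increment_le:
  fixes u :: "'a::euclidean_space \<Rightarrow> real"
  assumes der: "\<And>x. (u has_derivative (\<lambda>h. G x \<bullet> h)) (at x)" and cont: "continuous_on UNIV G"
  shows "ennreal \<bar>u (x + z) - u x\<bar> \<le> (\<integral>\<^sup>+t. indicator {0..1} t * ennreal (norm (G (x + t *\<^sub>R z)) * norm z) \<partial>lborel)"
proof -
  let ?f = "\<lambda>t. G (x + t *\<^sub>R z) \<bullet> z"
  have c: "continuous_on {0..1} ?f"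
    by (intro continuous_intros continuous_on_compose2[OF cont]) auto
  have d: "((\<lambda>t. u (x + t *\<^sub>R z)) has_vector_derivative ?f t) (at t within {0..1})" for t
  proof -
    have "((\<lambda>t. x + t *\<^sub>R z) has_derivative (\<lambda>s. s *\<^sub>R z)) (at t within {0..1})"
      by (auto intro!: derivative_eq_intros)
    from has_derivative_compose[OF this der] show ?thesis
      by (simp add: has_vector_derivative_def)
  qed
  have I: "integrable lborel (\<lambda>t. indicator {0..1} t *\<^sub>R ?f t)"
    by (rule borel_integrable_compact[OF _ c]) auto
  have "(LINT t|lborel. indicator {0..1} t *\<^sub>R ?f t) = u (x + z) - u x"
    using integral_FTC_Icc[OF _ d c] by simp
  then have "ennreal \<bar>u (x + z) - u x\<bar> \<le> (\<integral>\<^sup>+t. norm (indicator {0..1} t *\<^sub>R ?f t) \<partial>lborel)"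
    using integral_norm_bound_ennreal[OF I] by simp
  also have "\<dots> \<le> (\<integral>\<^sup>+t. indicator {0..1} t * ennreal (norm (G (x + t *\<^sub>R z)) * norm z) \<partial>lborel)"
    by (intro nn_integral_mono) (auto simp: indicator_def Cauchy_Schwarz_ineq2 intro!: ennreal_leI)
  finally show ?thesis .
qed

text \<open>For fixed y the condition |y| < t r means t > |y| / r, so the integral of t^(-n) from
  there to 1 produces the singularity |y|^(1-n). The contribution of the upper end point is negative
  and is dropped.\<close>

lemma radial_kernel_le:
  fixes y :: "'a::euclidean_space"
  assumes n: "2 \<le> DIM('a)" and r: "0 < r" and y: "y \<noteq> 0"
  shows "(\<integral>\<^sup>+t. indicator {0<..1} t * (indicator (ball 0 (t * r)) y * ennreal (t powr - real DIM('a))) \<partial>lborel)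
    \<le> indicator (ball 0 r) y * ennreal (r powr (real DIM('a) - 1) / (real DIM('a) - 1) * norm y powr (1 - real DIM('a)))"
proof -
  let ?n = "real DIM('a)"
  define a where "a = norm y / r"
  have a: "0 < a" using r y by (simp add: a_def)
  have n1: "?n - 1 > 0" using n by simp
  show ?thesis
  proof (cases "norm y < r")
    case False
    have "indicator {0<..1} t * (indicator (ball 0 (t * r)) y * ennreal (t powr - ?n)) = 0" for t
    proof -
      have "\<not> norm y < t * r" if "0 < t" "t \<le> 1"
      proof -
        have "t * r \<le> 1 * r" using that r by (intro mult_right_mono) auto
        then show ?thesis using False by linarith
      qed
      then show ?thesis by (auto simp: indicator_def)
    qed
    then have "(\<lambda>t. indicator {0<..1} t * (indicator (ball 0 (t * r)) y * ennreal (t powr - ?n))) = (\<lambda>t. 0)" by (intro ext)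
    then show ?thesis by (simp only: nn_integral_const mult_zero_left zero_le)
  next
    case True
    then have a1: "a \<le> 1" using r by (simp add: a_def)
    have "(\<integral>\<^sup>+t. indicator {0<..1} t * (indicator (ball 0 (t * r)) y * ennreal (t powr - ?n)) \<partial>lborel)
      \<le> (\<integral>\<^sup>+t. ennreal (t powr - ?n) * indicator {a..1} t \<partial>lborel)"
    proof (rule nn_integral_mono)
      fix t
      have "a \<le> t" if "norm y < t * r" using that r by (simp add: a_def field_simps)
      then show "indicator {0<..1} t * (indicator (ball 0 (t * r)) y * ennreal (t powr - ?n)) \<le> ennreal (t powr - ?n) * indicator {a..1} t"
        by (auto simp: indicator_def)
    qed
    also have "\<dots> = ennreal (1 powr (1 - ?n) / (1 - ?n) - a powr (1 - ?n) / (1 - ?n))"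
    proof (rule nn_integral_FTC_Icc)
      fix t :: real assume "t \<in> {a..1}"
      then have "((\<lambda>t. t powr (1 - ?n) / (1 - ?n)) has_real_derivative (1 - ?n) * t powr (1 - ?n - 1) / (1 - ?n)) (at t)"
        using a n1 by (intro DERIV_cdivide has_real_derivative_powr) auto
      moreover have "1 - ?n - 1 = - ?n" "\<And>b. (1 - ?n) * b / (1 - ?n) = b" using n1 by auto
      ultimately show "((\<lambda>t. t powr (1 - ?n) / (1 - ?n)) has_real_derivative t powr - ?n) (at t)"
        by (simp only:)
    qed (use a1 in auto)
    also have "\<dots> \<le> ennreal (a powr (1 - ?n) / (?n - 1))"
    proof (rule ennreal_leI)
      have neg: "b / (1 - ?n) = - (b / (?n - 1))" for b by (metis minus_diff_eq minus_divide_right)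
      have "0 \<le> 1 / (?n - 1)" using n1 by simp
      then show "1 powr (1 - ?n) / (1 - ?n) - a powr (1 - ?n) / (1 - ?n) \<le> a powr (1 - ?n) / (?n - 1)"
        unfolding neg powr_one_eq_one by linarith
    qed
    also have "a powr (1 - ?n) / (?n - 1) = r powr (?n - 1) / (?n - 1) * norm y powr (1 - ?n)"
    proof -
      have "r powr (?n - 1) * r powr (1 - ?n) = 1" using r by (simp flip: powr_add)
      then have "norm y powr (1 - ?n) / r powr (1 - ?n) = r powr (?n - 1) * norm y powr (1 - ?n)"
        using r by (simp add: divide_eq_eq mult.assoc mult.left_commute)
      then show ?thesis using r by (simp only: a_def powr_divide norm_ge_zero less_imp_le) simp
    qed
    finally show ?thesis using True by simp
  qed
qed

text \<open>Average the fundamental theorem of calculus over the segments from the centre; integrating out the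
  position on the segment turns the gradient terms into a truncated Riesz potential.\<close>
lemma ball_avg_diff_le:
  fixes u :: "'a::euclidean_space \<Rightarrow> real"
  assumes n: "2 \<le> DIM('a)" and r: "0 < r"
    and der: "\<And>x. (u has_derivative (\<lambda>h. G x \<bullet> h)) (at x)" and cont: "continuous_on UNIV G"
  shows "ennreal (unit_ball_vol (real DIM('a)) * (real DIM('a) - 1) * \<bar>u x - ball_avg r u x\<bar>)
     \<le> (\<integral>\<^sup>+y. indicator (ball 0 r) y * ennreal (norm y powr (1 - real DIM('a)) * norm (G (x + y))) \<partial>lborel)"
proof -
  let ?n = "real DIM('a)" let ?v = "unit_ball_vol ?n"
  have n1: "?n - 1 > 0" using n by simp
  have v: "?v > 0" by simp
  have contu: "continuous_on UNIV u"
    using der by (auto simp: continuous_on_eq_continuous_at intro: has_derivative_continuous)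
  have [measurable]: "u \<in> borel_measurable borel" "G \<in> borel_measurable borel"
    using contu cont by (auto intro: borel_measurable_continuous_onI)
  define c where "c = ?v * r ^ DIM('a)"
  have c: "c > 0" using v r by (simp add: c_def)
  have I1: "integrable lborel (\<lambda>z::'a. indicator (ball 0 r) z * u x)"
    using integrable_ball_continuous[of "\<lambda>_. u x" r 0] by simp
  have I2: "integrable lborel (\<lambda>z. indicator (ball 0 r) z * u (x + z))"
    by (rule integrable_ball_continuous[OF contu])
  have "(LINT z::'a|lborel. indicator (ball 0 r) z * u x) = c * u x"
    using measure_ball_unit_ball_vol[of r "0::'a"] r by (simp add: c_def)
  then have ceq: "c * (u x - ball_avg r u x) = (LINT z::'a|lborel. indicator (ball 0 r) z * u x - indicator (ball 0 r) z * u (x + z))"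
    unfolding Bochner_Integration.integral_diff[OF I1 I2] using c by (simp only: ball_avg_def c_def[symmetric] right_diff_distrib) simp
  then have "ennreal (c * \<bar>u x - ball_avg r u x\<bar>) = ennreal (norm (LINT z|lborel. indicator (ball 0 r) z * u x - indicator (ball 0 r) z * u (x + z)))"
    using c by (simp only: ceq[symmetric] real_norm_def abs_mult) simp
  also have "\<dots> \<le> (\<integral>\<^sup>+z. norm (indicator (ball 0 r) z * u x - indicator (ball 0 r) z * u (x + z)) \<partial>lborel)"
    by (rule integral_norm_bound_ennreal) (use I1 I2 in auto)
  also have "\<dots> = (\<integral>\<^sup>+z. indicator (ball 0 r) z * ennreal \<bar>u (x + z) - u x\<bar> \<partial>lborel)"
    by (intro nn_integral_cong) (auto simp: indicator_def abs_minus_commute)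
  also have "\<dots> \<le> (\<integral>\<^sup>+z. indicator (ball 0 r) z * (\<integral>\<^sup>+t. indicator {0..1} t * ennreal (norm (G (x + t *\<^sub>R z)) * norm z) \<partial>lborel) \<partial>lborel)"
    by (intro nn_integral_mono mult_left_mono segment_increment_le[OF der cont]) auto
  \<comment> \<open>The length of z is bounded by r, and the null point t = 0 is removed because the
    substitution y = t z degenerates there.\<close>
  also have "\<dots> \<le> (\<integral>\<^sup>+z. (\<integral>\<^sup>+t. ennreal r * (indicator {0<..1} t * (indicator (ball 0 r) z * ennreal (norm (G (x + t *\<^sub>R z))))) \<partial>lborel) \<partial>lborel)"
  proof (rule nn_integral_mono)
    fix z :: 'a
    have "indicator (ball 0 r) z * (\<integral>\<^sup>+t. indicator {0..1} t * ennreal (norm (G (x + t *\<^sub>R z)) * norm z) \<partial>lborel)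
      = (\<integral>\<^sup>+t. indicator (ball 0 r) z * (indicator {0..1} t * ennreal (norm (G (x + t *\<^sub>R z)) * norm z)) \<partial>lborel)"
      by (rule nn_integral_cmult[symmetric]) measurable
    also have "\<dots> \<le> (\<integral>\<^sup>+t. ennreal r * (indicator {0<..1} t * (indicator (ball 0 r) z * ennreal (norm (G (x + t *\<^sub>R z))))) \<partial>lborel)"
    proof (rule nn_integral_mono_AE)
      show "AE t in lborel. indicator (ball 0 r) z * (indicator {0..1} t * ennreal (norm (G (x + t *\<^sub>R z)) * norm z))
         \<le> ennreal r * (indicator {0<..1} t * (indicator (ball 0 r) z * ennreal (norm (G (x + t *\<^sub>R z)))))"
        using AE_lborel_singleton[of "0::real"]
      proof eventually_elim
        case (elim t)
        have "norm (G (x + t *\<^sub>R z)) * norm z \<le> r * norm (G (x + t *\<^sub>R z))" if "norm z < r"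
          using that by (subst mult.commute) (intro mult_right_mono, auto)
        then show ?case using elim r by (auto simp: indicator_def ennreal_mult[symmetric] intro!: ennreal_leI)
      qed
    qed
    finally show "indicator (ball 0 r) z * (\<integral>\<^sup>+t. indicator {0..1} t * ennreal (norm (G (x + t *\<^sub>R z)) * norm z) \<partial>lborel)
      \<le> (\<integral>\<^sup>+t. ennreal r * (indicator {0<..1} t * (indicator (ball 0 r) z * ennreal (norm (G (x + t *\<^sub>R z))))) \<partial>lborel)" .
  qed
  also have "\<dots> = (\<integral>\<^sup>+t. (\<integral>\<^sup>+z. ennreal r * (indicator {0<..1} t * (indicator (ball 0 r) z * ennreal (norm (G (x + t *\<^sub>R z))))) \<partial>lborel) \<partial>lborel)"
    by (rule lborel_pair.Fubini') measurable
  also have "\<dots> = (\<integral>\<^sup>+t. (\<integral>\<^sup>+y. ennreal r * (indicator {0<..1} t * (indicator (ball 0 (t * r)) y * ennreal (t powr - ?n)) * ennreal (norm (G (x + y)))) \<partial>lborel) \<partial>lborel)"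
  proof (rule nn_integral_cong)
    fix t :: real
    show "(\<integral>\<^sup>+z. ennreal r * (indicator {0<..1} t * (indicator (ball 0 r) z * ennreal (norm (G (x + t *\<^sub>R z))))) \<partial>lborel)
      = (\<integral>\<^sup>+y. ennreal r * (indicator {0<..1} t * (indicator (ball 0 (t * r)) y * ennreal (t powr - ?n)) * ennreal (norm (G (x + y)))) \<partial>lborel)"
    proof (cases "0 < t \<and> t \<le> 1")
      case True
      have "(\<integral>\<^sup>+z. ennreal r * (indicator {0<..1} t * (indicator (ball 0 r) z * ennreal (norm (G (x + t *\<^sub>R z))))) \<partial>lborel)
         = ennreal r * (\<integral>\<^sup>+z. indicator (ball 0 r) z * ennreal (norm (G (x + t *\<^sub>R z))) \<partial>lborel)"
        using True by (subst nn_integral_cmult[symmetric]) auto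
      also have "\<dots> = ennreal r * (ennreal (t powr - ?n) * (\<integral>\<^sup>+y. indicator (ball 0 (t * r)) y * ennreal (norm (G (x + y))) \<partial>lborel))"
        using True by (subst nn_integral_ball_affine) auto
      also have "\<dots> = (\<integral>\<^sup>+y. ennreal r * (ennreal (t powr - ?n) * (indicator (ball 0 (t * r)) y * ennreal (norm (G (x + y))))) \<partial>lborel)"
        by (simp add: nn_integral_cmult)
      also have "\<dots> = (\<integral>\<^sup>+y. ennreal r * (indicator {0<..1} t * (indicator (ball 0 (t * r)) y * ennreal (t powr - ?n)) * ennreal (norm (G (x + y)))) \<partial>lborel)"
        using True by (intro nn_integral_cong) (simp add: mult_ac)
      finally show ?thesis .
    qed auto
  qed
  also have "\<dots> = (\<integral>\<^sup>+y. (\<integral>\<^sup>+t. ennreal r * (indicator {0<..1} t * (indicator (ball 0 (t * r)) y * ennreal (t powr - ?n)) * ennreal (norm (G (x + y)))) \<partial>lborel) \<partial>lborel)"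
  proof (rule lborel_pair.Fubini'[symmetric])
    have "(\<lambda>(t, y::'a). indicator (ball 0 (t * r)) y :: ennreal) = (\<lambda>z. indicator {z. norm (snd z) < fst z * r} z)"
      by (auto simp: indicator_def)
    moreover have "\<dots> \<in> borel_measurable (lborel \<Otimes>\<^sub>M lborel)" by measurable
    ultimately have [measurable]: "(\<lambda>(t, y::'a). indicator (ball 0 (t * r)) y :: ennreal) \<in> borel_measurable (lborel \<Otimes>\<^sub>M lborel)" by simp
    show "(\<lambda>(t, y::'a). ennreal r * (indicator {0<..1} t * (indicator (ball 0 (t * r)) y * ennreal (t powr - ?n)) * ennreal (norm (G (x + y))))) \<in> borel_measurable (lborel \<Otimes>\<^sub>M lborel)"
      by measurable
  qed
  also have "\<dots> = (\<integral>\<^sup>+y. ennreal r * (\<integral>\<^sup>+t. indicator {0<..1} t * (indicator (ball 0 (t * r)) y * ennreal (t powr - ?n)) \<partial>lborel) * ennreal (norm (G (x + y))) \<partial>lborel)"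
  proof (rule nn_integral_cong)
    fix y :: 'a
    have [measurable]: "(\<lambda>t. indicator (ball 0 (t * r)) y :: ennreal) \<in> borel_measurable lborel"
    proof -
      have "(\<lambda>t. indicator (ball 0 (t * r)) y :: ennreal) = indicator {t. norm y < t * r}" by (auto simp: indicator_def)
      then show ?thesis by simp
    qed
    show "(\<integral>\<^sup>+t. ennreal r * (indicator {0<..1} t * (indicator (ball 0 (t * r)) y * ennreal (t powr - ?n)) * ennreal (norm (G (x + y)))) \<partial>lborel)
      = ennreal r * (\<integral>\<^sup>+t. indicator {0<..1} t * (indicator (ball 0 (t * r)) y * ennreal (t powr - ?n)) \<partial>lborel) * ennreal (norm (G (x + y)))"
      by (subst nn_integral_cmult, measurable, subst nn_integral_multc, measurable) (simp only: mult.assoc)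
  qed
  \<comment> \<open>The powers r and r^(n-1) combine to r^n, which cancels against the volume of the
    ball: the final estimate has no r in its constant.\<close>
  also have "\<dots> \<le> (\<integral>\<^sup>+y. ennreal (r ^ DIM('a) / (?n - 1)) * (indicator (ball 0 r) y * ennreal (norm y powr (1 - ?n) * norm (G (x + y)))) \<partial>lborel)"
  proof (rule nn_integral_mono_AE)
    show "AE y in lborel. ennreal r * (\<integral>\<^sup>+t. indicator {0<..1} t * (indicator (ball 0 (t * r)) y * ennreal (t powr - ?n)) \<partial>lborel) * ennreal (norm (G (x + y)))
      \<le> ennreal (r ^ DIM('a) / (?n - 1)) * (indicator (ball 0 r) y * ennreal (norm y powr (1 - ?n) * norm (G (x + y))))"
      using AE_lborel_singleton[of "0::'a"]
    proof eventually_elim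
      case (elim y)
      have nn: "0 \<le> r powr (?n - 1) / (?n - 1) * norm y powr (1 - ?n)" using n1 by simp
      have gen: "ennreal (d * a) * ennreal b = ennreal d * ennreal (a * b)" if "0 \<le> d" "0 \<le> a" "0 \<le> b" for a b d
        using that by (simp add: ennreal_mult mult.assoc)
      have rr: "r * (r powr (?n - 1) / (?n - 1) * a) = r ^ DIM('a) / (?n - 1) * a" for a
        using r powr_realpow[of r "DIM('a)"] by (simp add: powr_diff)
      have "ennreal r * (\<integral>\<^sup>+t. indicator {0<..1} t * (indicator (ball 0 (t * r)) y * ennreal (t powr - ?n)) \<partial>lborel) * ennreal (norm (G (x + y)))
        \<le> ennreal r * (indicator (ball 0 r) y * ennreal (r powr (?n - 1) / (?n - 1) * norm y powr (1 - ?n))) * ennreal (norm (G (x + y)))"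
        by (intro mult_left_mono mult_right_mono radial_kernel_le n r elim) auto
      also have "\<dots> = indicator (ball 0 r) y * (ennreal r * ennreal (r powr (?n - 1) / (?n - 1) * norm y powr (1 - ?n)) * ennreal (norm (G (x + y))))"
        by (simp add: mult_ac)
      also have "ennreal r * ennreal (r powr (?n - 1) / (?n - 1) * norm y powr (1 - ?n)) = ennreal (r ^ DIM('a) / (?n - 1) * norm y powr (1 - ?n))"
        using r nn by (subst ennreal_mult[symmetric]) (simp_all only: rr less_imp_le)
      also have "\<dots> * ennreal (norm (G (x + y))) = ennreal (r ^ DIM('a) / (?n - 1)) * ennreal (norm y powr (1 - ?n) * norm (G (x + y)))"
        using r n1 by (intro gen) auto
      finally show ?case by (simp only: mult.left_commute)
    qed
  qed
  also have "\<dots> = ennreal (r ^ DIM('a) / (?n - 1)) * (\<integral>\<^sup>+y. (indicator (ball 0 r) y * ennreal (norm y powr (1 - ?n) * norm (G (x + y)))) \<partial>lborel)"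
    by (rule nn_integral_cmult) measurable
  finally have fin: "ennreal (c * \<bar>u x - ball_avg r u x\<bar>) \<le> ennreal (r ^ DIM('a) / (?n - 1)) * (\<integral>\<^sup>+y. (indicator (ball 0 r) y * ennreal (norm y powr (1 - ?n) * norm (G (x + y)))) \<partial>lborel)" .
  have "ennreal (?v * (?n - 1) * \<bar>u x - ball_avg r u x\<bar>) = ennreal ((?n - 1) / r ^ DIM('a)) * ennreal (c * \<bar>u x - ball_avg r u x\<bar>)"
    using r n1 c by (subst ennreal_mult[symmetric]) (auto simp: c_def)
  also have "\<dots> \<le> ennreal ((?n - 1) / r ^ DIM('a)) * (ennreal (r ^ DIM('a) / (?n - 1)) * (\<integral>\<^sup>+y. (indicator (ball 0 r) y * ennreal (norm y powr (1 - ?n) * norm (G (x + y)))) \<partial>lborel))"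
    by (intro mult_left_mono fin) auto
  also have "\<dots> = (\<integral>\<^sup>+y. (indicator (ball 0 r) y * ennreal (norm y powr (1 - ?n) * norm (G (x + y)))) \<partial>lborel)"
  proof -
    have "ennreal ((?n - 1) / r ^ DIM('a)) * ennreal (r ^ DIM('a) / (?n - 1)) = 1"
      using r n1 by (subst ennreal_mult[symmetric]) auto
    then show ?thesis by (simp only: mult.assoc[symmetric] mult_1)
  qed
  finally show ?thesis .
qed

text \<open>The integrand |y|^(1-n) |G| is split as beta |y|^(-n) times |y| |G| / beta. Jensen with
  respect to the first factor, of mass at most I, gives I^(p-1) and the kernel beta^(1-p) |y|^(p-n);
  after the integrals are exchanged, J bounds the latter against \<open>mu\<close>, uniformly in the
  centre.\<close>

lemma gradient_Schur_test:
  fixes u :: "'a::euclidean_space \<Rightarrow> real" and mu :: "'a measure" and beta :: "real \<Rightarrow> real"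
  assumes n: "2 \<le> DIM('a)" and r: "0 < r" and p: "1 < p"
    and sets_mu: "sets mu = sets borel" and sf: "sigma_finite_measure mu"
    and beta[measurable]: "beta \<in> borel_measurable borel" and bpos: "\<And>s. 0 < s \<Longrightarrow> s < r \<Longrightarrow> 0 < beta s"
    and I: "0 < I" "(\<integral>\<^sup>+y. indicator (ball 0 r) (y::'a) * ennreal (beta (norm y) * norm y powr - real DIM('a)) \<partial>lborel) \<le> ennreal I"
    and J: "0 \<le> J" "\<And>y. (\<integral>\<^sup>+x. indicator (ball y r) x * ennreal (beta (norm (x - y)) powr (1 - p) * norm (x - y) powr (p - real DIM('a))) \<partial>mu) \<le> ennreal J"
    and der: "\<And>x. (u has_derivative (\<lambda>h. G x \<bullet> h)) (at x)" and cont: "continuous_on UNIV G"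
  shows "(\<integral>\<^sup>+x. ennreal (\<bar>u x - ball_avg r u x\<bar> powr p) \<partial>mu)
    \<le> ennreal ((unit_ball_vol (real DIM('a)) * (real DIM('a) - 1)) powr (- p) * I powr (p - 1) * J)
       * (\<integral>\<^sup>+y. ennreal (norm (G y) powr p) \<partial>lborel)"
proof -
  let ?n = "real DIM('a)"
  define c where "c = unit_ball_vol ?n * (?n - 1)"
  have c: "c > 0" using n by (simp add: c_def)
  have contu: "continuous_on UNIV u"
    using der by (auto simp: continuous_on_eq_continuous_at intro: has_derivative_continuous)
  have [measurable]: "u \<in> borel_measurable borel" "G \<in> borel_measurable borel"
    using contu cont by (auto intro: borel_measurable_continuous_onI)
  note [measurable_cong] = sets_mu
  interpret pair_sigma_finite mu lborel using sf by (simp add: pair_sigma_finite_def lborel.sigma_finite_measure_axioms)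
  define k where "k s = beta s powr (1 - p) * s powr (p - ?n)" for s
  have [measurable]: "k \<in> borel_measurable borel" unfolding k_def by measurable
  have k0: "0 \<le> k s" for s by (simp add: k_def)
  define nu where "nu = density lborel (\<lambda>y::'a. indicator (ball 0 r) y * ennreal (beta (norm y) * norm y powr - ?n))"
  have nu: "emeasure nu (space nu) \<le> ennreal I"
    using I by (simp add: nu_def emeasure_density)
  have pt: "ennreal ((c * \<bar>u x - ball_avg r u x\<bar>) powr p)
     \<le> ennreal (I powr (p - 1)) * (\<integral>\<^sup>+y. indicator (ball x r) y * ennreal (k (norm (y - x))) * ennreal (norm (G y) powr p) \<partial>lborel)" for x
  proof -
    \<comment> \<open>The second factor of the splitting; the value 0 at the centre and outside the
      ball keeps it nonnegative where the sign of \<open>beta\<close> is unknown.\<close>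
    define f where "f y = (if norm y < r \<and> y \<noteq> 0 then norm (G (x + y)) * norm y / beta (norm y) else 0)" for y
    have [measurable]: "f \<in> borel_measurable borel" unfolding f_def by measurable
    have f0: "0 \<le> f y" for y using bpos[of "norm y"] by (auto simp: f_def)
    have "ennreal (c * \<bar>u x - ball_avg r u x\<bar>) \<le> (\<integral>\<^sup>+y. indicator (ball 0 r) y * ennreal (norm y powr (1 - ?n) * norm (G (x + y))) \<partial>lborel)"
      unfolding c_def by (rule ball_avg_diff_le[OF n r der cont])
    also have "\<dots> = (\<integral>\<^sup>+y. ennreal (f y) \<partial>nu)"
      unfolding nu_def
    proof (subst nn_integral_density)
      show "(\<integral>\<^sup>+y. indicator (ball 0 r) y * ennreal (norm y powr (1 - ?n) * norm (G (x + y))) \<partial>lborel)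
        = (\<integral>\<^sup>+y. indicator (ball 0 r) y * ennreal (beta (norm y) * norm y powr - ?n) * ennreal (f y) \<partial>lborel)"
      proof (rule nn_integral_cong)
        fix y :: 'a
        show "indicator (ball 0 r) y * ennreal (norm y powr (1 - ?n) * norm (G (x + y)))
          = indicator (ball 0 r) y * ennreal (beta (norm y) * norm y powr - ?n) * ennreal (f y)"
        proof (cases "norm y < r \<and> y \<noteq> 0")
          case True
          then have b: "0 < beta (norm y)" using bpos by simp
          have "beta (norm y) * norm y powr - ?n * f y = norm y powr - ?n * norm y * norm (G (x + y))"
            using True b by (simp add: f_def)
          also have "norm y powr - ?n * norm y = norm y powr (1 - ?n)"
            using True powr_add[of "norm y" "- ?n" 1] by simp
          finally show ?thesis using True b f0[of y]
            by (simp add: ennreal_mult[symmetric])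
        next
          case False then show ?thesis by (auto simp: f_def)
        qed
      qed
    qed measurable
    finally have "ennreal ((c * \<bar>u x - ball_avg r u x\<bar>) powr p) \<le> ennreal (I powr (p - 1)) * (\<integral>\<^sup>+y. ennreal (f y powr p) \<partial>nu)"
      using c by (intro power_mean_nn_integral[OF nu I(1) _ f0 _ _ p]) (auto simp: nu_def)
    also have "(\<integral>\<^sup>+y. ennreal (f y powr p) \<partial>nu) = (\<integral>\<^sup>+y. indicator (ball 0 r) y * ennreal (beta (norm y) * norm y powr - ?n) * ennreal (f y powr p) \<partial>lborel)"
      unfolding nu_def by (subst nn_integral_density) measurable
    also have "\<dots> = (\<integral>\<^sup>+y. indicator (ball x r) (x + y) * ennreal (k (norm ((x + y) - x))) * ennreal (norm (G (x + y)) powr p) \<partial>lborel)"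
    proof (rule nn_integral_cong)
      fix y :: 'a
      show "indicator (ball 0 r) y * ennreal (beta (norm y) * norm y powr - ?n) * ennreal (f y powr p)
        = indicator (ball x r) (x + y) * ennreal (k (norm ((x + y) - x))) * ennreal (norm (G (x + y)) powr p)"
      proof (cases "norm y < r \<and> y \<noteq> 0")
        case True
        then have b: "0 < beta (norm y)" using bpos by simp
        have e: "beta (norm y) * beta (norm y) powr - p = beta (norm y) powr (1 - p)"
          using b powr_add[of "beta (norm y)" 1 "- p"] by simp
        have e2: "norm y powr - ?n * norm y powr p = norm y powr (p - ?n)"
          using powr_add[of "norm y" "- ?n" p] by simp
        have "beta (norm y) * norm y powr - ?n * f y powr p
            = (beta (norm y) * beta (norm y) powr - p) * (norm y powr - ?n * norm y powr p) * norm (G (x + y)) powr p"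
          using True b by (simp add: f_def powr_mult powr_divide powr_minus_divide mult_ac)
        also have "\<dots> = k (norm y) * norm (G (x + y)) powr p" unfolding e e2 k_def ..
        finally show ?thesis using True b k0 by (simp add: ennreal_mult[symmetric] dist_norm)
      next
        case False then show ?thesis using p by (auto simp: f_def k_def dist_norm)
      qed
    qed
    also have "\<dots> = (\<integral>\<^sup>+y. indicator (ball x r) y * ennreal (k (norm (y - x))) * ennreal (norm (G y) powr p) \<partial>lborel)"
      by (rule nn_integral_lborel_translate) measurable
    finally show ?thesis .
  qed
  have ind: "(\<lambda>(x::'a, y). indicator (ball x r) y :: ennreal) = indicator {z. dist (fst z) (snd z) < r}"
    by (auto simp: indicator_def)
  have [measurable]: "(\<lambda>(x::'a, y). indicator (ball x r) y :: ennreal) \<in> borel_measurable (mu \<Otimes>\<^sub>M lborel)"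
    unfolding ind by measurable
  have "(\<integral>\<^sup>+x. (\<integral>\<^sup>+y. indicator (ball x r) y * ennreal (k (norm (y - x))) * ennreal (norm (G y) powr p) \<partial>lborel) \<partial>mu)
      = (\<integral>\<^sup>+y. (\<integral>\<^sup>+x. indicator (ball x r) y * ennreal (k (norm (y - x))) * ennreal (norm (G y) powr p) \<partial>mu) \<partial>lborel)"
    by (rule Fubini'[symmetric]) measurable
  also have "\<dots> = (\<integral>\<^sup>+y. (\<integral>\<^sup>+x. indicator (ball y r) x * ennreal (k (norm (x - y))) * ennreal (norm (G y) powr p) \<partial>mu) \<partial>lborel)"
    by (intro nn_integral_cong) (auto simp: indicator_def dist_commute norm_minus_commute)
  also have "\<dots> = (\<integral>\<^sup>+y. (\<integral>\<^sup>+x. indicator (ball y r) x * ennreal (k (norm (x - y))) \<partial>mu) * ennreal (norm (G y) powr p) \<partial>lborel)"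
    by (intro nn_integral_cong nn_integral_multc) measurable
  also have "\<dots> \<le> (\<integral>\<^sup>+y. ennreal J * ennreal (norm (G y) powr p) \<partial>lborel)"
    using J by (intro nn_integral_mono mult_right_mono) (auto simp: k_def)
  also have "\<dots> = ennreal J * (\<integral>\<^sup>+y. ennreal (norm (G y) powr p) \<partial>lborel)"
    by (rule nn_integral_cmult) measurable
  finally have inner: "(\<integral>\<^sup>+x. (\<integral>\<^sup>+y. indicator (ball x r) y * ennreal (k (norm (y - x))) * ennreal (norm (G y) powr p) \<partial>lborel) \<partial>mu) \<le> ennreal J * (\<integral>\<^sup>+y. ennreal (norm (G y) powr p) \<partial>lborel)" .
  have "(\<integral>\<^sup>+x. ennreal ((c * \<bar>u x - ball_avg r u x\<bar>) powr p) \<partial>mu)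
      \<le> (\<integral>\<^sup>+x. ennreal (I powr (p - 1)) * (\<integral>\<^sup>+y. indicator (ball x r) y * ennreal (k (norm (y - x))) * ennreal (norm (G y) powr p) \<partial>lborel) \<partial>mu)"
    by (intro nn_integral_mono pt)
  also have "\<dots> = ennreal (I powr (p - 1)) * (\<integral>\<^sup>+x. (\<integral>\<^sup>+y. indicator (ball x r) y * ennreal (k (norm (y - x))) * ennreal (norm (G y) powr p) \<partial>lborel) \<partial>mu)"
    by (rule nn_integral_cmult) measurable
  also have "\<dots> \<le> ennreal (I powr (p - 1)) * (ennreal J * (\<integral>\<^sup>+y. ennreal (norm (G y) powr p) \<partial>lborel))"
    by (intro mult_left_mono inner) simp
  finally have fin: "(\<integral>\<^sup>+x. ennreal ((c * \<bar>u x - ball_avg r u x\<bar>) powr p) \<partial>mu)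
     \<le> ennreal (I powr (p - 1)) * (ennreal J * (\<integral>\<^sup>+y. ennreal (norm (G y) powr p) \<partial>lborel))" .
  have "(\<integral>\<^sup>+x. ennreal (\<bar>u x - ball_avg r u x\<bar> powr p) \<partial>mu)
      = (\<integral>\<^sup>+x. ennreal (c powr - p) * ennreal ((c * \<bar>u x - ball_avg r u x\<bar>) powr p) \<partial>mu)"
  proof (rule nn_integral_cong)
    fix x
    have "c powr - p * c powr p = 1" using c by (simp flip: powr_add)
    then have "c powr - p * (c * \<bar>u x - ball_avg r u x\<bar>) powr p = \<bar>u x - ball_avg r u x\<bar> powr p"
      using c by (simp add: powr_mult mult.assoc[symmetric])
    then show "ennreal (\<bar>u x - ball_avg r u x\<bar> powr p) = ennreal (c powr - p) * ennreal ((c * \<bar>u x - ball_avg r u x\<bar>) powr p)"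
      by (simp add: ennreal_mult[symmetric])
  qed
  also have "\<dots> = ennreal (c powr - p) * (\<integral>\<^sup>+x. ennreal ((c * \<bar>u x - ball_avg r u x\<bar>) powr p) \<partial>mu)"
    by (rule nn_integral_cmult) measurable
  also have "\<dots> \<le> ennreal (c powr - p) * (ennreal (I powr (p - 1)) * (ennreal J * (\<integral>\<^sup>+y. ennreal (norm (G y) powr p) \<partial>lborel)))"
    by (intro mult_left_mono fin) auto
  also have "\<dots> = ennreal (c powr (- p) * I powr (p - 1) * J) * (\<integral>\<^sup>+y. ennreal (norm (G y) powr p) \<partial>lborel)"
    using J by (simp add: ennreal_mult mult.assoc)
  finally show ?thesis unfolding c_def .
qed

section \<open>Dyadic decompositions and measures with small oscillation\<close>

lemma dyadic_level:
  fixes a b :: real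
  assumes "0 < a" "a < b"
  obtains k :: nat where "2 ^ k * a < b" "b \<le> 2 ^ (k + 1) * a"
proof -
  obtain m where "b / a < 2 ^ m" using real_arch_pow[of 2 "b / a"] by auto
  then have "b \<le> 2 ^ (m + 1) * a" using assms by (simp add: field_simps)
  then have ex: "\<exists>k. b \<le> 2 ^ (k + 1) * a" by blast
  define k where "k = (LEAST k. b \<le> 2 ^ (k + 1) * a)"
  have 1: "b \<le> 2 ^ (k + 1) * a" unfolding k_def using ex by (rule LeastI_ex)
  have "2 ^ k * a < b"
  proof (cases k)
    case 0 then show ?thesis using assms by simp
  next
    case (Suc j)
    then have "\<not> b \<le> 2 ^ (j + 1) * a" using not_less_Least[of j "\<lambda>k. b \<le> 2 ^ (k + 1) * a"] by (simp add: k_def)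
    then show ?thesis using Suc by simp
  qed
  with 1 show thesis using that by blast
qed

lemma ennreal_le_suminf: "f k \<le> (\<Sum>k. f k :: ennreal)"
  using sum_le_suminf[of f "{k}"] by simp

text \<open>On the layer 2^k a < h <= 2^(k+1) a the integrand is at most twice the lower level, so
  the layers sum up like a geometric series of ratio 2^(1-s) < 1. Radially decreasing kernels fit in
  well, as their superlevel sets lie in balls of controlled radius.\<close>

lemma nn_integral_weak_type:
  fixes h :: "'a \<Rightarrow> real"
  assumes [measurable]: "h \<in> borel_measurable mu" and a: "0 < a" and C: "0 \<le> C" and s: "1 < s"
    and W: "\<And>l. a \<le> l \<Longrightarrow> emeasure mu {x\<in>space mu. l < h x} \<le> ennreal (C * l powr - s)"
  shows "(\<integral>\<^sup>+x. indicator {x. a < h x} x * ennreal (h x) \<partial>mu) \<le> ennreal (2 * C * a powr (1 - s) * (1 / (1 - 2 powr (1 - s))))"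
proof -
  define q where "q = (2::real) powr (1 - s)"
  have q: "0 \<le> q" "q < 1" using s powr_less_mono[of "1 - s" 0 2] by (auto simp: q_def)
  define E where "E k = {x\<in>space mu. 2 ^ k * a < h x}" for k :: nat
  have [measurable]: "E k \<in> sets mu" for k unfolding E_def by measurable
  have "(\<integral>\<^sup>+x. indicator {x. a < h x} x * ennreal (h x) \<partial>mu) \<le> (\<integral>\<^sup>+x. (\<Sum>k. ennreal (2 ^ (k + 1) * a) * indicator (E k) x) \<partial>mu)"
  proof (rule nn_integral_mono)
    fix x assume x: "x \<in> space mu"
    show "indicator {x. a < h x} x * ennreal (h x) \<le> (\<Sum>k. ennreal (2 ^ (k + 1) * a) * indicator (E k) x)"
    proof (cases "a < h x")
      case True
      then obtain k where k: "2 ^ k * a < h x" "h x \<le> 2 ^ (k + 1) * a" using dyadic_level[OF a] by blast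
      then have "indicator {x. a < h x} x * ennreal (h x) \<le> ennreal (2 ^ (k + 1) * a) * indicator (E k) x"
        using x True by (simp add: E_def ennreal_leI)
      also have "\<dots> \<le> (\<Sum>k. ennreal (2 ^ (k + 1) * a) * indicator (E k) x)" by (rule ennreal_le_suminf)
      finally show ?thesis .
    qed simp
  qed
  also have "\<dots> = (\<Sum>k. \<integral>\<^sup>+x. ennreal (2 ^ (k + 1) * a) * indicator (E k) x \<partial>mu)"
    by (rule nn_integral_suminf) measurable
  also have "\<dots> = (\<Sum>k. ennreal (2 ^ (k + 1) * a) * emeasure mu (E k))"
    by (simp only: nn_integral_cmult_indicator[OF \<open>E _ \<in> sets mu\<close>])
  also have "\<dots> \<le> (\<Sum>k. ennreal (2 * C * a powr (1 - s) * q ^ k))"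
  proof (rule suminf_le[OF _ summableI summableI])
    fix k :: nat
    have "a \<le> 2 ^ k * a" using a by simp
    then have "emeasure mu (E k) \<le> ennreal (C * (2 ^ k * a) powr - s)" unfolding E_def by (rule W)
    then have "ennreal (2 ^ (k + 1) * a) * emeasure mu (E k) \<le> ennreal (2 ^ (k + 1) * a) * ennreal (C * (2 ^ k * a) powr - s)"
      by (rule mult_left_mono) simp
    also have "\<dots> = ennreal ((2 ^ (k + 1) * a) * (C * (2 ^ k * a) powr - s))"
      using a C by (simp add: ennreal_mult)
    also have "(2 ^ (k + 1) * a) * (C * (2 ^ k * a) powr - s) = 2 * C * a powr (1 - s) * q ^ k"
    proof -
      have 1: "(2 ^ k * a) * (2 ^ k * a) powr - s = (2 ^ k * a) powr (1 - s)"
        using a powr_add[of "2 ^ k * a" 1 "- s"] by simp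
      have 2: "(2 ^ k * a) powr (1 - s) = a powr (1 - s) * q ^ k"
        using a by (simp add: powr_mult q_def powr_realpow[symmetric] powr_powr mult.commute)
      show ?thesis using 1 2 by (simp add: algebra_simps)
    qed
    finally show "ennreal (2 ^ (k + 1) * a) * emeasure mu (E k) \<le> ennreal (2 * C * a powr (1 - s) * q ^ k)" .
  qed
  also have "\<dots> = ennreal (2 * C * a powr (1 - s) * (1 / (1 - q)))"
    using q C by (intro suminf_ennreal_eq sums_mult geometric_sums) auto
  finally show ?thesis unfolding q_def .
qed

text \<open>Each dyadic shell has mass at most v 2^n with respect to |y|^(-n) dy, independently of
  k, where v is the volume of the unit ball; hence a summable bound of \<open>beta\<close> on the
  shells suffices.\<close>

lemma nn_integral_radial_shells:
  fixes beta :: "real \<Rightarrow> real"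
  assumes r: "0 < r" and b: "\<And>k s. r / 2 ^ (k + 1) \<le> s \<Longrightarrow> s < r / 2 ^ k \<Longrightarrow> beta s \<le> b k"
    and b0: "\<And>k. 0 \<le> b k" and sb: "summable b"
  shows "(\<integral>\<^sup>+y. indicator (ball 0 r) (y::'a::euclidean_space) * ennreal (beta (norm y) * norm y powr - real DIM('a)) \<partial>lborel)
     \<le> ennreal (unit_ball_vol (real DIM('a)) * 2 ^ DIM('a) * suminf b)"
proof -
  let ?n = "real DIM('a)"
  let ?F = "\<lambda>k. \<lambda>y::'a. ennreal (b k * (r / 2 ^ (k + 1)) powr - ?n) * indicator (ball 0 (r / 2 ^ k)) y"
  have "(\<integral>\<^sup>+y. indicator (ball 0 r) (y::'a) * ennreal (beta (norm y) * norm y powr - ?n) \<partial>lborel) \<le> (\<integral>\<^sup>+y. (\<Sum>k. ?F k y) \<partial>lborel)"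
  proof (rule nn_integral_mono)
    fix y :: 'a
    show "indicator (ball 0 r) y * ennreal (beta (norm y) * norm y powr - ?n) \<le> (\<Sum>k. ?F k y)"
    proof (cases "norm y < r \<and> y \<noteq> 0")
      case True
      then obtain k where k: "2 ^ k * norm y < r" "r \<le> 2 ^ (k + 1) * norm y" using dyadic_level[of "norm y" r] by auto
      then have k': "r / 2 ^ (k + 1) \<le> norm y" "norm y < r / 2 ^ k" by (auto simp: field_simps)
      have "beta (norm y) * norm y powr - ?n \<le> b k * (r / 2 ^ (k + 1)) powr - ?n"
        using b[OF k'] b0[of k] k' r by (intro mult_mono powr_mono2') auto
      then have "indicator (ball 0 r) y * ennreal (beta (norm y) * norm y powr - ?n) \<le> ?F k y"
        using True k' by (simp add: ennreal_leI)
      also have "\<dots> \<le> (\<Sum>k. ?F k y)" by (rule ennreal_le_suminf)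
      finally show ?thesis .
    qed auto
  qed
  also have "\<dots> = (\<Sum>k. \<integral>\<^sup>+y. ?F k y \<partial>lborel)"
    by (rule nn_integral_suminf) measurable
  also have "\<dots> = (\<Sum>k. ennreal (b k * (unit_ball_vol ?n * 2 ^ DIM('a))))"
  proof (rule suminf_cong)
    fix k :: nat
    have "(\<integral>\<^sup>+y. ?F k y \<partial>lborel) = ennreal (b k * (r / 2 ^ (k + 1)) powr - ?n) * ennreal (unit_ball_vol ?n * (r / 2 ^ k) ^ DIM('a))"
      using r by (subst nn_integral_cmult_indicator) (auto simp: emeasure_ball)
    also have "\<dots> = ennreal (b k * (r / 2 ^ (k + 1)) powr - ?n * (unit_ball_vol ?n * (r / 2 ^ k) ^ DIM('a)))"
      using b0 r by (simp add: ennreal_mult)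
    also have "b k * (r / 2 ^ (k + 1)) powr - ?n * (unit_ball_vol ?n * (r / 2 ^ k) ^ DIM('a)) = b k * (unit_ball_vol ?n * 2 ^ DIM('a))"
    proof -
      define t where "t = r / 2 ^ (k + 1)"
      have t: "t > 0" "r / 2 ^ k = 2 * t" using r by (auto simp: t_def)
      have "t powr - ?n * t ^ DIM('a) = 1" using t by (simp add: powr_minus powr_realpow)
      then have "t powr - ?n * (2 * t) ^ DIM('a) = 2 ^ DIM('a)" by (simp add: power_mult_distrib)
      then show ?thesis unfolding t_def[symmetric] t(2) by (simp add: mult_ac)
    qed
    finally show "(\<integral>\<^sup>+y. ?F k y \<partial>lborel) = ennreal (b k * (unit_ball_vol ?n * 2 ^ DIM('a)))" .
  qed
  also have "\<dots> = ennreal (suminf b * (unit_ball_vol ?n * 2 ^ DIM('a)))"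
    using b0 sb by (intro suminf_ennreal_eq sums_mult2 summable_sums) auto
  finally show ?thesis by (simp add: mult_ac)
qed

text \<open>A Poincare inequality with arbitrarily small constant, the radius being chosen before
  the function. Applied to |V| dx it yields the trace inequality, applied to Lebesgue measure it
  yields compactness.\<close>

definition small_oscillation :: "real \<Rightarrow> 'a::euclidean_space measure \<Rightarrow> bool" where
  "small_oscillation p mu \<longleftrightarrow> (\<forall>d>0. \<exists>r>0. \<forall>u G.
     (\<forall>x. (u has_derivative (\<lambda>h. G x \<bullet> h)) (at x)) \<longrightarrow> continuous_on UNIV G \<longrightarrow>
     (\<integral>\<^sup>+x. ennreal (\<bar>u x - ball_avg r u x\<bar> powr p) \<partial>mu)
       \<le> ennreal d * (\<integral>\<^sup>+y. ennreal (norm (G y) powr p) \<partial>lborel))"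

text \<open>Dominated convergence along the radii R / (k + 1). The assumption F 0 = 0 takes care of
  the centre, which belongs to all the balls.\<close>

lemma nn_integral_shrinking_balls:
  fixes F :: "'a::euclidean_space \<Rightarrow> ennreal"
  assumes [measurable]: "F \<in> borel_measurable borel" and R: "0 < R" and F0: "F 0 = 0"
    and fin: "(\<integral>\<^sup>+y. indicator (ball 0 R) y * F y \<partial>lborel) < \<infinity>" and e: "0 < e"
  obtains r where "0 < r" "r \<le> R" "(\<integral>\<^sup>+y. indicator (ball 0 r) y * F y \<partial>lborel) \<le> ennreal e"
proof -
  define f where "f k y = indicator (ball 0 (R / real (Suc k))) y * F y" for k y
  have [measurable]: "f k \<in> borel_measurable lborel" for k unfolding f_def by measurable
  have "(\<lambda>k. \<integral>\<^sup>+y. f k y \<partial>lborel) \<longlonglongrightarrow> (\<integral>\<^sup>+y. 0 \<partial>(lborel::'a measure))"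
  proof (rule nn_integral_dominated_convergence[where w="\<lambda>y. indicator (ball 0 R) y * F y"])
    show "AE y in lborel. f k y \<le> indicator (ball 0 R) y * F y" for k
    proof (rule AE_I2)
      fix y :: 'a
      have "R / real (Suc k) \<le> R" using R by (simp add: field_simps)
      then show "f k y \<le> indicator (ball 0 R) y * F y" by (auto simp: f_def indicator_def)
    qed
    show "AE y in lborel. (\<lambda>k. f k y) \<longlonglongrightarrow> 0"
    proof (rule AE_I2)
      fix y :: 'a
      show "(\<lambda>k. f k y) \<longlonglongrightarrow> 0"
      proof (cases "y = 0")
        case True then show ?thesis by (simp add: f_def F0)
      next
        case False
        have "(\<lambda>k. R * inverse (real (Suc k))) \<longlonglongrightarrow> R * 0"
          by (intro tendsto_intros LIMSEQ_inverse_real_of_nat)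
        then have "eventually (\<lambda>k. R / real (Suc k) < norm y) sequentially"
          using False by (intro order_tendstoD(2)[of _ 0]) (auto simp: divide_inverse)
        then have "eventually (\<lambda>k. f k y = 0) sequentially"
          by eventually_elim (auto simp: f_def indicator_def)
        then show ?thesis by (rule tendsto_eventually)
      qed
    qed
  qed (use fin in auto)
  then have "eventually (\<lambda>k. (\<integral>\<^sup>+y. f k y \<partial>lborel) < ennreal e) sequentially"
    using e by (intro order_tendstoD(2)) auto
  then obtain k where "(\<integral>\<^sup>+y. f k y \<partial>lborel) < ennreal e" by (meson eventually_sequentially le_refl)
  then show thesis using R by (intro that[of "R / real (Suc k)"]) (auto simp: f_def field_simps)
qed

text \<open>J is fixed at the outer radius, while the mass I tends to 0 with the radius and enters
  with the positive exponent p - 1: all smallness comes from I.\<close>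

lemma small_oscillation_kernel:
  fixes mu :: "'a::euclidean_space measure" and beta :: "real \<Rightarrow> real"
  assumes n: "2 \<le> DIM('a)" and R: "0 < R" and p: "1 < p"
    and sets_mu: "sets mu = sets borel" and sf: "sigma_finite_measure mu"
    and beta[measurable]: "beta \<in> borel_measurable borel" and bpos: "\<And>s. 0 < s \<Longrightarrow> s < R \<Longrightarrow> 0 < beta s"
    and I: "(\<integral>\<^sup>+y. indicator (ball 0 R) (y::'a) * ennreal (beta (norm y) * norm y powr - real DIM('a)) \<partial>lborel) < \<infinity>"
    and J: "0 \<le> J" "\<And>y. (\<integral>\<^sup>+x. indicator (ball y R) x * ennreal (beta (norm (x - y)) powr (1 - p) * norm (x - y) powr (p - real DIM('a))) \<partial>mu) \<le> ennreal J"
  shows "small_oscillation p mu"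
  unfolding small_oscillation_def
proof (intro allI impI)
  fix d :: real assume d: "0 < d"
  let ?n = "real DIM('a)"
  define c where "c = unit_ball_vol ?n * (?n - 1)"
  have c: "c > 0" using n by (simp add: c_def)
  \<comment> \<open>Solves c^(-p) e^(p-1) (J + 1) = d; adding 1 keeps the quotient meaningful for J
    = 0.\<close>
  define e where "e = (d * c powr p / (J + 1)) powr (1 / (p - 1))"
  have e: "0 < e" using d c J by (simp add: e_def)
  have ep: "e powr (p - 1) = d * c powr p / (J + 1)" using p d c J by (simp add: e_def powr_powr)
  obtain r where r: "0 < r" "r \<le> R" "(\<integral>\<^sup>+y. indicator (ball 0 r) (y::'a) * ennreal (beta (norm y) * norm y powr - ?n) \<partial>lborel) \<le> ennreal e"
    by (rule nn_integral_shrinking_balls[OF _ R _ I e]) auto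
  have K: "c powr - p * e powr (p - 1) * J \<le> d"
  proof -
    have "c powr - p * e powr (p - 1) * J = d * (J / (J + 1))"
      using c by (simp add: ep powr_minus)
    also have "\<dots> \<le> d * 1" using d J by (intro mult_left_mono) auto
    finally show ?thesis by simp
  qed
  show "\<exists>r>0. \<forall>u G. (\<forall>x. (u has_derivative (\<lambda>h. G x \<bullet> h)) (at x)) \<longrightarrow> continuous_on UNIV G \<longrightarrow>
     (\<integral>\<^sup>+x. ennreal (\<bar>u x - ball_avg r u x\<bar> powr p) \<partial>mu) \<le> ennreal d * (\<integral>\<^sup>+y. ennreal (norm (G y) powr p) \<partial>lborel)"
  proof (intro exI[of _ r] conjI r allI impI)
    fix u :: "'a \<Rightarrow> real" and G
    assume der: "\<forall>x. (u has_derivative (\<lambda>h. G x \<bullet> h)) (at x)" and cont: "continuous_on UNIV G"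
    have "(\<integral>\<^sup>+x. ennreal (\<bar>u x - ball_avg r u x\<bar> powr p) \<partial>mu)
      \<le> ennreal (c powr - p * e powr (p - 1) * J) * (\<integral>\<^sup>+y. ennreal (norm (G y) powr p) \<partial>lborel)"
      unfolding c_def
    proof (rule gradient_Schur_test[OF n r(1) p sets_mu sf beta _ e r(3) J(1) _ _ cont])
      fix y
      have "(\<integral>\<^sup>+x. indicator (ball y r) x * ennreal (beta (norm (x - y)) powr (1 - p) * norm (x - y) powr (p - ?n)) \<partial>mu)
         \<le> (\<integral>\<^sup>+x. indicator (ball y R) x * ennreal (beta (norm (x - y)) powr (1 - p) * norm (x - y) powr (p - ?n)) \<partial>mu)"
        using r by (intro nn_integral_mono mult_right_mono) (auto simp: indicator_def)
      then show "(\<integral>\<^sup>+x. indicator (ball y r) x * ennreal (beta (norm (x - y)) powr (1 - p) * norm (x - y) powr (p - ?n)) \<partial>mu) \<le> ennreal J"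
        using J(2)[of y] by (rule order_trans)
    qed (use der bpos r in auto)
    also have "\<dots> \<le> ennreal d * (\<integral>\<^sup>+y. ennreal (norm (G y) powr p) \<partial>lborel)"
      using K by (intro mult_right_mono ennreal_leI) auto
    finally show "(\<integral>\<^sup>+x. ennreal (\<bar>u x - ball_avg r u x\<bar> powr p) \<partial>mu) \<le> ennreal d * (\<integral>\<^sup>+y. ennreal (norm (G y) powr p) \<partial>lborel)" .
  qed
qed

text \<open>The surplus s - (n - p) > 0 is shared between the two demands on the weight |y|^tau: tau
  > 0 makes the mass I finite, and the loss tau (p - 1) has to leave the kernel integrable against a
  measure of growth exponent s.\<close>

lemma small_oscillation_powr:
  fixes mu :: "'a::euclidean_space measure"
  assumes n: "2 \<le> DIM('a)" and p: "1 < p"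
    and sets_mu: "sets mu = sets borel" and sf: "sigma_finite_measure mu"
    and C: "0 \<le> C" and s: "real DIM('a) - p < s"
    and growth: "\<And>y r. 0 < r \<Longrightarrow> r \<le> 1 \<Longrightarrow> emeasure mu (ball y r) \<le> ennreal (C * r powr s)"
  shows "small_oscillation p mu"
proof -
  let ?n = "real DIM('a)"
  note [measurable_cong] = sets_mu
  \<comment> \<open>Half of the surplus is spent on the weight, the other half remains for
    integrability against \<open>mu\<close>.\<close>
  define t where "t = (s - (?n - p)) / 2"
  define tau where "tau = t / (p - 1)"
  have tau: "0 < tau" using s p by (simp add: tau_def t_def)
  define e where "e = p - ?n - tau * (p - 1)"
  have tp: "tau * (p - 1) = t" using p by (simp add: tau_def)
  have e: "- e < s" unfolding e_def tp t_def using s by (simp add: field_simps)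
  have kern: "(norm (x - y) powr tau) powr (1 - p) * norm (x - y) powr (p - ?n) = norm (x - y) powr e" for x y :: 'a
    by (simp add: powr_powr e_def powr_add[symmetric] algebra_simps)
  have I: "(\<integral>\<^sup>+y. indicator (ball 0 1) (y::'a) * ennreal (norm y powr tau * norm y powr - ?n) \<partial>lborel) < \<infinity>"
  proof -
    have "(\<integral>\<^sup>+y. indicator (ball 0 1) (y::'a) * ennreal (norm y powr tau * norm y powr - ?n) \<partial>lborel)
      \<le> ennreal (unit_ball_vol ?n * 2 ^ DIM('a) * (\<Sum>k. (1 / 2 powr tau) ^ k))"
    proof (rule nn_integral_radial_shells)
      fix k :: nat and s :: real assume "1 / 2 ^ (k + 1) \<le> s" "s < 1 / 2 ^ k"
      moreover have "0 < 1 / (2::real) ^ (k + 1)" by simp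
      ultimately have "0 \<le> s" "s \<le> 1 / 2 ^ k" by linarith+
      then have "s powr tau \<le> (1 / 2 ^ k) powr tau" using tau by (intro powr_mono2) auto
      also have "\<dots> = (1 / 2 powr tau) ^ k"
        by (simp add: powr_divide power_divide powr_realpow[symmetric] powr_powr mult.commute)
      finally show "s powr tau \<le> (1 / 2 powr tau) ^ k" .
    qed (use tau in \<open>auto intro!: summable_geometric\<close>)
    then show ?thesis by (rule le_less_trans) simp
  qed
  \<comment> \<open>For e >= 0 the kernel is at most 1 on the unit ball. For e < 0 its superlevel
    set at l lies in a ball of radius l^(1/e), of mass at most C l^(s/e), which is a weak-type bound
    with exponent s / (-e) > 1.\<close>
  have J: "\<exists>J\<ge>0. \<forall>y. (\<integral>\<^sup>+x. indicator (ball y 1) x * ennreal (norm (x - y) powr e) \<partial>mu) \<le> ennreal J"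
  proof (cases "0 \<le> e")
    case True
    have "(\<integral>\<^sup>+x. indicator (ball y 1) x * ennreal (norm (x - y) powr e) \<partial>mu) \<le> ennreal C" for y :: 'a
    proof -
      have "(\<integral>\<^sup>+x. indicator (ball y 1) x * ennreal (norm (x - y) powr e) \<partial>mu) \<le> (\<integral>\<^sup>+x. indicator (ball y 1) x \<partial>mu)"
      proof (rule nn_integral_mono)
        fix x
        have "norm (x - y) powr e \<le> 1 powr e" if "dist y x < 1"
          using that True by (intro powr_mono2) (auto simp: dist_norm norm_minus_commute)
        then show "indicator (ball y 1) x * ennreal (norm (x - y) powr e) \<le> indicator (ball y 1) x"
          by (auto simp: indicator_def)
      qed
      also have "\<dots> = emeasure mu (ball y 1)" by (rule nn_integral_indicator) measurable
      also have "\<dots> \<le> ennreal C" using growth[of 1 y] by simp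
      finally show ?thesis .
    qed
    then show ?thesis using C by blast
  next
    case False
    let ?K = "2 * C * 1 powr (1 - s / - e) * (1 / (1 - 2 powr (1 - s / - e)))"
    have s1: "1 < s / - e" using False e by (simp add: field_simps)
    have "(\<integral>\<^sup>+x. indicator (ball y 1) x * ennreal (norm (x - y) powr e) \<partial>mu) \<le> ennreal ?K" for y :: 'a
    proof -
      have "(\<integral>\<^sup>+x. indicator (ball y 1) x * ennreal (norm (x - y) powr e) \<partial>mu)
         \<le> (\<integral>\<^sup>+x. indicator {x. 1 < norm (x - y) powr e} x * ennreal (norm (x - y) powr e) \<partial>mu)"
      proof (rule nn_integral_mono)
        fix x
        have "1 powr e < norm (x - y) powr e" if "dist y x < 1" "x \<noteq> y"
          using that False by (intro powr_less_mono2_neg) (auto simp: dist_norm norm_minus_commute)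
        then show "indicator (ball y 1) x * ennreal (norm (x - y) powr e) \<le> indicator {x. 1 < norm (x - y) powr e} x * ennreal (norm (x - y) powr e)"
          by (cases "x = y") (auto simp: indicator_def)
      qed
      also have "\<dots> \<le> ennreal ?K"
      proof (rule nn_integral_weak_type[OF _ _ C s1])
        fix l :: real assume l: "1 \<le> l"
        define r where "r = l powr (1 / e)"
        have r: "0 < r" "r \<le> 1" using l False powr_mono2'[of "1/e" 1 l] by (auto simp: r_def)
        have "{x \<in> space mu. l < norm (x - y) powr e} \<subseteq> ball y r"
        proof
          fix x assume "x \<in> {x \<in> space mu. l < norm (x - y) powr e}"
          then have lx: "l < norm (x - y) powr e" by simp
          then have "x \<noteq> y" using l by auto
          have "(norm (x - y) powr e) powr (1 / e) < l powr (1 / e)"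
            using lx l False by (intro powr_less_mono2_neg) auto
          then have "norm (x - y) < r" using False \<open>x \<noteq> y\<close> by (simp add: powr_powr r_def)
          then show "x \<in> ball y r" by (simp add: dist_norm norm_minus_commute)
        qed
        then have "emeasure mu {x \<in> space mu. l < norm (x - y) powr e} \<le> emeasure mu (ball y r)"
          by (rule emeasure_mono) measurable
        also have "\<dots> \<le> ennreal (C * r powr s)" by (rule growth[OF r])
        also have "r powr s = l powr - (s / - e)" by (simp add: r_def powr_powr)
        finally show "emeasure mu {x \<in> space mu. l < norm (x - y) powr e} \<le> ennreal (C * l powr - (s / - e))" .
      qed auto
      finally show ?thesis .
    qed
    moreover have "0 \<le> ?K"
      using C s1 powr_less_mono[of "1 - s / - e" 0 2] by simp
    ultimately show ?thesis by blast
  qed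
  then obtain J where J: "0 \<le> J" "\<And>y. (\<integral>\<^sup>+x. indicator (ball y 1) x * ennreal (norm (x - y) powr e) \<partial>mu) \<le> ennreal J" by blast
  show ?thesis
    by (rule small_oscillation_kernel[where beta="\<lambda>s. s powr tau", OF n zero_less_one p sets_mu sf _ _ I J(1)])
      (use J(2) in \<open>auto simp: kern\<close>)
qed

text \<open>At the critical exponent no power weight works. The weight is $\log(R/s)^{-\tau}$ with $1 < \tau < \gamma/(p-1)$:
  the lower bound makes the Lebesgue integral converge, the upper bound the integral against the measure.\<close>
lemma small_oscillation_log:
  fixes mu :: "'a::euclidean_space measure"
  assumes n: "2 \<le> DIM('a)" and p: "p = real DIM('a)"
    and sets_mu: "sets mu = sets borel" and sf: "sigma_finite_measure mu"
    and C: "0 \<le> C" and gam: "real DIM('a) - 1 < gam" and R: "0 < R"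
    and growth: "\<And>y r. 0 < r \<Longrightarrow> r < R \<Longrightarrow> emeasure mu (ball y r) \<le> ennreal (C * ln (R / r) powr - gam)"
  shows "small_oscillation p mu"
proof -
  let ?n = "real DIM('a)"
  note [measurable_cong] = sets_mu
  have p1: "1 < p" "0 < p - 1" using n p by auto
  define g where "g = gam / (p - 1)"
  \<comment> \<open>The midpoint of 1 and \<open>g\<close>; the interval is nonempty because gam > n
    - 1 = p - 1.\<close>
  define tau where "tau = (1 + g) / 2"
  have "1 < gam / (p - 1)" using gam p p1 by simp
  then have tau: "1 < tau" "tau < gam / (p - 1)" by (auto simp: tau_def g_def[symmetric])
  define sig where "sig = tau * (p - 1)"
  have sig: "0 < sig" "sig < gam" using tau p1 by (auto simp: sig_def field_simps)
  define beta where "beta s = ln (R / s) powr - tau" for s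
  have [measurable]: "beta \<in> borel_measurable borel" unfolding beta_def by measurable
  have lnp: "ln 2 < ln (R / s)" if "0 < s" "s < R / 2" for s
    using that R by (subst ln_less_cancel_iff) (auto simp: field_simps)
  have l2: "0 < ln (2::real)" by simp
  \<comment> \<open>Halving the radius keeps the logarithm above ln 2; on the k-th shell it is at
    least (k + 1) ln 2, and tau > 1 makes the series converge.\<close>
  have I: "(\<integral>\<^sup>+y. indicator (ball 0 (R / 2)) (y::'a) * ennreal (beta (norm y) * norm y powr - ?n) \<partial>lborel) < \<infinity>"
  proof -
    have "(\<integral>\<^sup>+y. indicator (ball 0 (R / 2)) (y::'a) * ennreal (beta (norm y) * norm y powr - ?n) \<partial>lborel)
      \<le> ennreal (unit_ball_vol ?n * 2 ^ DIM('a) * (\<Sum>k. ln 2 powr - tau * real (Suc k) powr - tau))"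
    proof (rule nn_integral_radial_shells)
      fix k :: nat and s :: real assume s: "R / 2 / 2 ^ (k + 1) \<le> s" "s < R / 2 / 2 ^ k"
      have "0 < R / 2 / 2 ^ (k + 1)" using R by simp
      then have s0: "0 < s" using s by linarith
      have "2 ^ Suc k \<le> R / s" using s s0 by (simp add: field_simps)
      then have "ln (2 ^ Suc k) \<le> ln (R / s)" using R s0 by (subst ln_le_cancel_iff) auto
      then have "real (Suc k) * ln 2 \<le> ln (R / s)" by (simp only: ln_realpow)
      then have "ln (R / s) powr - tau \<le> (real (Suc k) * ln 2) powr - tau"
        using tau l2 by (intro powr_mono2') auto
      then show "beta s \<le> ln 2 powr - tau * real (Suc k) powr - tau"
        by (simp add: beta_def powr_mult mult.commute)
    next
      have "summable (\<lambda>k. real k powr - tau)" using tau by (simp add: summable_real_powr_iff)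
      then have "summable (\<lambda>k. real (Suc k) powr - tau)" by (subst summable_Suc_iff)
      then show "summable (\<lambda>k. ln 2 powr - tau * real (Suc k) powr - tau)" by (rule summable_mult)
    qed (use R in auto)
    then show ?thesis by (rule le_less_trans) simp
  qed
  \<comment> \<open>Half of a lower bound for the kernel, so that the whole punctured ball lies
    strictly above this level.\<close>
  define a where "a = ln 2 powr sig / 2"
  have a: "0 < a" by (simp add: a_def)
  let ?K = "2 * C * a powr (1 - gam / sig) * (1 / (1 - 2 powr (1 - gam / sig)))"
  have s1: "1 < gam / sig" using sig by simp
  have J: "(\<integral>\<^sup>+x. indicator (ball y (R / 2)) x * ennreal (beta (norm (x - y)) powr (1 - p) * norm (x - y) powr (p - ?n)) \<partial>mu) \<le> ennreal ?K" for y :: 'a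
  proof -
    define h where "h x = (if x \<noteq> y \<and> norm (x - y) < R / 2 then ln (R / norm (x - y)) powr sig else 0)" for x
    have [measurable]: "h \<in> borel_measurable mu" unfolding h_def by measurable
    have "(\<integral>\<^sup>+x. indicator (ball y (R / 2)) x * ennreal (beta (norm (x - y)) powr (1 - p) * norm (x - y) powr (p - ?n)) \<partial>mu)
      \<le> (\<integral>\<^sup>+x. indicator {x. a < h x} x * ennreal (h x) \<partial>mu)"
    proof (rule nn_integral_mono)
      fix x
      show "indicator (ball y (R / 2)) x * ennreal (beta (norm (x - y)) powr (1 - p) * norm (x - y) powr (p - ?n)) \<le> indicator {x. a < h x} x * ennreal (h x)"
      proof (cases "x \<noteq> y \<and> norm (x - y) < R / 2")
        case True
        then have hx: "h x = ln (R / norm (x - y)) powr sig" by (simp add: h_def)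
        have "ln 2 powr sig \<le> h x" unfolding hx using lnp[of "norm (x - y)"] True sig l2 by (intro powr_mono2) auto
        moreover have "0 < ln 2 powr sig" using l2 by simp
        ultimately have "a < h x" unfolding a_def by linarith
        moreover have "beta (norm (x - y)) powr (1 - p) * norm (x - y) powr (p - ?n) = h x"
          using True p by (simp add: hx beta_def powr_powr sig_def algebra_simps)
        ultimately show ?thesis by (auto simp: indicator_def)
      next
        case False then show ?thesis using p by (auto simp: indicator_def dist_norm norm_minus_commute)
      qed
    qed
    also have "\<dots> \<le> ennreal ?K"
    proof (rule nn_integral_weak_type[OF _ a C s1])
      fix l :: real assume "a \<le> l"
      then have l: "0 < l" using a by linarith
      \<comment> \<open>The radius at which ln (R / r)^sig equals the level l.\<close>
      define r where "r = R * exp (- (l powr (1 / sig)))"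
      have r: "0 < r" "r < R" using R l by (auto simp: r_def)
      have lr: "ln (R / r) = l powr (1 / sig)" using R by (simp add: r_def ln_div ln_mult)
      have "{x \<in> space mu. l < h x} \<subseteq> ball y r"
      proof
        fix x assume "x \<in> {x \<in> space mu. l < h x}"
        then have lx: "l < h x" by simp
        then have x: "x \<noteq> y" "norm (x - y) < R / 2" "l < ln (R / norm (x - y)) powr sig"
          using l by (auto simp: h_def split: if_splits)
        have "l powr (1 / sig) < (ln (R / norm (x - y)) powr sig) powr (1 / sig)"
          using x(3) l sig by (intro powr_less_mono2) auto
        also have "\<dots> = ln (R / norm (x - y))"
          using sig less_trans[OF l2 lnp[of "norm (x - y)"]] x by (simp add: powr_powr)
        finally have "exp (l powr (1 / sig)) < exp (ln (R / norm (x - y)))" by simp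
        also have "\<dots> = R / norm (x - y)" using R x by (intro exp_ln) auto
        finally have "exp (l powr (1 / sig)) < R / norm (x - y)" .
        then have "norm (x - y) < r" using x R by (simp add: r_def exp_minus field_simps)
        then show "x \<in> ball y r" by (simp add: dist_norm norm_minus_commute)
      qed
      then have "emeasure mu {x \<in> space mu. l < h x} \<le> emeasure mu (ball y r)"
        by (rule emeasure_mono) measurable
      also have "\<dots> \<le> ennreal (C * ln (R / r) powr - gam)" by (rule growth[OF r])
      also have "ln (R / r) powr - gam = l powr - (gam / sig)" by (simp add: lr powr_powr)
      finally show "emeasure mu {x \<in> space mu. l < h x} \<le> ennreal (C * l powr - (gam / sig))" .
    qed auto
    finally show ?thesis .
  qed
  have K0: "0 \<le> ?K" using C s1 powr_less_mono[of "1 - gam / sig" 0 2] by simp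
  show ?thesis
  proof (rule small_oscillation_kernel[OF n _ p1(1) sets_mu sf \<open>beta \<in> borel_measurable borel\<close> _ I K0 J])
    show "0 < beta s" if "0 < s" "s < R / 2" for s
      unfolding beta_def using less_trans[OF l2 lnp[OF that]] by (metis less_irrefl powr_gt_zero)
  qed (use R in auto)
qed

section \<open>Continuously differentiable functions with compact support\<close>

text \<open>The gradient is carried along as data, in the form in which the oscillation estimates
  take it.\<close>

definition C1c :: "'a::euclidean_space set \<Rightarrow> ('a \<Rightarrow> real) \<Rightarrow> ('a \<Rightarrow> 'a) \<Rightarrow> bool" where
  "C1c w u G \<longleftrightarrow> (\<forall>x. (u has_derivative (\<lambda>h. G x \<bullet> h)) (at x)) \<and> continuous_on UNIV G \<and>
     compact (closure {x. u x \<noteq> 0}) \<and> closure {x. u x \<noteq> 0} \<subseteq> w"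

text \<open>\<open>smooth_fun\<close> speaks of partial derivatives only. The displacement is made
  one coordinate at a time, with the mean value theorem on each step; continuity of the partials
  controls the error.\<close>

lemma continuous_partials_imp_has_derivative:
  fixes f :: "'a::euclidean_space \<Rightarrow> real"
  assumes der: "\<And>x b. b \<in> Basis \<Longrightarrow> ((\<lambda>t. f (x + t *\<^sub>R b)) has_real_derivative D b x) (at 0)"
    and cont: "\<And>b. b \<in> Basis \<Longrightarrow> continuous_on UNIV (D b)"
  shows "(f has_derivative (\<lambda>h. (\<Sum>b\<in>Basis. D b x *\<^sub>R b) \<bullet> h)) (at x)"
  unfolding has_derivative_at_alt
proof (intro conjI allI impI)
  show "bounded_linear ((\<bullet>) (\<Sum>b\<in>Basis. D b x *\<^sub>R b))" by (rule bounded_linear_inner_right)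
  fix e :: real assume e: "0 < e"
  define e' where "e' = e / real DIM('a)"
  have e': "0 < e'" using e by (simp add: e'_def)
  have "\<exists>d>0. \<forall>y. norm (y - x) < d \<longrightarrow> \<bar>D b y - D b x\<bar> \<le> e'" if "b \<in> Basis" for b
  proof -
    have "isCont (D b) x" using cont[OF that] by (simp add: continuous_on_eq_continuous_at)
    then obtain d where "d > 0" "\<And>y. dist y x < d \<Longrightarrow> dist (D b y) (D b x) < e'"
      using e' unfolding continuous_at_eps_delta by blast
    then show ?thesis by (intro exI[of _ d]) (auto simp: dist_norm less_imp_le)
  qed
  then obtain d where d: "\<And>b. b \<in> Basis \<Longrightarrow> 0 < d b" "\<And>b y. b \<in> Basis \<Longrightarrow> norm (y - x) < d b \<Longrightarrow> \<bar>D b y - D b x\<bar> \<le> e'"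
    by metis
  define dd where "dd = Min (d ` (Basis::'a set))"
  have dd: "0 < dd" "\<And>b. b \<in> Basis \<Longrightarrow> dd \<le> d b" using d(1) by (auto simp: dd_def)
  have "norm (f y - f x - (\<Sum>b\<in>Basis. D b x *\<^sub>R b) \<bullet> (y - x)) \<le> e * norm (y - x)" if y: "norm (y - x) < dd" for y
  proof -
    define h where "h = y - x"
    \<comment> \<open>The part of the displacement along the coordinates in B; the induction on B
      adds one coordinate per step.\<close>
    define hB where "hB B = (\<Sum>b\<in>B. (h \<bullet> b) *\<^sub>R b)" for B
    have comp: "hB B \<bullet> c = (if c \<in> B then h \<bullet> c else 0)" if "c \<in> Basis" "B \<subseteq> Basis" for B c
    proof -
      have fB: "finite B" using that finite_subset finite_Basis by blast
      have "hB B \<bullet> c = (\<Sum>b\<in>B. (h \<bullet> b) * (b \<bullet> c))" by (simp add: hB_def inner_sum_left)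
      also have "\<dots> = (\<Sum>b\<in>B. if b = c then h \<bullet> c else 0)"
        using that by (intro sum.cong) (auto simp: inner_Basis subset_iff)
      also have "\<dots> = (if c \<in> B then h \<bullet> c else 0)" using fB by (simp add: sum.delta)
      finally show ?thesis .
    qed
    have "\<bar>f (x + hB B) - f x - (\<Sum>b\<in>B. D b x * (h \<bullet> b))\<bar> \<le> (\<Sum>b\<in>B. e' * \<bar>h \<bullet> b\<bar>)" if "finite B" "B \<subseteq> Basis" for B
      using that
    proof (induction B rule: finite_induct)
      case empty then show ?case by (simp add: hB_def)
    next
      case (insert b B)
      have bB: "b \<in> Basis" "B \<subseteq> Basis" using insert.prems by auto
      define z where "z = x + hB B"
      define c where "c = h \<bullet> b"
      have hI: "x + hB (insert b B) = z + c *\<^sub>R b" using insert.hyps by (simp add: hB_def z_def c_def)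
      have der': "((\<lambda>t. f (z + t *\<^sub>R b)) has_real_derivative D b (z + t *\<^sub>R b)) (at t)" for t
      proof -
        have "((\<lambda>s. f ((z + t *\<^sub>R b) + s *\<^sub>R b)) has_real_derivative D b (z + t *\<^sub>R b)) (at 0)" by (rule der[OF bB(1)])
        then have "((\<lambda>s. f (z + (s + t) *\<^sub>R b)) has_real_derivative D b (z + t *\<^sub>R b)) (at 0)" by (simp add: algebra_simps)
        then show ?thesis using DERIV_shift[of "\<lambda>s. f (z + s *\<^sub>R b)" "D b (z + t *\<^sub>R b)" 0 t] by simp
      qed
      \<comment> \<open>Intermediate points stay in the ball of radius \<open>dd\<close>, since no
        coordinate of the partial displacement exceeds that of h in absolute value.\<close>
      have near: "norm (z + t *\<^sub>R b - x) < dd" if "\<bar>t\<bar> \<le> \<bar>c\<bar>" for t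
      proof -
        have "norm (hB B + t *\<^sub>R b) \<le> norm h"
        proof (rule norm_le_componentwise)
          fix k :: 'a assume k: "k \<in> Basis"
          show "\<bar>(hB B + t *\<^sub>R b) \<bullet> k\<bar> \<le> \<bar>h \<bullet> k\<bar>"
            using that bB insert.hyps k by (auto simp: inner_add_left comp inner_Basis c_def)
        qed
        then show ?thesis using y by (simp add: z_def h_def)
      qed
      have "\<exists>t. \<bar>t\<bar> \<le> \<bar>c\<bar> \<and> f (z + c *\<^sub>R b) - f z = c * D b (z + t *\<^sub>R b)"
      proof (cases "c = 0")
        case False
        show ?thesis
        proof (cases "0 < c")
          case True
          from MVT2[OF this, of "\<lambda>t. f (z + t *\<^sub>R b)" "\<lambda>t. D b (z + t *\<^sub>R b)"] der'
          obtain t where "0 < t" "t < c" "f (z + c *\<^sub>R b) - f (z + 0 *\<^sub>R b) = (c - 0) * D b (z + t *\<^sub>R b)" by blast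
          then show ?thesis by (intro exI[of _ t]) auto
        next
          case False
          then have "c < 0" using \<open>c \<noteq> 0\<close> by simp
          from MVT2[OF this, of "\<lambda>t. f (z + t *\<^sub>R b)" "\<lambda>t. D b (z + t *\<^sub>R b)"] der'
          obtain t where "c < t" "t < 0" "f (z + 0 *\<^sub>R b) - f (z + c *\<^sub>R b) = (0 - c) * D b (z + t *\<^sub>R b)" by blast
          then show ?thesis by (intro exI[of _ t]) (auto simp: algebra_simps)
        qed
      qed auto
      then obtain t where t: "\<bar>t\<bar> \<le> \<bar>c\<bar>" "f (z + c *\<^sub>R b) - f z = c * D b (z + t *\<^sub>R b)" by blast
      have "\<bar>D b (z + t *\<^sub>R b) - D b x\<bar> \<le> e'"
        using near[OF t(1)] dd(2)[OF bB(1)] by (intro d(2) bB) linarith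
      then have "\<bar>c\<bar> * \<bar>D b (z + t *\<^sub>R b) - D b x\<bar> \<le> \<bar>c\<bar> * e'" by (rule mult_left_mono) simp
      then have 1: "\<bar>f (z + c *\<^sub>R b) - f z - D b x * c\<bar> \<le> e' * \<bar>c\<bar>"
        by (simp add: t(2) abs_mult[symmetric] algebra_simps)
      have 2: "\<bar>f z - f x - (\<Sum>b\<in>B. D b x * (h \<bullet> b))\<bar> \<le> (\<Sum>b\<in>B. e' * \<bar>h \<bullet> b\<bar>)"
        using insert.IH bB by (simp add: z_def)
      show ?case
        unfolding hI sum.insert[OF insert.hyps(1,2)] c_def[symmetric] using 1 2 by linarith
    qed
    from this[of Basis] have "\<bar>f (x + hB Basis) - f x - (\<Sum>b\<in>Basis. D b x * (h \<bullet> b))\<bar> \<le> (\<Sum>b\<in>Basis. e' * \<bar>h \<bullet> b\<bar>)" by simp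
    also have "\<dots> \<le> (\<Sum>b\<in>(Basis::'a set). e' * norm h)"
      using e' by (intro sum_mono mult_left_mono Basis_le_norm) auto
    also have "\<dots> = e * norm h" by (simp add: e'_def)
    finally have "\<bar>f (x + hB Basis) - f x - (\<Sum>b\<in>Basis. D b x * (h \<bullet> b))\<bar> \<le> e * norm h" .
    moreover have "x + hB Basis = y" by (simp add: hB_def euclidean_representation h_def)
    moreover have "(\<Sum>b\<in>Basis. D b x * (h \<bullet> b)) = (\<Sum>b\<in>Basis. D b x *\<^sub>R b) \<bullet> h"
      by (simp add: inner_sum_left inner_commute[of h])
    ultimately show ?thesis by (simp add: h_def)
  qed
  then show "\<exists>d>0. \<forall>y. norm (y - x) < d \<longrightarrow> norm (f y - f x - (\<Sum>b\<in>Basis. D b x *\<^sub>R b) \<bullet> (y - x)) \<le> e * norm (y - x)"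
    using dd(1) by blast
qed

lemma test_fun_C1c:
  assumes "test_fun w f"
  shows "C1c w f (grad f)"
proof -
  have s: "\<And>bs. set bs \<subseteq> Basis \<Longrightarrow> continuous_on UNIV (dpartial bs f) \<and>
      (\<forall>x. \<forall>b\<in>Basis. ((\<lambda>t. dpartial bs f (x + t *\<^sub>R b)) has_real_derivative pd b (dpartial bs f) x) (at 0))"
    using assms by (auto simp: test_fun_def smooth_fun_def)
  have d: "((\<lambda>t. f (x + t *\<^sub>R b)) has_real_derivative pd b f x) (at 0)" if "b \<in> Basis" for x b
    using s[of "[]"] that by auto
  have c: "continuous_on UNIV (pd b f)" if "b \<in> Basis" for b
    using s[of "[b]"] that by auto
  have "(f has_derivative (\<lambda>h. grad f x \<bullet> h)) (at x)" for x
    unfolding grad_def by (rule continuous_partials_imp_has_derivative[OF d c])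
  moreover have "continuous_on UNIV (grad f)"
    unfolding grad_def[abs_def] by (intro continuous_intros c)
  ultimately show ?thesis using assms by (auto simp: C1c_def test_fun_def)
qed

section \<open>Supports and integrals of C^1 functions\<close>

lemma C1c_continuous: "C1c w u G \<Longrightarrow> continuous_on UNIV u"
  by (auto simp: C1c_def continuous_on_eq_continuous_at intro: has_derivative_continuous)

lemma C1c_diff:
  assumes "C1c w u G" "C1c w v F"
  shows "C1c w (\<lambda>x. u x - v x) (\<lambda>x. G x - F x)"
proof -
  have "closure {x. u x - v x \<noteq> 0} \<subseteq> closure ({x. u x \<noteq> 0} \<union> {x. v x \<noteq> 0})"
    by (rule closure_mono) auto
  also have "\<dots> = closure {x. u x \<noteq> 0} \<union> closure {x. v x \<noteq> 0}" by (rule closure_Un)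
  finally have sub: "closure {x. u x - v x \<noteq> 0} \<subseteq> closure {x. u x \<noteq> 0} \<union> closure {x. v x \<noteq> 0}" .
  have cpt: "compact (closure {x. u x \<noteq> 0} \<union> closure {x. v x \<noteq> 0})" using assms by (auto simp: C1c_def)
  have "compact (closure {x. u x - v x \<noteq> 0})"
    using compact_Int_closed[OF cpt, of "closure {x. u x - v x \<noteq> 0}"] sub by (simp add: inf.absorb2)
  moreover have "((\<lambda>x. u x - v x) has_derivative (\<lambda>h. (G x - F x) \<bullet> h)) (at x)" for x
    using assms by (auto simp: C1c_def inner_diff_left intro: has_derivative_diff)
  ultimately show ?thesis using assms sub by (auto simp: C1c_def intro!: continuous_intros)
qed

text \<open>Near a point off the closed support the function is constantly 0, and uniqueness of the
  derivative forces G to vanish there.\<close>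

lemma C1c_support:
  assumes "C1c w u G"
  shows "{x. u x \<noteq> 0} \<subseteq> closure {x. u x \<noteq> 0}" "{x. G x \<noteq> 0} \<subseteq> closure {x. u x \<noteq> 0}"
proof -
  show "{x. u x \<noteq> 0} \<subseteq> closure {x. u x \<noteq> 0}" by (rule closure_subset)
  have "G x = 0" if x: "x \<notin> closure {x. u x \<noteq> 0}" for x
  proof -
    have ev: "eventually (\<lambda>y. u y = 0) (nhds x)"
    proof (rule eventually_mono[OF eventually_nhds_in_open[of "- closure {x. u x \<noteq> 0}" x]])
      show "u y = 0" if "y \<in> - closure {x. u x \<noteq> 0}" for y using that closure_subset[of "{x. u x \<noteq> 0}"] by auto
    qed (use x in auto)
    have "(u has_derivative (\<lambda>h. G x \<bullet> h)) (at x)" using assms by (simp add: C1c_def)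
    moreover have "(u has_derivative (\<lambda>h. 0)) (at x)"
    proof (rule has_derivative_transform_eventually[of "\<lambda>_. 0"])
      show "eventually (\<lambda>y. 0 = u y) (at x)" using ev by (auto simp: eventually_at_filter elim!: eventually_mono)
      show "0 = u x" using eventually_nhds_x_imp_x[OF ev] by simp
    qed auto
    ultimately have "(\<lambda>h. G x \<bullet> h) = (\<lambda>h. 0)" by (rule has_derivative_unique)
    then have "G x \<bullet> G x = 0" by metis
    then show ?thesis by simp
  qed
  then show "{x. G x \<noteq> 0} \<subseteq> closure {x. u x \<noteq> 0}" by auto
qed

lemma borel_measurable_lebesgue_on:
  "f \<in> borel_measurable borel \<Longrightarrow> f \<in> borel_measurable (lebesgue_on S)"
  by (simp add: measurable_completion measurable_restrict_space1)

text \<open>The link between two settings: kernel estimates live on the whole space with Borel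
  measure, Sobolev functions on w with the completed measure. Compact support inside w makes the
  integrals agree.\<close>

lemma compact_support_integral:
  fixes f :: "'a::euclidean_space \<Rightarrow> real"
  assumes cont: "continuous_on UNIV f" and K: "compact K" "K \<subseteq> w" "{x. f x \<noteq> 0} \<subseteq> K" and w: "open w"
    and nn: "\<And>x. 0 \<le> f x"
  shows "integrable (lebesgue_on w) f" "(\<integral>\<^sup>+x. ennreal (f x) \<partial>lborel) = ennreal (integral\<^sup>L (lebesgue_on w) f)"
proof -
  have [measurable]: "f \<in> borel_measurable borel" using cont by (rule borel_measurable_continuous_onI)
  have fK: "f = (\<lambda>x. indicator K x *\<^sub>R f x)" and fw: "f = (\<lambda>x. indicator w x *\<^sub>R f x)"
    using K by (auto simp: indicator_def fun_eq_iff)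
  have i: "integrable lborel f"
    by (subst fK, rule borel_integrable_compact) (use K continuous_on_subset[OF cont] in auto)
  then have iL: "integrable lebesgue f" by (simp add: integrable_completion)
  have ws: "w \<inter> space lebesgue \<in> sets lebesgue" using w by auto
  show "integrable (lebesgue_on w) f"
    using iL fw by (subst integrable_restrict_space[OF ws]) simp
  have "integral\<^sup>L (lebesgue_on w) f = (LINT x|lebesgue. indicator w x *\<^sub>R f x)"
    by (rule integral_restrict_space[OF ws])
  also have "\<dots> = integral\<^sup>L lebesgue f" using fw by simp
  also have "\<dots> = integral\<^sup>L lborel f" by (rule integral_completion) simp
  finally show "(\<integral>\<^sup>+x. ennreal (f x) \<partial>lborel) = ennreal (integral\<^sup>L (lebesgue_on w) f)"
    using nn_integral_eq_integral[OF i] nn by simp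
qed

lemma C1c_integrals:
  fixes u :: "'a::euclidean_space \<Rightarrow> real"
  assumes u: "C1c w u G" and w: "open w" and p: "0 < p"
  shows "integrable (lebesgue_on w) (\<lambda>x. \<bar>u x\<bar> powr p)"
    "(\<integral>\<^sup>+x. ennreal (\<bar>u x\<bar> powr p) \<partial>lborel) = ennreal (LINT x|lebesgue_on w. \<bar>u x\<bar> powr p)"
    "integrable (lebesgue_on w) (\<lambda>x. norm (G x) powr p)"
    "(\<integral>\<^sup>+x. ennreal (norm (G x) powr p) \<partial>lborel) = ennreal (LINT x|lebesgue_on w. norm (G x) powr p)"
proof -
  let ?K = "closure {x. u x \<noteq> 0}"
  have K: "compact ?K" "?K \<subseteq> w" using u by (auto simp: C1c_def)
  have c1: "continuous_on UNIV (\<lambda>x. \<bar>u x\<bar> powr p)"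
    using p by (intro continuous_on_powr' continuous_intros C1c_continuous[OF u]) auto
  have "continuous_on UNIV G" using u by (simp add: C1c_def)
  then have c2: "continuous_on UNIV (\<lambda>x. norm (G x) powr p)"
    using p by (intro continuous_on_powr' continuous_intros) auto
  have s1: "{x. \<bar>u x\<bar> powr p \<noteq> 0} \<subseteq> ?K" using C1c_support(1)[OF u] by auto
  have s2: "{x. norm (G x) powr p \<noteq> 0} \<subseteq> ?K" using C1c_support(2)[OF u] by auto
  show "integrable (lebesgue_on w) (\<lambda>x. \<bar>u x\<bar> powr p)"
    "(\<integral>\<^sup>+x. ennreal (\<bar>u x\<bar> powr p) \<partial>lborel) = ennreal (LINT x|lebesgue_on w. \<bar>u x\<bar> powr p)"
    using compact_support_integral[OF c1 K s1 w] by auto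
  show "integrable (lebesgue_on w) (\<lambda>x. norm (G x) powr p)"
    "(\<integral>\<^sup>+x. ennreal (norm (G x) powr p) \<partial>lborel) = ennreal (LINT x|lebesgue_on w. norm (G x) powr p)"
    using compact_support_integral[OF c2 K s2 w] by auto
qed

text \<open>Jensen over the ball, followed by enlarging the ball to the whole space. The bound does
  not depend on x, so it can be integrated against a measure of finite total mass.\<close>

lemma ball_avg_powr_le:
  fixes u :: "'a::euclidean_space \<Rightarrow> real"
  assumes cont: "continuous_on UNIV u" and r: "0 < r" and p: "1 < p"
  shows "ennreal (\<bar>ball_avg r u x\<bar> powr p)
     \<le> ennreal (1 / (unit_ball_vol (real DIM('a)) * r ^ DIM('a))) * (\<integral>\<^sup>+y. ennreal (\<bar>u y\<bar> powr p) \<partial>lborel)"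
proof -
  have [measurable]: "u \<in> borel_measurable borel" using cont by (rule borel_measurable_continuous_onI)
  define c where "c = unit_ball_vol (real DIM('a)) * r ^ DIM('a)"
  have c: "c > 0" using r by (simp add: c_def)
  define nu where "nu = density lborel (indicator (ball 0 r) :: 'a \<Rightarrow> ennreal)"
  have nu: "emeasure nu (space nu) \<le> ennreal c"
    using r by (simp add: nu_def emeasure_density emeasure_ball c_def)
  have "ennreal (c * \<bar>ball_avg r u x\<bar>) = ennreal (norm (LINT z|lborel. indicator (ball 0 r) z * u (x + z)))"
    using c by (simp add: ball_avg_def c_def[symmetric] abs_mult)
  also have "\<dots> \<le> (\<integral>\<^sup>+z. norm (indicator (ball 0 r) z * u (x + z)) \<partial>lborel)"
    by (rule integral_norm_bound_ennreal[OF integrable_ball_continuous[OF cont]])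
  also have "\<dots> = (\<integral>\<^sup>+z. ennreal \<bar>u (x + z)\<bar> \<partial>nu)"
    unfolding nu_def by (subst nn_integral_density) (auto intro!: nn_integral_cong simp: indicator_def)
  finally have "ennreal ((c * \<bar>ball_avg r u x\<bar>) powr p) \<le> ennreal (c powr (p - 1)) * (\<integral>\<^sup>+z. ennreal (\<bar>u (x + z)\<bar> powr p) \<partial>nu)"
    using c by (intro power_mean_nn_integral[OF nu c _ _ _ _ p]) (auto simp: nu_def)
  also have "(\<integral>\<^sup>+z. ennreal (\<bar>u (x + z)\<bar> powr p) \<partial>nu) \<le> (\<integral>\<^sup>+z. ennreal (\<bar>u (x + z)\<bar> powr p) \<partial>lborel)"
    unfolding nu_def by (subst nn_integral_density) (auto intro!: nn_integral_mono simp: indicator_def)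
  also have "\<dots> = (\<integral>\<^sup>+y. ennreal (\<bar>u y\<bar> powr p) \<partial>lborel)"
    by (rule nn_integral_lborel_translate[of "\<lambda>y. ennreal (\<bar>u y\<bar> powr p)"]) measurable
  finally have 1: "ennreal ((c * \<bar>ball_avg r u x\<bar>) powr p) \<le> ennreal (c powr (p - 1)) * (\<integral>\<^sup>+y. ennreal (\<bar>u y\<bar> powr p) \<partial>lborel)"
    by (simp add: mult_left_mono)
  have cc: "c powr - p * c powr p = 1" using c by (simp flip: powr_add)
  have "ennreal (\<bar>ball_avg r u x\<bar> powr p) = ennreal (c powr - p) * ennreal ((c * \<bar>ball_avg r u x\<bar>) powr p)"
    using c cc by (simp add: ennreal_mult[symmetric] powr_mult mult.assoc[symmetric])
  also have "\<dots> \<le> ennreal (c powr - p) * (ennreal (c powr (p - 1)) * (\<integral>\<^sup>+y. ennreal (\<bar>u y\<bar> powr p) \<partial>lborel))"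
    by (intro mult_left_mono 1) simp
  also have "\<dots> = ennreal (c powr - p * c powr (p - 1)) * (\<integral>\<^sup>+y. ennreal (\<bar>u y\<bar> powr p) \<partial>lborel)"
    by (simp add: ennreal_mult mult.assoc)
  also have "c powr - p * c powr (p - 1) = 1 / c" using c by (simp add: powr_diff powr_minus)
  finally show ?thesis unfolding c_def .
qed

text \<open>Write u as oscillation plus ball average: the oscillation costs a small multiple of the
  gradient term, and the average is bounded uniformly by the p-norm, at the price of the total mass
  of \<open>mu\<close>.\<close>

lemma trace_of_small_oscillation:
  fixes mu :: "'a::euclidean_space measure"
  assumes osc: "small_oscillation p mu" and p: "1 < p" and sets_mu: "sets mu = sets borel"
    and fin: "emeasure mu UNIV < \<infinity>" and w: "open w" and d: "0 < d"
  obtains C where "0 \<le> C" "\<And>u G. C1c w u G \<Longrightarrow> (\<integral>\<^sup>+x. ennreal (\<bar>u x\<bar> powr p) \<partial>mu)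
     \<le> ennreal (d * (LINT x|lebesgue_on w. norm (G x) powr p) + C * (LINT x|lebesgue_on w. \<bar>u x\<bar> powr p))"
proof -
  note [measurable_cong] = sets_mu
  \<comment> \<open>Compensates the factor 2^p from raising a sum to the power p.\<close>
  define d' where "d' = d / 2 powr p"
  have d': "0 < d'" using d by (simp add: d'_def)
  obtain r where r: "0 < r" and osc': "\<And>u G. (\<forall>x. (u has_derivative (\<lambda>h. G x \<bullet> h)) (at x)) \<Longrightarrow> continuous_on UNIV G \<Longrightarrow>
     (\<integral>\<^sup>+x. ennreal (\<bar>u x - ball_avg r u x\<bar> powr p) \<partial>mu) \<le> ennreal d' * (\<integral>\<^sup>+y. ennreal (norm (G y) powr p) \<partial>lborel)"
    using osc d' unfolding small_oscillation_def by blast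
  define m where "m = measure mu UNIV"
  have sp: "space mu = UNIV" using sets_eq_imp_space_eq[OF sets_mu] by simp
  have m: "emeasure mu UNIV = ennreal m" "0 \<le> m" using fin by (auto simp: m_def emeasure_eq_ennreal_measure less_top[symmetric])
  define C where "C = 2 powr p * (m * (1 / (unit_ball_vol (real DIM('a)) * r ^ DIM('a))))"
  have C: "0 \<le> C" using m r by (simp add: C_def)
  show thesis
  proof (rule that[OF C])
    fix u :: "'a \<Rightarrow> real" and G assume u: "C1c w u G"
    have [measurable]: "u \<in> borel_measurable borel"
      by (rule borel_measurable_continuous_onI[OF C1c_continuous[OF u]])
    let ?g = "LINT x|lebesgue_on w. norm (G x) powr p" and ?u = "LINT x|lebesgue_on w. \<bar>u x\<bar> powr p"
    let ?k = "1 / (unit_ball_vol (real DIM('a)) * r ^ DIM('a))"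
    have pos: "0 \<le> ?g" "0 \<le> ?u" "0 \<le> ?k" using r by auto
    have 1: "(\<integral>\<^sup>+x. ennreal (\<bar>u x - ball_avg r u x\<bar> powr p) \<partial>mu) \<le> ennreal (d' * ?g)"
      using osc'[of u G] u C1c_integrals(4)[OF u w, of p] p d' by (simp add: C1c_def ennreal_mult)
    have 2: "(\<integral>\<^sup>+x. ennreal (\<bar>ball_avg r u x\<bar> powr p) \<partial>mu) \<le> ennreal (m * (?k * ?u))"
    proof -
      have "(\<integral>\<^sup>+x. ennreal (\<bar>ball_avg r u x\<bar> powr p) \<partial>mu) \<le> (\<integral>\<^sup>+x. ennreal (?k * ?u) \<partial>mu)"
        using ball_avg_powr_le[OF C1c_continuous[OF u] r p] C1c_integrals(2)[OF u w, of p] p pos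
        by (intro nn_integral_mono) (simp only: ennreal_mult)
      also have "\<dots> = ennreal (m * (?k * ?u))"
        using pos m by (simp only: nn_integral_const sp m(1) ennreal_mult mult_nonneg_nonneg mult.commute)
      finally show ?thesis .
    qed
    have "(\<integral>\<^sup>+x. ennreal (\<bar>u x\<bar> powr p) \<partial>mu)
      \<le> (\<integral>\<^sup>+x. ennreal (2 powr p) * (ennreal (\<bar>u x - ball_avg r u x\<bar> powr p) + ennreal (\<bar>ball_avg r u x\<bar> powr p)) \<partial>mu)"
    proof (rule nn_integral_mono)
      fix x
      have "\<bar>u x\<bar> powr p \<le> 2 powr p * (\<bar>u x - ball_avg r u x\<bar> powr p + \<bar>ball_avg r u x\<bar> powr p)"
        using norm_add_powr_le[of p "u x - ball_avg r u x" "ball_avg r u x"] p by simp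
      from ennreal_leI[OF this]
      show "ennreal (\<bar>u x\<bar> powr p) \<le> ennreal (2 powr p) * (ennreal (\<bar>u x - ball_avg r u x\<bar> powr p) + ennreal (\<bar>ball_avg r u x\<bar> powr p))"
        by (simp add: ennreal_mult)
    qed
    also have "\<dots> = ennreal (2 powr p) * ((\<integral>\<^sup>+x. ennreal (\<bar>u x - ball_avg r u x\<bar> powr p) \<partial>mu) + (\<integral>\<^sup>+x. ennreal (\<bar>ball_avg r u x\<bar> powr p) \<partial>mu))"
      by (subst nn_integral_cmult, measurable, subst nn_integral_add, measurable)
    also have "\<dots> \<le> ennreal (2 powr p) * (ennreal (d' * ?g) + ennreal (m * (?k * ?u)))"
      by (intro mult_left_mono add_mono 1 2) simp
    also have "\<dots> = ennreal (2 powr p * (d' * ?g + m * (?k * ?u)))"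
      using pos m(2) d' by (subst ennreal_plus[symmetric]) (auto simp: ennreal_mult)
    also have "2 powr p * (d' * ?g + m * (?k * ?u)) = d * ?g + C * ?u"
      by (simp add: d'_def C_def algebra_simps)
    finally show "(\<integral>\<^sup>+x. ennreal (\<bar>u x\<bar> powr p) \<partial>mu) \<le> ennreal (d * ?g + C * ?u)" .
  qed
qed

section \<open>The Morrey class\<close>

text \<open>The measure |V| dx on w. As V is only Lebesgue measurable, the density is a Borel
  function that agrees almost everywhere, which keeps \<open>mu\<close> on the Borel sets.\<close>

lemma weight_measure:
  fixes V :: "'a::euclidean_space \<Rightarrow> real"
  assumes w: "open w" and V: "integrable (lebesgue_on w) V"
  obtains mu where "sets mu = sets borel" "emeasure mu UNIV < \<infinity>"
    "\<And>f. f \<in> borel_measurable borel \<Longrightarrow> (\<integral>\<^sup>+x. f x \<partial>mu) = (\<integral>\<^sup>+x. ennreal \<bar>V x\<bar> * f x \<partial>lebesgue_on w)"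
    "\<And>y r. emeasure mu (ball y r) = ennreal (LINT x|lebesgue_on (w \<inter> ball y r). \<bar>V x\<bar>)"
proof -
  define g where "g x = indicator w x *\<^sub>R V x" for x
  have ws: "w \<inter> space lebesgue \<in> sets lebesgue" using w by auto
  have ig: "integrable lebesgue g" unfolding g_def using V integrable_restrict_space[OF ws, of V] by simp
  then have gm: "g \<in> borel_measurable lebesgue" by auto
  obtain g' where g'[measurable]: "g' \<in> borel_measurable lborel" and ae: "AE x in lborel. g x = g' x"
    using completion_ex_borel_measurable_real[OF gm] by blast
  define mu where "mu = density lborel (\<lambda>x. ennreal \<bar>g' x\<bar>)"
  have aeL: "AE x in lebesgue. g x = g' x" using ae by (rule AE_completion)
  have int: "(\<integral>\<^sup>+x. f x \<partial>mu) = (\<integral>\<^sup>+x. ennreal \<bar>V x\<bar> * f x \<partial>lebesgue_on w)" if [measurable]: "f \<in> borel_measurable borel" for f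
  proof -
    have "(\<integral>\<^sup>+x. f x \<partial>mu) = (\<integral>\<^sup>+x. ennreal \<bar>g' x\<bar> * f x \<partial>lborel)"
      unfolding mu_def by (rule nn_integral_density) measurable
    also have "\<dots> = (\<integral>\<^sup>+x. ennreal \<bar>g' x\<bar> * f x \<partial>lebesgue)" by (simp add: nn_integral_completion)
    also have "\<dots> = (\<integral>\<^sup>+x. (ennreal \<bar>V x\<bar> * f x) * indicator w x \<partial>lebesgue)"
      using aeL by (intro nn_integral_cong_AE, eventually_elim) (auto simp: g_def indicator_def)
    also have "\<dots> = (\<integral>\<^sup>+x. ennreal \<bar>V x\<bar> * f x \<partial>lebesgue_on w)"
      by (rule nn_integral_restrict_space[OF ws, symmetric])
    finally show ?thesis .
  qed
  show thesis
  proof (rule that[of mu])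
    show "sets mu = sets borel" by (simp add: mu_def)
    show "(\<integral>\<^sup>+x. f x \<partial>mu) = (\<integral>\<^sup>+x. ennreal \<bar>V x\<bar> * f x \<partial>lebesgue_on w)" if "f \<in> borel_measurable borel" for f
      using int[OF that] .
    have "emeasure mu UNIV = (\<integral>\<^sup>+x. 1 \<partial>mu)" by (simp add: mu_def)
    also have "\<dots> = (\<integral>\<^sup>+x. ennreal \<bar>V x\<bar> \<partial>lebesgue_on w)" by (subst int) auto
    also have "\<dots> = ennreal (LINT x|lebesgue_on w. \<bar>V x\<bar>)"
      using V by (intro nn_integral_eq_integral) auto
    finally show "emeasure mu UNIV < \<infinity>" by simp
    fix y :: 'a and r :: real
    have bs: "(w \<inter> ball y r) \<inter> space lebesgue \<in> sets lebesgue" using w by auto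
    have "integrable lebesgue (\<lambda>x. indicator (ball y r) x *\<^sub>R g x)"
      by (rule integrable_mult_indicator[OF _ ig]) auto
    moreover have "(\<lambda>x. indicator (ball y r) x *\<^sub>R g x) = (\<lambda>x. indicator (w \<inter> ball y r) x *\<^sub>R V x)"
      by (auto simp: g_def indicator_def)
    ultimately have "integrable (lebesgue_on (w \<inter> ball y r)) V"
      using integrable_restrict_space[OF bs, of V] by simp
    then have iV: "integrable (lebesgue_on (w \<inter> ball y r)) (\<lambda>x. \<bar>V x\<bar>)" by auto
    have "emeasure mu (ball y r) = (\<integral>\<^sup>+x. indicator (ball y r) x \<partial>mu)"
      by (subst nn_integral_indicator) (auto simp: mu_def)
    also have "\<dots> = (\<integral>\<^sup>+x. ennreal \<bar>V x\<bar> * indicator (ball y r) x \<partial>lebesgue_on w)"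
      by (rule int) measurable
    also have "\<dots> = (\<integral>\<^sup>+x. ennreal \<bar>V x\<bar> * indicator (ball y r) x * indicator w x \<partial>lebesgue)"
      by (rule nn_integral_restrict_space[OF ws])
    also have "\<dots> = (\<integral>\<^sup>+x. ennreal \<bar>V x\<bar> * indicator (w \<inter> ball y r) x \<partial>lebesgue)"
      by (intro nn_integral_cong) (auto simp: indicator_def)
    also have "\<dots> = (\<integral>\<^sup>+x. ennreal \<bar>V x\<bar> \<partial>lebesgue_on (w \<inter> ball y r))"
      by (rule nn_integral_restrict_space[OF bs, symmetric])
    also have "\<dots> = ennreal (LINT x|lebesgue_on (w \<inter> ball y r). \<bar>V x\<bar>)"
      by (rule nn_integral_eq_integral[OF iV]) auto
    finally show "emeasure mu (ball y r) = ennreal (LINT x|lebesgue_on (w \<inter> ball y r). \<bar>V x\<bar>)" .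
  qed
qed

text \<open>The Morrey condition is read as a growth bound: q > n / p gives the exponent n - n / q >
  n - p, q > n gives the logarithmic exponent q (n - 1) / n > n - 1, and for p > n the total mass is
  enough. It speaks only of centres in w and radii below the diameter, and has to be extended to
  other balls.\<close>

lemma Morrey_small_oscillation:
  fixes V :: "'a::euclidean_space \<Rightarrow> real"
  assumes n: "2 \<le> DIM('a)" and p: "1 < p" and w: "open w" "bounded w" "w \<noteq> {}" and V: "morrey p q w V"
    and sets_mu: "sets mu = sets borel" and fin: "emeasure mu UNIV < \<infinity>"
    and ball: "\<And>y r. emeasure mu (ball y r) = ennreal (LINT x|lebesgue_on (w \<inter> ball y r). \<bar>V x\<bar>)"
  shows "small_oscillation p mu"
proof -
  let ?n = "real DIM('a)"
  define d where "d = diameter w"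
  have d: "0 < d"
  proof -
    obtain x e where xe: "e > 0" "cball x e \<subseteq> w" using w open_contains_cball by blast
    obtain b :: 'a where b: "b \<in> Basis" using nonempty_Basis by blast
    have "x \<in> w" "x + e *\<^sub>R b \<in> w" using xe b by (auto intro!: subsetD[OF xe(2)] simp: dist_norm)
    then have "dist x (x + e *\<^sub>R b) \<le> d" unfolding d_def using diameter_bounded_bound[OF w(2)] by blast
    then show ?thesis using xe b by (simp add: dist_norm)
  qed
  have sp: "space mu = UNIV" using sets_eq_imp_space_eq[OF sets_mu] by simp
  have sf: "sigma_finite_measure mu"
    using fin sp by (intro finite_measure.axioms(1) finite_measureI) auto
  define T where "T = measure mu UNIV"
  have T: "0 \<le> T" "\<And>A. emeasure mu A \<le> ennreal T"
    using fin emeasure_space[of mu] by (auto simp: T_def sp emeasure_eq_ennreal_measure less_top[symmetric])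
  \<comment> \<open>A ball that meets w is contained in one of twice the radius centred in w; a ball
    that misses w has mass 0.\<close>
  have step: "emeasure mu (ball y r) \<le> ennreal B"
    if B: "0 \<le> B" "\<And>y0. y0 \<in> w \<Longrightarrow> emeasure mu (ball y0 (2 * r)) \<le> ennreal B" for y r B
  proof (cases "w \<inter> ball y r = {}")
    case True then show ?thesis using ball[of y r] by simp
  next
    case False
    then obtain y0 where y0: "y0 \<in> w" "dist y y0 < r" by auto
    have "ball y r \<subseteq> ball y0 (2 * r)"
    proof
      fix z assume "z \<in> ball y r"
      then show "z \<in> ball y0 (2 * r)" using y0(2) dist_triangle[of y0 z y] by (simp add: dist_commute)
    qed
    then have "emeasure mu (ball y r) \<le> emeasure mu (ball y0 (2 * r))"
      by (intro emeasure_mono) (auto simp: sets_mu)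
    then show ?thesis using B(2)[OF y0(1)] by (rule order_trans)
  qed
  consider "p < ?n" | "p = ?n" | "p > ?n" by linarith
  then show ?thesis
  proof cases
    case 1
    define s where "s = ?n / (q / (q - 1))"
    obtain C where q: "?n / p < q" and C: "\<And>y r. y \<in> w \<Longrightarrow> 0 < r \<Longrightarrow> r < d \<Longrightarrow> r powr (- s) * (LINT x|lebesgue_on (w \<inter> ball y r). \<bar>V x\<bar>) \<le> C"
      using V 1 unfolding morrey_def Let_def d_def s_def by auto
    have "1 < ?n / p" using 1 p by (simp add: field_simps)
    then have qp: "1 < q" using q by linarith
    have s: "s = ?n - ?n / q" using qp by (simp add: s_def field_simps)
    have "?n / q < p" using q qp p by (simp add: field_simps)
    then have s': "?n - p < s" "0 \<le> s" using s 1 by auto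
    \<comment> \<open>The first term is the Morrey bound at the doubled radius, the second covers 2
      r >= d by the total mass.\<close>
    define K where "K = \<bar>C\<bar> * 2 powr s + T * (2 / d) powr s"
    have K: "0 \<le> K" using T by (simp add: K_def)
    show ?thesis
    proof (rule small_oscillation_powr[OF n p sets_mu sf K s'(1)])
      fix y :: 'a and r :: real assume r: "0 < r"
      show "emeasure mu (ball y r) \<le> ennreal (K * r powr s)"
      proof (rule step)
        show "0 \<le> K * r powr s" using K by simp
        have split: "K * r powr s = \<bar>C\<bar> * (2 * r) powr s + T * (2 * r / d) powr s"
          using r d by (simp add: K_def powr_mult powr_divide algebra_simps)
        fix y0 assume y0: "y0 \<in> w"
        show "emeasure mu (ball y0 (2 * r)) \<le> ennreal (K * r powr s)"
        proof (cases "2 * r < d")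
          case True
          let ?M = "LINT x|lebesgue_on (w \<inter> ball y0 (2 * r)). \<bar>V x\<bar>"
          have "(2 * r) powr s * ((2 * r) powr - s * ?M) \<le> (2 * r) powr s * C"
            using C[OF y0 _ True] r by (intro mult_left_mono) auto
          moreover have "(2 * r) powr s * (2 * r) powr - s = 1" using r by (simp flip: powr_add)
          ultimately have "?M \<le> C * (2 * r) powr s" by (metis mult.assoc mult.commute mult_1)
          also have "\<dots> \<le> \<bar>C\<bar> * (2 * r) powr s" by (intro mult_right_mono) auto
          also have "\<dots> \<le> K * r powr s" unfolding split using T by simp
          finally show ?thesis unfolding ball by (rule ennreal_leI)
        next
          case False
          then have "1 \<le> (2 * r / d) powr s" using d s' by (intro ge_one_powr_ge_zero) auto
          then have "T * 1 \<le> T * (2 * r / d) powr s" using T by (intro mult_left_mono) auto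
          then have "T \<le> K * r powr s" unfolding split by (simp add: add_increasing)
          then show ?thesis using T(2)[of "ball y0 (2 * r)"] by (meson ennreal_leI order_trans)
        qed
      qed
    qed
  next
    case 2
    define gam where "gam = q / (?n / (?n - 1))"
    obtain C where q: "?n < q" and C: "\<And>y r. y \<in> w \<Longrightarrow> 0 < r \<Longrightarrow> r < d \<Longrightarrow> ln (d / r) powr gam * (LINT x|lebesgue_on (w \<inter> ball y r). \<bar>V x\<bar>) \<le> C"
      using V 2 unfolding morrey_def Let_def d_def gam_def by auto
    have gam: "?n - 1 < gam"
    proof -
      have "(?n - 1) * ?n < (?n - 1) * q" using q n by (intro mult_strict_left_mono) auto
      then show ?thesis using n by (simp add: gam_def field_simps)
    qed
    \<comment> \<open>Halving the diameter absorbs the doubled radius, as d / (2 r) = (d / 2) /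
      r.\<close>
    show ?thesis
    proof (rule small_oscillation_log[OF n 2 sets_mu sf _ gam, of "\<bar>C\<bar>" "d / 2"])
      fix y :: 'a and r :: real assume r: "0 < r" "r < d / 2"
      have l: "0 < ln (d / 2 / r)" using r d by (subst ln_gt_zero_iff) (auto simp: field_simps)
      show "emeasure mu (ball y r) \<le> ennreal (\<bar>C\<bar> * ln (d / 2 / r) powr - gam)"
      proof (rule step)
        fix y0 assume y0: "y0 \<in> w"
        let ?M = "LINT x|lebesgue_on (w \<inter> ball y0 (2 * r)). \<bar>V x\<bar>" and ?l = "ln (d / 2 / r)"
        have "ln (d / (2 * r)) powr gam * ?M \<le> C" using C[OF y0, of "2 * r"] r by simp
        then have "?l powr gam * ?M \<le> \<bar>C\<bar>" by (simp add: divide_divide_eq_left)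
        then have le: "?l powr - gam * (?l powr gam * ?M) \<le> ?l powr - gam * \<bar>C\<bar>" by (intro mult_left_mono) auto
        have "?l powr - gam * ?l powr gam = 1" using l by (simp flip: powr_add)
        then have "?l powr - gam * (?l powr gam * ?M) = ?M" by (simp only: mult.assoc[symmetric] mult_1)
        with le have "?M \<le> \<bar>C\<bar> * ?l powr - gam" by (simp only: mult.commute[of "\<bar>C\<bar>"])
        then show "emeasure mu (ball y0 (2 * r)) \<le> ennreal (\<bar>C\<bar> * ?l powr - gam)" unfolding ball by (rule ennreal_leI)
      qed simp
    qed (use d in auto)
  next
    case 3
    \<comment> \<open>The growth exponent 0 already exceeds n - p.\<close>
    show ?thesis
      by (rule small_oscillation_powr[OF n p sets_mu sf T(1), of 0]) (use 3 T(2) in auto)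
  qed
qed

lemma Morrey_trace:
  fixes V :: "'a::euclidean_space \<Rightarrow> real"
  assumes n: "2 \<le> DIM('a)" and p: "1 < p" and w: "open w" "bounded w" "w \<noteq> {}" and V: "morrey p q w V"
    and d: "0 < d"
  shows "\<exists>C\<ge>0. \<forall>u G. C1c w u G \<longrightarrow> integrable (lebesgue_on w) (\<lambda>x. \<bar>V x\<bar> * \<bar>u x\<bar> powr p) \<and>
     (LINT x|lebesgue_on w. \<bar>V x\<bar> * \<bar>u x\<bar> powr p)
       \<le> d * (LINT x|lebesgue_on w. norm (G x) powr p) + C * (LINT x|lebesgue_on w. \<bar>u x\<bar> powr p)"
proof -
  have iV: "integrable (lebesgue_on w) V" using V by (auto simp: morrey_def Let_def split: if_splits)
  obtain mu where mu: "sets mu = sets borel" "emeasure mu UNIV < \<infinity>"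
    "\<And>f. f \<in> borel_measurable borel \<Longrightarrow> (\<integral>\<^sup>+x. f x \<partial>mu) = (\<integral>\<^sup>+x. ennreal \<bar>V x\<bar> * f x \<partial>lebesgue_on w)"
    "\<And>y r. emeasure mu (ball y r) = ennreal (LINT x|lebesgue_on (w \<inter> ball y r). \<bar>V x\<bar>)"
    using weight_measure[OF w(1) iV] by blast
  have osc: "small_oscillation p mu"
    by (rule Morrey_small_oscillation[OF n p w V mu(1,2,4)])
  obtain C where C: "0 \<le> C" "\<And>u G. C1c w u G \<Longrightarrow> (\<integral>\<^sup>+x. ennreal (\<bar>u x\<bar> powr p) \<partial>mu)
     \<le> ennreal (d * (LINT x|lebesgue_on w. norm (G x) powr p) + C * (LINT x|lebesgue_on w. \<bar>u x\<bar> powr p))"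
    using trace_of_small_oscillation[OF osc p mu(1,2) w(1) d] by metis
  show ?thesis
  proof (intro exI[of _ C] conjI C(1) allI impI)
    fix u :: "'a \<Rightarrow> real" and G assume u: "C1c w u G"
    have um[measurable]: "u \<in> borel_measurable borel"
      by (rule borel_measurable_continuous_onI[OF C1c_continuous[OF u]])
    note [measurable] = borel_measurable_lebesgue_on[OF um]
    have [measurable]: "V \<in> borel_measurable (lebesgue_on w)" using iV by auto
    let ?B = "d * (LINT x|lebesgue_on w. norm (G x) powr p) + C * (LINT x|lebesgue_on w. \<bar>u x\<bar> powr p)"
    have "(\<integral>\<^sup>+x. ennreal (\<bar>V x\<bar> * \<bar>u x\<bar> powr p) \<partial>lebesgue_on w) = (\<integral>\<^sup>+x. ennreal \<bar>V x\<bar> * ennreal (\<bar>u x\<bar> powr p) \<partial>lebesgue_on w)"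
      by (simp add: ennreal_mult)
    also have "\<dots> = (\<integral>\<^sup>+x. ennreal (\<bar>u x\<bar> powr p) \<partial>mu)" by (rule mu(3)[symmetric]) measurable
    also have "\<dots> \<le> ennreal ?B" by (rule C(2)[OF u])
    finally have b: "(\<integral>\<^sup>+x. ennreal (\<bar>V x\<bar> * \<bar>u x\<bar> powr p) \<partial>lebesgue_on w) \<le> ennreal ?B" .
    have i: "integrable (lebesgue_on w) (\<lambda>x. \<bar>V x\<bar> * \<bar>u x\<bar> powr p)"
      using b by (intro integrableI_nonneg) (auto simp: less_top[symmetric] top_unique)
    have B0: "0 \<le> ?B" using d C(1) by (intro add_nonneg_nonneg mult_nonneg_nonneg integral_nonneg_AE) auto
    have "ennreal (LINT x|lebesgue_on w. \<bar>V x\<bar> * \<bar>u x\<bar> powr p) \<le> ennreal ?B"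
      using b nn_integral_eq_integral[OF i] by simp
    then show "(LINT x|lebesgue_on w. \<bar>V x\<bar> * \<bar>u x\<bar> powr p) \<le> ?B" using B0 by simp
    show "integrable (lebesgue_on w) (\<lambda>x. \<bar>V x\<bar> * \<bar>u x\<bar> powr p)" by (fact i)
  qed
qed

section \<open>Compactness\<close>

lemma integral_lborel_translate:
  fixes F :: "'a::euclidean_space \<Rightarrow> real"
  assumes [measurable]: "F \<in> borel_measurable borel"
  shows "(LINT z|lborel. F (x + z)) = (LINT y|lborel. F y)"
proof -
  have "(LINT y|lborel. F y) = (LINT y|distr lborel borel ((+) x). F y)" by (simp add: lborel_distr_plus)
  also have "\<dots> = (LINT z|lborel. F (x + z))" by (rule integral_distr) measurable
  finally show ?thesis ..
qed

text \<open>Two balls with nearby centres differ inside a thin shell, over which the integral of |u|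
  is at most E times the volume of the shell plus E^(1-p) B. First E is taken large, then the shell
  thin; the same h serves every u with the bound B.\<close>

lemma ball_avg_equicontinuous:
  fixes x :: "'a::euclidean_space"
  assumes r: "0 < r" and p: "1 < p" and B: "0 \<le> B" and e: "0 < e"
  obtains h where "0 < h" "\<And>u x'. continuous_on UNIV u \<Longrightarrow> (\<integral>\<^sup>+y. ennreal (\<bar>u y\<bar> powr p) \<partial>lborel) \<le> ennreal B \<Longrightarrow>
     dist x x' < h \<Longrightarrow> \<bar>ball_avg r u x - ball_avg r u x'\<bar> \<le> e"
proof -
  let ?v = "unit_ball_vol (real DIM('a))"
  define c where "c = ?v * r ^ DIM('a)"
  have c: "0 < c" using r by (simp add: c_def)
  \<comment> \<open>Large enough that E^(1-p) B <= c e / 2; using B + 1 keeps E positive when B =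
    0.\<close>
  define E where "E = (2 * (B + 1) / (c * e)) powr (1 / (p - 1))"
  have E: "0 < E" using B c e by (simp add: E_def)
  have "E powr (1 - p) = (2 * (B + 1) / (c * e)) powr (- 1)"
    using p unfolding E_def powr_powr by (intro arg_cong[where f="\<lambda>a. _ powr a"]) (simp add: field_simps)
  also have "\<dots> = c * e / (2 * (B + 1))" using B c e by (simp add: powr_minus)
  finally have Ep: "E powr (1 - p) = c * e / (2 * (B + 1))" .
  have "E powr (1 - p) * B = c * e / 2 * (B / (B + 1))" using B by (simp add: Ep)
  also have "\<dots> \<le> c * e / 2 * 1" using B c e by (intro mult_left_mono) auto
  finally have EB: "E powr (1 - p) * B \<le> c * e / 2" by simp
  have "((\<lambda>h. E * (?v * (r + h) ^ DIM('a) - ?v * (r - h) ^ DIM('a))) \<longlongrightarrow> E * (?v * (r + 0) ^ DIM('a) - ?v * (r - 0) ^ DIM('a))) (at_right 0)"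
    by (intro tendsto_intros)
  then have "eventually (\<lambda>h. E * (?v * (r + h) ^ DIM('a) - ?v * (r - h) ^ DIM('a)) < c * e / 2) (at_right 0)"
    using c e by (intro order_tendstoD(2)[where y="E * (?v * (r + 0) ^ DIM('a) - ?v * (r - 0) ^ DIM('a))"]) auto
  moreover have "eventually (\<lambda>h. h \<in> {0<..<r}) (at_right 0)"
    using r by (intro eventually_at_right_real)
  ultimately have "eventually (\<lambda>h. E * (?v * (r + h) ^ DIM('a) - ?v * (r - h) ^ DIM('a)) < c * e / 2 \<and> h \<in> {0<..<r}) (at_right 0)"
    by (rule eventually_conj)
  then obtain h where h: "E * (?v * (r + h) ^ DIM('a) - ?v * (r - h) ^ DIM('a)) < c * e / 2" "0 < h" "h < r"
    using eventually_happens'[of "at_right (0::real)"] by fastforce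
  show thesis
  proof (rule that[OF h(2)])
    fix u :: "'a \<Rightarrow> real" and x'
    assume cont: "continuous_on UNIV u" and uB: "(\<integral>\<^sup>+y. ennreal (\<bar>u y\<bar> powr p) \<partial>lborel) \<le> ennreal B" and x': "dist x x' < h"
    have [measurable]: "u \<in> borel_measurable borel" using cont by (rule borel_measurable_continuous_onI)
    have avg: "c * ball_avg r u z = (LINT y|lborel. indicator (ball z r) y * u y)" for z
    proof -
      have "c * ball_avg r u z = (LINT y|lborel. indicator (ball 0 r) y * u (z + y))"
        using c by (simp add: ball_avg_def flip: c_def)
      also have "\<dots> = (LINT y|lborel. indicator (ball z r) (z + y) * u (z + y))"
        by (intro Bochner_Integration.integral_cong) (auto simp: indicator_def dist_norm)
      also have "\<dots> = (LINT y|lborel. indicator (ball z r) y * u y)"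
        by (rule integral_lborel_translate[of "\<lambda>y. indicator (ball z r) y * u y"]) measurable
      finally show ?thesis .
    qed
    have int: "integrable lborel (\<lambda>y. indicator (ball z r) y * u y)" for z
    proof -
      have "integrable lborel (\<lambda>y. indicator (cball z r) y *\<^sub>R u y)"
        by (rule borel_integrable_compact) (use continuous_on_subset[OF cont] in auto)
      then show ?thesis by (rule Bochner_Integration.integrable_bound) (auto simp: indicator_def)
    qed
    define A where "A = ball x (r + h) - ball x (r - h)"
    have [measurable]: "A \<in> sets borel" by (simp add: A_def)
    have eA: "emeasure lborel A = ennreal (?v * (r + h) ^ DIM('a) - ?v * (r - h) ^ DIM('a))"
    proof -
      have "emeasure lborel A = emeasure lborel (ball x (r + h)) - emeasure lborel (ball x (r - h))"
        unfolding A_def using h emeasure_lborel_ball_finite[of x "r - h"] by (intro emeasure_Diff) (auto intro!: subset_ball simp: less_top)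
      also have "\<dots> = ennreal (?v * (r + h) ^ DIM('a)) - ennreal (?v * (r - h) ^ DIM('a))"
        using h r by (simp add: emeasure_ball)
      also have "\<dots> = ennreal (?v * (r + h) ^ DIM('a) - ?v * (r - h) ^ DIM('a))"
        using h r by (intro ennreal_minus) auto
      finally show ?thesis .
    qed
    have A0: "0 \<le> ?v * (r + h) ^ DIM('a) - ?v * (r - h) ^ DIM('a)"
      using h r by (simp add: power_mono)
    have "ennreal (c * \<bar>ball_avg r u x - ball_avg r u x'\<bar>) = ennreal \<bar>c * ball_avg r u x - c * ball_avg r u x'\<bar>"
      using c by (simp add: abs_mult flip: right_diff_distrib)
    also have "\<dots> = ennreal (norm (LINT y|lborel. indicator (ball x r) y * u y - indicator (ball x' r) y * u y))"
      unfolding avg Bochner_Integration.integral_diff[OF int int] by simp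
    also have "\<dots> \<le> (\<integral>\<^sup>+y. norm (indicator (ball x r) y * u y - indicator (ball x' r) y * u y) \<partial>lborel)"
      by (rule integral_norm_bound_ennreal) (intro Bochner_Integration.integrable_diff int)
    also have "\<dots> \<le> (\<integral>\<^sup>+y. ennreal E * indicator A y + ennreal (E powr (1 - p)) * ennreal (\<bar>u y\<bar> powr p) \<partial>lborel)"
    proof (rule nn_integral_mono)
      fix y :: 'a
      have "\<bar>indicator (ball x r) y * u y - indicator (ball x' r) y * u y\<bar> \<le> indicator A y * \<bar>u y\<bar>"
        using x' dist_triangle[of x y x'] dist_triangle[of x' y x]
        by (auto simp: A_def indicator_def dist_commute)
      also have "\<dots> \<le> indicator A y * (E + E powr (1 - p) * \<bar>u y\<bar> powr p)"
        using le_add_powr[of "\<bar>u y\<bar>" E p] E p by (intro mult_left_mono) auto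
      also have "\<dots> \<le> E * indicator A y + E powr (1 - p) * \<bar>u y\<bar> powr p"
        by (auto simp: indicator_def)
      finally have "ennreal (norm (indicator (ball x r) y * u y - indicator (ball x' r) y * u y)) \<le> ennreal (E * indicator A y + E powr (1 - p) * \<bar>u y\<bar> powr p)"
        by (intro ennreal_leI) simp
      also have "\<dots> = ennreal E * indicator A y + ennreal (E powr (1 - p)) * ennreal (\<bar>u y\<bar> powr p)"
        using E by (auto simp: indicator_def ennreal_mult)
      finally show "ennreal (norm (indicator (ball x r) y * u y - indicator (ball x' r) y * u y)) \<le> ennreal E * indicator A y + ennreal (E powr (1 - p)) * ennreal (\<bar>u y\<bar> powr p)" .
    qed
    also have "\<dots> = ennreal E * emeasure lborel A + ennreal (E powr (1 - p)) * (\<integral>\<^sup>+y. ennreal (\<bar>u y\<bar> powr p) \<partial>lborel)"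
    proof -
      have "(\<integral>\<^sup>+y. ennreal E * indicator A y \<partial>lborel) = ennreal E * emeasure lborel A"
        by (rule nn_integral_cmult_indicator) simp
      moreover have "(\<integral>\<^sup>+y. ennreal (E powr (1 - p)) * ennreal (\<bar>u y\<bar> powr p) \<partial>lborel) = ennreal (E powr (1 - p)) * (\<integral>\<^sup>+y. ennreal (\<bar>u y\<bar> powr p) \<partial>lborel)"
        by (rule nn_integral_cmult) measurable
      moreover have "(\<integral>\<^sup>+y. ennreal E * indicator A y + ennreal (E powr (1 - p)) * ennreal (\<bar>u y\<bar> powr p) \<partial>lborel)
        = (\<integral>\<^sup>+y. ennreal E * indicator A y \<partial>lborel) + (\<integral>\<^sup>+y. ennreal (E powr (1 - p)) * ennreal (\<bar>u y\<bar> powr p) \<partial>lborel)"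
        by (rule nn_integral_add) measurable
      ultimately show ?thesis by (simp only:)
    qed
    also have "\<dots> \<le> ennreal E * emeasure lborel A + ennreal (E powr (1 - p)) * ennreal B"
      by (intro add_left_mono mult_left_mono uB) simp
    also have "\<dots> = ennreal (E * (?v * (r + h) ^ DIM('a) - ?v * (r - h) ^ DIM('a)) + E powr (1 - p) * B)"
      unfolding eA using E A0 B by (simp add: ennreal_mult)
    also have "\<dots> \<le> ennreal (c * e)" using h(1) EB by (intro ennreal_leI) linarith
    finally have "c * \<bar>ball_avg r u x - ball_avg r u x'\<bar> \<le> c * e" using c e by simp
    then show "\<bar>ball_avg r u x - ball_avg r u x'\<bar> \<le> e" using c by simp
  qed
qed

text \<open>Lebesgue measure has growth exponent n > n - p; this instance drives
  compactness.\<close>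

lemma small_oscillation_lborel:
  assumes n: "2 \<le> DIM('a::euclidean_space)" and p: "1 < p"
  shows "small_oscillation p (lborel :: 'a measure)"
proof (rule small_oscillation_powr[OF n p _ lborel.sigma_finite_measure_axioms, of "unit_ball_vol (real DIM('a))" "real DIM('a)"])
  fix y :: 'a and r :: real assume "0 < r"
  then show "emeasure lborel (ball y r) \<le> ennreal (unit_ball_vol (real DIM('a)) * r powr real DIM('a))"
    by (simp add: emeasure_ball powr_realpow)
qed (use p in auto)

text \<open>Ball averages of a bounded sequence are equicontinuous, hence converge pointwise along a subsequence, and
  they approximate the functions in $L^p$ uniformly along the sequence.\<close>
lemma Rellich_C1c:
  fixes u :: "nat \<Rightarrow> 'a::euclidean_space \<Rightarrow> real"
  assumes n: "2 \<le> DIM('a)" and p: "1 < p" and w: "open w" "bounded w"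
    and u: "\<And>k. C1c w (u k) (G k)"
    and uB: "\<And>k. (LINT x|lebesgue_on w. \<bar>u k x\<bar> powr p) \<le> B" and GB: "\<And>k. (LINT x|lebesgue_on w. norm (G k x) powr p) \<le> B"
  obtains rho where "strict_mono (rho::nat\<Rightarrow>nat)"
    "\<And>e. e > 0 \<Longrightarrow> \<exists>N. \<forall>i\<ge>N. \<forall>j\<ge>N. (LINT x|lebesgue_on w. \<bar>u (rho i) x - u (rho j) x\<bar> powr p) < e"
proof -
  let ?M = "lebesgue_on w"
  have "0 \<le> (LINT x|?M. \<bar>u 0 x\<bar> powr p)" by (rule integral_nonneg_AE) auto
  then have B: "0 \<le> B" using uB[of 0] by linarith
  have cu: "continuous_on UNIV (u k)" for k by (rule C1c_continuous[OF u])
  have um[measurable]: "u k \<in> borel_measurable borel" for k using cu by (rule borel_measurable_continuous_onI)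
  have uB': "(\<integral>\<^sup>+y. ennreal (\<bar>u k y\<bar> powr p) \<partial>lborel) \<le> ennreal B" for k
    using C1c_integrals(2)[OF u w(1), of p k] uB[of k] p by (simp add: ennreal_leI)
  have GB': "(\<integral>\<^sup>+y. ennreal (norm (G k y) powr p) \<partial>lborel) \<le> ennreal B" for k
    using C1c_integrals(4)[OF u w(1), of p k] GB[of k] p by (simp add: ennreal_leI)
  \<comment> \<open>With the radius of stage m, the p-th power integral of the oscillation is at
    most 1 / (m + 1) times that of the gradient.\<close>
  define P where "P m r \<longleftrightarrow> 0 < r \<and> (\<forall>u G. (\<forall>x. (u has_derivative (\<lambda>h. G x \<bullet> h)) (at x)) \<longrightarrow> continuous_on UNIV G \<longrightarrow>
     (\<integral>\<^sup>+x. ennreal (\<bar>u x - ball_avg r u x\<bar> powr p) \<partial>lborel) \<le> ennreal (1 / real (Suc m)) * (\<integral>\<^sup>+y. ennreal (norm (G (y::'a)) powr p) \<partial>lborel))" for m :: nat and r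
  have "\<exists>r. P m r" for m
    using small_oscillation_lborel[OF n p] unfolding small_oscillation_def P_def
    by (drule_tac x="1 / real (Suc m)" in spec) simp
  then have "\<exists>r. \<forall>m. P m (r m)" by (intro choice allI)
  then obtain r where Pr: "\<And>m. P m (r m)" by blast
  have r: "0 < r m" for m using Pr[of m] by (simp add: P_def)
  have osc: "(\<integral>\<^sup>+x. ennreal (\<bar>u x - ball_avg (r m) u x\<bar> powr p) \<partial>lborel) \<le> ennreal (1 / real (Suc m)) * (\<integral>\<^sup>+y. ennreal (norm (G (y::'a)) powr p) \<partial>lborel)"
    if "\<forall>x. (u has_derivative (\<lambda>h. G x \<bullet> h)) (at x)" "continuous_on UNIV G" for m u G
    using Pr[of m] that unfolding P_def by blast
  define c where "c m = unit_ball_vol (real DIM('a)) * r m ^ DIM('a)" for m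
  have c: "0 < c m" for m using r by (simp add: c_def)
  have avgB: "\<bar>ball_avg (r m) (u k) x\<bar> powr p \<le> B / c m" for m k x
  proof -
    have "ennreal (\<bar>ball_avg (r m) (u k) x\<bar> powr p) \<le> ennreal (1 / c m) * (\<integral>\<^sup>+y. ennreal (\<bar>u k y\<bar> powr p) \<partial>lborel)"
      unfolding c_def by (rule ball_avg_powr_le[OF cu r p])
    also have "\<dots> \<le> ennreal (1 / c m) * ennreal B" by (intro mult_left_mono uB') simp
    also have "\<dots> = ennreal (B / c m)" using c[of m] B by (simp add: ennreal_mult[symmetric])
    finally show ?thesis using B c[of m] by simp
  qed
  obtain D :: "'a set" where D: "countable D" "\<And>X. open X \<Longrightarrow> X \<noteq> {} \<Longrightarrow> \<exists>d\<in>D. d \<in> X"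
    using countable_dense_exists by metis
  \<comment> \<open>The factor c^(1/p) makes the bound B^(1/p) independent of m, as required by the
    diagonal argument over the countable set of pairs of a stage and a point of D.\<close>
  define f where "f k mx = ball_avg (r (fst mx)) (u k) (snd mx) * c (fst mx) powr (1 / p)" for k and mx :: "nat \<times> 'a"
  have fB: "norm (f k mx) \<le> B powr (1 / p)" for k mx
  proof -
    obtain m x where mx: "mx = (m, x)" by fastforce
    have "\<bar>f k mx\<bar> = (\<bar>ball_avg (r m) (u k) x\<bar> powr p * c m) powr (1 / p)"
      using p c[of m] by (simp add: f_def mx abs_mult powr_mult powr_powr)
    also have "\<dots> \<le> B powr (1 / p)"
      using avgB[of m k x] c[of m] p by (intro powr_mono2) (auto simp: field_simps)
    finally show ?thesis by simp
  qed
  obtain rho where rho: "strict_mono (rho::nat\<Rightarrow>nat)" "\<And>mx. mx \<in> UNIV \<times> D \<Longrightarrow> \<exists>l. (\<lambda>k. f (rho k) mx) \<longlonglongrightarrow> l"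
    using function_convergent_subsequence[of "UNIV \<times> D" f "B powr (1 / p)"] D(1) fB by (metis countable_SIGMA countableI_type)
  define avg where "avg m k x = ball_avg (r m) (u (rho k)) x" for m k x
  have [measurable]: "avg m k \<in> borel_measurable borel" for m k unfolding avg_def by measurable
  have convD: "convergent (\<lambda>k. avg m k x)" if xD: "x \<in> D" for m x
  proof -
    obtain l where "(\<lambda>k. f (rho k) (m, x)) \<longlonglongrightarrow> l" using rho(2)[of "(m, x)"] xD by auto
    then have "(\<lambda>k. f (rho k) (m, x) * (1 / c m powr (1 / p))) \<longlonglongrightarrow> l * (1 / c m powr (1 / p))"
      by (intro tendsto_intros)
    moreover have "f (rho k) (m, x) * (1 / c m powr (1 / p)) = avg m k x" for k
      using c[of m] by (simp add: f_def avg_def)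
    ultimately show ?thesis by (auto simp: convergent_def)
  qed
  \<comment> \<open>From the dense set to every point by equicontinuity, whose modulus at x is
    common to all k.\<close>
  have conv: "convergent (\<lambda>k. avg m k x)" for m x
    unfolding Cauchy_convergent_iff[symmetric]
  proof (rule metric_CauchyI)
    fix e :: real assume e: "0 < e"
    obtain h where h: "0 < h" "\<And>u x'. continuous_on UNIV u \<Longrightarrow> (\<integral>\<^sup>+y. ennreal (\<bar>u y\<bar> powr p) \<partial>lborel) \<le> ennreal B \<Longrightarrow>
      dist x x' < h \<Longrightarrow> \<bar>ball_avg (r m) u x - ball_avg (r m) u x'\<bar> \<le> e / 4"
      using ball_avg_equicontinuous[OF r[of m] p B, of "e/4" x] e by auto
    obtain x' where x': "x' \<in> D" "dist x x' < h" using D(2)[of "ball x h"] h(1) by auto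
    have near: "\<bar>avg m k x - avg m k x'\<bar> \<le> e / 4" for k
      unfolding avg_def by (rule h(2)[OF cu uB' x'(2)])
    have "Cauchy (\<lambda>k. avg m k x')" using convD[OF x'(1)] by (rule convergent_Cauchy)
    then obtain N where N: "\<And>i j. i \<ge> N \<Longrightarrow> j \<ge> N \<Longrightarrow> dist (avg m i x') (avg m j x') < e / 4"
      using e metric_CauchyD[of "\<lambda>k. avg m k x'" "e/4"] by auto
    have "dist (avg m i x) (avg m j x) < e" if "i \<ge> N" "j \<ge> N" for i j
      using near[of i] near[of j] N[OF that] e unfolding dist_real_def by linarith
    then show "\<exists>N. \<forall>i\<ge>N. \<forall>j\<ge>N. dist (avg m i x) (avg m j x) < e" by blast
  qed
  define a where "a m x = lim (\<lambda>k. avg m k x)" for m x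
  have lim: "(\<lambda>k. avg m k x) \<longlonglongrightarrow> a m x" for m x
    unfolding a_def using conv by (simp add: convergent_LIMSEQ_iff)
  have [measurable]: "a m \<in> borel_measurable borel" for m
    by (rule borel_measurable_LIMSEQ_real[OF lim]) measurable
  have wl: "w \<in> lmeasurable" using w by (simp add: bounded_set_imp_lmeasurable)
  interpret finite_measure ?M using wl by (rule finite_measure_lebesgue_on)
  have ml: "g \<in> borel_measurable ?M" if "g \<in> borel_measurable borel" for g :: "'a \<Rightarrow> real"
    using that by (rule borel_measurable_lebesgue_on)
  have aB: "\<bar>a m x\<bar> powr p \<le> B / c m" for m x
  proof -
    have "(\<lambda>k. \<bar>avg m k x\<bar> powr p) \<longlonglongrightarrow> \<bar>a m x\<bar> powr p"
      using p by (intro tendsto_powr2 tendsto_intros lim) auto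
    then show ?thesis by (rule LIMSEQ_le_const2) (auto simp: avg_def avgB)
  qed
  have dB: "\<bar>avg m k x - a m x\<bar> powr p \<le> 2 powr p * (B / c m + B / c m)" for m k x
  proof -
    have "\<bar>avg m k x - a m x\<bar> powr p \<le> 2 powr p * (\<bar>avg m k x\<bar> powr p + \<bar>a m x\<bar> powr p)"
      using norm_diff_powr_le[of p "avg m k x" "a m x"] p by simp
    also have "\<dots> \<le> 2 powr p * (B / c m + B / c m)"
      using aB[of m x] avgB[of m "rho k" x] by (intro mult_left_mono add_mono) (auto simp: avg_def)
    finally show ?thesis .
  qed
  have iavg: "integrable ?M (\<lambda>x. \<bar>avg m k x - a m x\<bar> powr p)" for m k
    by (rule integrable_const_bound[where B="2 powr p * (B / c m + B / c m)"]) (use dB in \<open>auto intro!: ml\<close>)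
  have lavg: "(\<lambda>k. LINT x|?M. \<bar>avg m k x - a m x\<bar> powr p) \<longlonglongrightarrow> 0" for m
  proof -
    have "(\<lambda>k. LINT x|?M. \<bar>avg m k x - a m x\<bar> powr p) \<longlonglongrightarrow> (LINT x|?M. 0)"
    proof (rule integral_dominated_convergence[where w="\<lambda>_. 2 powr p * (B / c m + B / c m)"])
      show "AE x in ?M. (\<lambda>k. \<bar>avg m k x - a m x\<bar> powr p) \<longlonglongrightarrow> 0"
      proof (rule AE_I2)
        fix x
        have "(\<lambda>k. \<bar>avg m k x - a m x\<bar> powr p) \<longlonglongrightarrow> \<bar>a m x - a m x\<bar> powr p"
          using p by (intro tendsto_powr2 tendsto_intros lim) auto
        then show "(\<lambda>k. \<bar>avg m k x - a m x\<bar> powr p) \<longlonglongrightarrow> 0" by simp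
      qed
    qed (use dB in \<open>auto intro!: ml\<close>)
    then show ?thesis by simp
  qed
  have iosc: "integrable ?M (\<lambda>x. \<bar>u (rho k) x - avg m k x\<bar> powr p)"
    and Bosc: "(LINT x|?M. \<bar>u (rho k) x - avg m k x\<bar> powr p) \<le> B / real (Suc m)" for m k
  proof -
    have "(\<integral>\<^sup>+x. ennreal (\<bar>u (rho k) x - avg m k x\<bar> powr p) \<partial>?M) \<le> (\<integral>\<^sup>+x. ennreal (\<bar>u (rho k) x - avg m k x\<bar> powr p) \<partial>lborel)"
    proof -
      have "(\<integral>\<^sup>+x. ennreal (\<bar>u (rho k) x - avg m k x\<bar> powr p) \<partial>?M) = (\<integral>\<^sup>+x. ennreal (\<bar>u (rho k) x - avg m k x\<bar> powr p) * indicator w x \<partial>lebesgue)"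
        using w by (intro nn_integral_restrict_space) auto
      also have "\<dots> \<le> (\<integral>\<^sup>+x. ennreal (\<bar>u (rho k) x - avg m k x\<bar> powr p) \<partial>lebesgue)"
        by (intro nn_integral_mono) (auto simp: indicator_def)
      also have "\<dots> = (\<integral>\<^sup>+x. ennreal (\<bar>u (rho k) x - avg m k x\<bar> powr p) \<partial>lborel)" by (rule nn_integral_completion)
      finally show ?thesis .
    qed
    also have "\<dots> \<le> ennreal (1 / real (Suc m)) * (\<integral>\<^sup>+y. ennreal (norm (G (rho k) y) powr p) \<partial>lborel)"
      unfolding avg_def using u[of "rho k"] by (intro osc) (auto simp: C1c_def)
    also have "\<dots> \<le> ennreal (1 / real (Suc m)) * ennreal B" by (intro mult_left_mono GB') simp
    also have "\<dots> = ennreal (B / real (Suc m))" using B by (simp add: ennreal_mult[symmetric])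
    finally have le: "(\<integral>\<^sup>+x. ennreal (\<bar>u (rho k) x - avg m k x\<bar> powr p) \<partial>?M) \<le> ennreal (B / real (Suc m))" .
    show i: "integrable ?M (\<lambda>x. \<bar>u (rho k) x - avg m k x\<bar> powr p)"
    proof (rule integrableI_nonneg)
      show "(\<lambda>x. \<bar>u (rho k) x - avg m k x\<bar> powr p) \<in> borel_measurable ?M" by (rule ml) measurable
    qed (use le in \<open>auto simp: less_top[symmetric] top_unique\<close>)
    show "(LINT x|?M. \<bar>u (rho k) x - avg m k x\<bar> powr p) \<le> B / real (Suc m)"
      using le nn_integral_eq_integral[OF i] B by simp
  qed
  show thesis
  proof (rule that[OF rho(1)])
    fix e :: real assume e: "0 < e"
    \<comment> \<open>The factor 2^p occurs twice: the limit average first separates the two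
      indices, then lies between each function and its own average.\<close>
    define K where "K = 4 powr p"
    have K: "0 < K" by (simp add: K_def)
    obtain m :: nat where m: "K * (B + 1) * 4 / e < real m" using reals_Archimedean2 by blast
    have m': "K * (B / real (Suc m)) < e / 4"
    proof -
      have "K * (B + 1) * 4 < e * real (Suc m)" using m e K B by (simp add: field_simps)
      moreover have "K * B \<le> K * (B + 1)" using K by simp
      ultimately show ?thesis by (simp add: field_simps)
    qed
    have "eventually (\<lambda>k. (LINT x|?M. \<bar>avg m k x - a m x\<bar> powr p) < e / (4 * K)) sequentially"
      using lavg[of m] e K by (intro order_tendstoD) auto
    then obtain N where N: "\<And>k. k \<ge> N \<Longrightarrow> (LINT x|?M. \<bar>avg m k x - a m x\<bar> powr p) < e / (4 * K)"
      by (auto simp: eventually_sequentially)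
    have "(LINT x|?M. \<bar>u (rho i) x - u (rho j) x\<bar> powr p) < e" if ij: "i \<ge> N" "j \<ge> N" for i j
    proof -
      let ?F = "\<lambda>k x. \<bar>u (rho k) x - avg m k x\<bar> powr p + \<bar>avg m k x - a m x\<bar> powr p"
      have iF: "integrable ?M (?F k)" for k using iosc iavg by auto
      have F4: "K * (LINT x|?M. ?F k x) < e / 2" if "k \<ge> N" for k
      proof -
        have "(LINT x|?M. ?F k x) = (LINT x|?M. \<bar>u (rho k) x - avg m k x\<bar> powr p) + (LINT x|?M. \<bar>avg m k x - a m x\<bar> powr p)"
          using iosc iavg by simp
        then have "K * (LINT x|?M. ?F k x) = K * (LINT x|?M. \<bar>u (rho k) x - avg m k x\<bar> powr p) + K * (LINT x|?M. \<bar>avg m k x - a m x\<bar> powr p)"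
          by (simp add: distrib_left)
        moreover have "K * (LINT x|?M. \<bar>u (rho k) x - avg m k x\<bar> powr p) \<le> K * (B / real (Suc m))"
          using Bosc K by (intro mult_left_mono) auto
        moreover have "K * (LINT x|?M. \<bar>avg m k x - a m x\<bar> powr p) < K * (e / (4 * K))"
          using N[OF that] K by (intro mult_strict_left_mono) auto
        moreover have "K * (e / (4 * K)) = e / 4" using K by simp
        ultimately show ?thesis using m' by linarith
      qed
      have pw: "\<bar>u (rho i) x - u (rho j) x\<bar> powr p \<le> K * (?F i x + ?F j x)" for x
      proof -
        have 1: "\<bar>u (rho k) x - a m x\<bar> powr p \<le> 2 powr p * ?F k x" for k
          using norm_add_powr_le[of p "u (rho k) x - avg m k x" "avg m k x - a m x"] p by simp
        have "\<bar>u (rho i) x - u (rho j) x\<bar> powr p \<le> 2 powr p * (\<bar>u (rho i) x - a m x\<bar> powr p + \<bar>u (rho j) x - a m x\<bar> powr p)"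
          using norm_diff_powr_le[of p "u (rho i) x - a m x" "u (rho j) x - a m x"] p by simp
        also have "\<dots> \<le> 2 powr p * (2 powr p * ?F i x + 2 powr p * ?F j x)"
          using 1 by (intro mult_left_mono add_mono) auto
        also have "\<dots> = K * (?F i x + ?F j x)"
        proof -
          have "K = 2 powr p * 2 powr p" unfolding K_def by (simp flip: powr_mult)
          then show ?thesis by (simp only: distrib_left mult.assoc)
        qed
        finally show ?thesis .
      qed
      have "(LINT x|?M. \<bar>u (rho i) x - u (rho j) x\<bar> powr p) \<le> (LINT x|?M. K * (?F i x + ?F j x))"
      proof (rule integral_mono'[OF _ pw])
        show "integrable ?M (\<lambda>x. K * (?F i x + ?F j x))" using iosc iavg by auto
      qed (use K in auto)
      also have "\<dots> = K * (LINT x|?M. ?F i x + ?F j x)" by (rule integral_mult_right_zero)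
      also have "(LINT x|?M. ?F i x + ?F j x) = (LINT x|?M. ?F i x) + (LINT x|?M. ?F j x)"
        by (rule Bochner_Integration.integral_add[OF iF iF])
      also have "K * ((LINT x|?M. ?F i x) + (LINT x|?M. ?F j x)) = K * (LINT x|?M. ?F i x) + K * (LINT x|?M. ?F j x)"
        by (rule distrib_left)
      also have "\<dots> < e" using F4[OF ij(1)] F4[OF ij(2)] by linarith
      finally show ?thesis .
    qed
    then show "\<exists>N. \<forall>i\<ge>N. \<forall>j\<ge>N. (LINT x|?M. \<bar>u (rho i) x - u (rho j) x\<bar> powr p) < e" by blast
  qed
qed

section \<open>Strong convergence of gradients\<close>

text \<open>The upper counterpart of \<open>coercive\<close>: it makes the monotonicity gap of two
  L^p fields integrable.\<close>

lemma (in finsler_norm) abs_flux_diff_le: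
  "\<bar>(A xi - A eta) \<bullet> (xi - eta)\<bar> \<le> 4 * nu powr p * (norm xi powr p + norm eta powr p)"
proof -
  define m where "m = max (norm xi) (norm eta)"
  have m: "0 \<le> m" "norm xi \<le> m" "norm eta \<le> m" by (auto simp: m_def le_max_iff_disj)
  have pm: "norm z powr (p - 1) \<le> m powr (p - 1)" if "norm z \<le> m" for z :: 'a
    using that p by (intro powr_mono2) auto
  have "norm (A xi - A eta) \<le> norm (A xi) + norm (A eta)" by (rule norm_triangle_ineq4)
  also have "\<dots> \<le> nu powr p * norm xi powr (p - 1) + nu powr p * norm eta powr (p - 1)"
    by (intro add_mono norm_flux_le)
  also have "\<dots> \<le> nu powr p * m powr (p - 1) + nu powr p * m powr (p - 1)"
    using pm[OF m(2)] pm[OF m(3)] by (intro add_mono mult_left_mono) auto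
  finally have 1: "norm (A xi - A eta) \<le> 2 * nu powr p * m powr (p - 1)" by simp
  have 2: "norm (xi - eta) \<le> 2 * m" using norm_triangle_ineq4[of xi eta] m by linarith
  have "\<bar>(A xi - A eta) \<bullet> (xi - eta)\<bar> \<le> norm (A xi - A eta) * norm (xi - eta)" by (rule Cauchy_Schwarz_ineq2)
  also have "\<dots> \<le> (2 * nu powr p * m powr (p - 1)) * (2 * m)" using 1 2 m by (intro mult_mono) auto
  also have "\<dots> = 4 * nu powr p * (m powr (p - 1) * m)" by simp
  also have "m powr (p - 1) * m = m powr p" using m powr_add[of m "p - 1" 1] by (cases "m = 0") auto
  also have "4 * nu powr p * m powr p \<le> 4 * nu powr p * (norm xi powr p + norm eta powr p)"
    by (intro mult_left_mono) (auto simp: m_def max_def)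
  finally show ?thesis .
qed

text \<open>The function min f b is dominated by the fixed b, and the excess of f over it is at most
  a_k, which vanishes in L^1.\<close>

lemma dominated_convergence_L1_perturbed:
  fixes f a :: "nat \<Rightarrow> 'a \<Rightarrow> real"
  assumes [measurable]: "\<And>k. f k \<in> borel_measurable M" and b: "integrable M b"
    and a: "\<And>k. integrable M (a k)" "\<And>k x. 0 \<le> a k x" "(\<lambda>k. integral\<^sup>L M (a k)) \<longlonglongrightarrow> 0"
    and nn: "\<And>k x. 0 \<le> f k x" "\<And>x. 0 \<le> b x" and le: "\<And>k. AE x in M. f k x \<le> a k x + b x"
    and lim: "AE x in M. (\<lambda>k. f k x) \<longlonglongrightarrow> 0"
  shows "(\<lambda>k. integral\<^sup>L M (f k)) \<longlonglongrightarrow> 0"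
proof -
  have [measurable]: "b \<in> borel_measurable M" "a k \<in> borel_measurable M" for k using a(1) b by auto
  have i: "integrable M (f k)" for k
    by (rule Bochner_Integration.integrable_bound[OF Bochner_Integration.integrable_add[OF a(1)[of k] b]])
      (use le[of k] nn in \<open>auto elim!: eventually_mono\<close>)
  have im: "integrable M (\<lambda>x. min (f k x) (b x))" for k
    by (rule Bochner_Integration.integrable_bound[OF b]) (use nn in auto)
  have l0: "(\<lambda>k. LINT x|M. min (f k x) (b x)) \<longlonglongrightarrow> (LINT x|M. 0)"
  proof (rule integral_dominated_convergence[where w=b])
    show "AE x in M. (\<lambda>k. min (f k x) (b x)) \<longlonglongrightarrow> 0"
      using lim
    proof eventually_elim
      case (elim x)
      have "(\<lambda>k. min (f k x) (b x)) \<longlonglongrightarrow> min 0 (b x)" by (intro tendsto_intros elim)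
      then show ?case using nn by simp
    qed
    show "AE x in M. norm (min (f k x) (b x)) \<le> b x" for k using nn by auto
  qed (use b in auto)
  have "(\<lambda>k. (LINT x|M. min (f k x) (b x)) + integral\<^sup>L M (a k)) \<longlonglongrightarrow> (LINT x|M. 0) + 0"
    by (rule tendsto_add[OF l0 a(3)])
  then have u0: "(\<lambda>k. (LINT x|M. min (f k x) (b x)) + integral\<^sup>L M (a k)) \<longlonglongrightarrow> 0" by simp
  show ?thesis
  proof (rule tendsto_sandwich[OF _ _ tendsto_const u0])
    show "eventually (\<lambda>k. 0 \<le> integral\<^sup>L M (f k)) sequentially"
      using nn by (auto intro!: always_eventually integral_nonneg_AE)
    show "eventually (\<lambda>k. integral\<^sup>L M (f k) \<le> (LINT x|M. min (f k x) (b x)) + integral\<^sup>L M (a k)) sequentially"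
    proof (rule always_eventually, rule allI)
      fix k
      have "integral\<^sup>L M (f k) \<le> (LINT x|M. min (f k x) (b x) + a k x)"
        using le[of k] by (intro integral_mono_AE i Bochner_Integration.integrable_add im a(1), eventually_elim)
          (use a(2) in \<open>auto simp: min_def add_increasing2\<close>)
      also have "\<dots> = (LINT x|M. min (f k x) (b x)) + integral\<^sup>L M (a k)"
        using im a(1) by simp
      finally show "integral\<^sup>L M (f k) \<le> (LINT x|M. min (f k x) (b x)) + integral\<^sup>L M (a k)" .
    qed
  qed
qed

text \<open>A field of norms over an abstract finite measure. Measurability of the composed flux is
  an assumption here; on subdomains it is supplied by
  \<open>flux_measurable_lebesgue_on\<close>.\<close>

locale finsler_field = finite_measure M for M :: "'a measure" +
  fixes H :: "'a \<Rightarrow> 'b::euclidean_space \<Rightarrow> real" and p kappa nu :: real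
  assumes p: "1 < p" and norms: "AE x in M. finsler_norm (H x) p kappa nu"
    and flux_measurable: "\<And>h. h \<in> borel_measurable M \<Longrightarrow> (\<lambda>x. flux (H x) p (h x)) \<in> borel_measurable M"
begin

abbreviation A where "A x \<equiv> flux (H x) p"

text \<open>The absolute value changes nothing almost everywhere, where A is monotone, but makes the
  gap nonnegative at every point, also where H (x, .) fails to be a norm.\<close>

definition gap :: "('a \<Rightarrow> 'b) \<Rightarrow> ('a \<Rightarrow> 'b) \<Rightarrow> 'a \<Rightarrow> real" where
  "gap g h x = \<bar>(A x (g x) - A x (h x)) \<bullet> (g x - h x)\<bar>"

lemma gap_measurable:
  assumes [measurable]: "g \<in> borel_measurable M" "h \<in> borel_measurable M"
  shows "gap g h \<in> borel_measurable M"
  unfolding gap_def[abs_def] using flux_measurable[OF assms(1)] flux_measurable[OF assms(2)] by measurable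

lemma gap_integrable:
  assumes m: "g \<in> borel_measurable M" "h \<in> borel_measurable M"
    and "integrable M (\<lambda>x. norm (g x) powr p)" "integrable M (\<lambda>x. norm (h x) powr p)"
  shows "integrable M (gap g h)"
proof (rule Bochner_Integration.integrable_bound[OF _ gap_measurable[OF m]])
  show "integrable M (\<lambda>x. 4 * nu powr p * (norm (g x) powr p + norm (h x) powr p))" using assms by auto
  show "AE x in M. norm (gap g h x) \<le> norm (4 * nu powr p * (norm (g x) powr p + norm (h x) powr p))"
    using norms
  proof eventually_elim
    case (elim x)
    from finsler_norm.abs_flux_diff_le[OF this, of "g x" "h x"] show ?case by (simp add: gap_def)
  qed
qed

text \<open>As the modulus of monotonicity depends on the point, the claim is reached by
  contradiction: pairs of fields that stay apart while their gap vanishes have, along a subsequence,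
  gap tending to 0 almost everywhere, and there \<open>monotone_uniform\<close> applies point by
  point. Values beyond R are controlled by the p-norm.\<close>

lemma L1_Cauchy_of_gap:
  fixes g :: "nat \<Rightarrow> 'a \<Rightarrow> 'b"
  assumes g[measurable]: "\<And>k. g k \<in> borel_measurable M" and gi: "\<And>k. integrable M (\<lambda>x. norm (g k x) powr p)"
    and gB: "\<And>k. (LINT x|M. norm (g k x) powr p) \<le> B"
    and gap: "\<And>e. e > 0 \<Longrightarrow> \<exists>N. \<forall>i\<ge>N. \<forall>j\<ge>N. integral\<^sup>L M (gap (g i) (g j)) < e"
    and e: "0 < e"
  shows "\<exists>N. \<forall>i\<ge>N. \<forall>j\<ge>N. (LINT x|M. norm (g i x - g j x)) < e"
proof (rule ccontr)
  assume "\<not> ?thesis"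
  then have "\<forall>N. \<exists>ij. fst ij \<ge> N \<and> snd ij \<ge> N \<and> e \<le> (LINT x|M. norm (g (fst ij) x - g (snd ij) x))"
    by (metis linorder_not_le fst_conv snd_conv)
  then obtain ij where ij: "\<And>N. fst (ij N) \<ge> N" "\<And>N. snd (ij N) \<ge> N" "\<And>N. e \<le> (LINT x|M. norm (g (fst (ij N)) x - g (snd (ij N)) x))"
    by metis
  define a where "a N = g (fst (ij N))" for N
  define b where "b N = g (snd (ij N))" for N
  have [measurable]: "a N \<in> borel_measurable M" "b N \<in> borel_measurable M" for N by (auto simp: a_def b_def)
  have gapi: "integrable M (gap (a N) (b N))" for N
    unfolding a_def b_def by (intro gap_integrable g gi)
  have "(\<lambda>N. LINT x|M. norm (gap (a N) (b N) x)) \<longlonglongrightarrow> 0"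
  proof (rule LIMSEQ_I)
    fix d :: real assume "0 < d"
    then obtain N where N: "\<forall>i\<ge>N. \<forall>j\<ge>N. integral\<^sup>L M (gap (g i) (g j)) < d" using gap by blast
    have "norm ((LINT x|M. norm (gap (a k) (b k) x)) - 0) < d" if "k \<ge> N" for k
    proof -
      have "integral\<^sup>L M (gap (a k) (b k)) < d"
        unfolding a_def b_def using N ij(1,2)[of k] that by (meson order_trans)
      moreover have "norm (gap (a k) (b k) x) = gap (a k) (b k) x" for x by (simp add: gap_def)
      moreover have "0 \<le> integral\<^sup>L M (gap (a k) (b k))" by (rule integral_nonneg_AE) (simp add: gap_def)
      ultimately show ?thesis by simp
    qed
    then show "\<exists>no. \<forall>k\<ge>no. norm ((LINT x|M. norm (gap (a k) (b k) x)) - 0) < d" by blast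
  qed
  then obtain s where s: "strict_mono (s::nat\<Rightarrow>nat)" "AE x in M. (\<lambda>k. gap (a (s k)) (b (s k)) x) \<longlonglongrightarrow> 0"
    using tendsto_L1_AE_subseq[of M "\<lambda>N. gap (a N) (b N)"] gapi by auto
  have "0 \<le> (LINT x|M. norm (g 0 x) powr p)" by (rule integral_nonneg_AE) auto
  then have B: "0 \<le> B" using gB[of 0] by linarith
  \<comment> \<open>Chosen so that the part beyond R, of size 4 B R^(1-p), is at most e / 2.\<close>
  define R where "R = (8 * (B + 1) / e) powr (1 / (p - 1))"
  have R: "0 < R" using B e by (simp add: R_def)
  have "R powr (1 - p) = (8 * (B + 1) / e) powr (- 1)"
    using p unfolding R_def powr_powr by (intro arg_cong[where f="\<lambda>a. _ powr a"]) (simp add: field_simps)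
  also have "\<dots> = e / (8 * (B + 1))" using B e by (simp add: powr_minus)
  finally have Rp: "R powr (1 - p) = e / (8 * (B + 1))" .
  have RB: "4 * B * R powr (1 - p) \<le> e / 2" using B e by (simp add: Rp field_simps)
  \<comment> \<open>The difference, cut off where one of the two values exceeds R; its bound 2 R
    permits dominated convergence.\<close>
  define T where "T k x = (if norm (a (s k) x) \<le> R \<and> norm (b (s k) x) \<le> R then norm (a (s k) x - b (s k) x) else 0)" for k x
  have [measurable]: "T k \<in> borel_measurable M" for k unfolding T_def by measurable
  have TR: "norm (T k x) \<le> 2 * R" for k x
    using norm_triangle_ineq4[of "a (s k) x" "b (s k) x"] R by (auto simp: T_def)
  have Ti: "integrable M (T k)" for k
    by (rule integrable_const_bound[where B="2 * R"]) (use TR in auto)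
  have "(\<lambda>k. integral\<^sup>L M (T k)) \<longlonglongrightarrow> (LINT x|M. 0)"
  proof (rule integral_dominated_convergence[where w="\<lambda>_. 2 * R"])
    show "AE x in M. (\<lambda>k. T k x) \<longlonglongrightarrow> 0"
      using s(2) norms
    proof eventually_elim
      case (elim x)
      interpret N: finsler_norm "H x" p kappa nu by (rule elim(2))
      show ?case
      proof (rule LIMSEQ_I)
        fix d :: real assume d: "0 < d"
        obtain m where m: "0 < m" "\<And>xi eta. norm xi \<le> R \<Longrightarrow> norm eta \<le> R \<Longrightarrow> d \<le> norm (xi - eta) \<Longrightarrow> m \<le> (N.A xi - N.A eta) \<bullet> (xi - eta)"
          using N.monotone_uniform[OF d, of R] by blast
        obtain N0 where N0: "\<And>k. k \<ge> N0 \<Longrightarrow> gap (a (s k)) (b (s k)) x < m"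
          using LIMSEQ_D[OF elim(1) m(1)] by (auto simp: gap_def)
        have "norm (T k x - 0) < d" if "k \<ge> N0" for k
        proof (rule ccontr)
          assume *: "\<not> norm (T k x - 0) < d"
          then have "norm (a (s k) x) \<le> R" "norm (b (s k) x) \<le> R" "d \<le> norm (a (s k) x - b (s k) x)"
            using d by (auto simp: T_def split: if_splits)
          from m(2)[OF this] N0[OF that] show False by (simp add: gap_def)
        qed
        then show "\<exists>no. \<forall>k\<ge>no. norm (T k x - 0) < d" by blast
      qed
    qed
  qed (use TR in auto)
  then have "eventually (\<lambda>k. integral\<^sup>L M (T k) < e / 2) sequentially"
    using e by (intro order_tendstoD(2)) auto
  then obtain k where k: "integral\<^sup>L M (T k) < e / 2" by (meson eventually_sequentially le_refl)
  have pw: "norm (a (s k) x - b (s k) x) \<le> T k x + 2 * R powr (1 - p) * (norm (a (s k) x) powr p + norm (b (s k) x) powr p)" for x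
  proof (cases "norm (a (s k) x) \<le> R \<and> norm (b (s k) x) \<le> R")
    case True then show ?thesis by (simp add: T_def)
  next
    case False
    define m where "m = max (norm (a (s k) x)) (norm (b (s k) x))"
    have m: "R < m" using False by (auto simp: m_def less_max_iff_disj)
    have "norm (a (s k) x - b (s k) x) \<le> 2 * m" using norm_triangle_ineq4[of "a (s k) x" "b (s k) x"] by (auto simp: m_def)
    also have "m = m powr (1 - p) * m powr p" using m R by (simp flip: powr_add)
    also have "\<dots> \<le> R powr (1 - p) * m powr p" using m R p by (intro mult_right_mono powr_mono2') auto
    also have "m powr p \<le> norm (a (s k) x) powr p + norm (b (s k) x) powr p" by (auto simp: m_def max_def)
    finally have "norm (a (s k) x - b (s k) x) \<le> 2 * (R powr (1 - p) * (norm (a (s k) x) powr p + norm (b (s k) x) powr p))"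
      by (simp add: mult_left_mono)
    moreover have "0 \<le> T k x" by (simp add: T_def)
    ultimately show ?thesis by simp
  qed
  have T0: "0 \<le> T k x" for x by (simp add: T_def)
  have ia: "integrable M (\<lambda>x. norm (a (s k) x) powr p)" "integrable M (\<lambda>x. norm (b (s k) x) powr p)" by (auto simp: a_def b_def gi)
  have "(LINT x|M. norm (a (s k) x - b (s k) x)) \<le> (LINT x|M. T k x + 2 * R powr (1 - p) * (norm (a (s k) x) powr p + norm (b (s k) x) powr p))"
    by (rule integral_mono'[OF _ pw]) (use Ti ia T0 in \<open>auto intro!: add_nonneg_nonneg\<close>)
  also have "\<dots> = integral\<^sup>L M (T k) + 2 * R powr (1 - p) * ((LINT x|M. norm (a (s k) x) powr p) + (LINT x|M. norm (b (s k) x) powr p))"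
    using Ti ia by simp
  also have "\<dots> \<le> integral\<^sup>L M (T k) + 2 * R powr (1 - p) * (B + B)"
    using gB by (intro add_left_mono mult_left_mono add_mono) (auto simp: a_def b_def)
  also have "\<dots> < e" using k RB by (simp add: algebra_simps)
  finally show False using ij(3)[of "s k"] by (simp add: a_def b_def)
qed

text \<open>The $(S_+)$ property. Strict monotonicity only controls the gradients on bounded sets of values, hence the
  passage through convergence in $L^1$; coercivity of the gap upgrades it to $L^p$.\<close>
lemma strong_convergence_of_gap:
  fixes g :: "nat \<Rightarrow> 'a \<Rightarrow> 'b"
  assumes g[measurable]: "\<And>k. g k \<in> borel_measurable M" and gi: "\<And>k. integrable M (\<lambda>x. norm (g k x) powr p)"
    and gB: "\<And>k. (LINT x|M. norm (g k x) powr p) \<le> B"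
    and gap: "\<And>e. e > 0 \<Longrightarrow> \<exists>N. \<forall>i\<ge>N. \<forall>j\<ge>N. integral\<^sup>L M (gap (g i) (g j)) < e"
  obtains r l where "strict_mono (r::nat\<Rightarrow>nat)" "l \<in> borel_measurable M" "integrable M (\<lambda>x. norm (l x) powr p)"
    "AE x in M. (\<lambda>k. g (r k) x) \<longlonglongrightarrow> l x" "(\<lambda>k. LINT x|M. norm (g (r k) x - l x) powr p) \<longlonglongrightarrow> 0"
proof -
  have i1: "integrable M (g k)" for k
  proof (rule Bochner_Integration.integrable_bound)
    show "integrable M (\<lambda>x. 1 + norm (g k x) powr p)" using gi by auto
    show "AE x in M. norm (g k x) \<le> norm (1 + norm (g k x) powr p)"
      using powr_le_one_add[of "norm (g k _)" p] p by (auto intro!: AE_I2)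
  qed measurable
  obtain r l where r: "strict_mono (r::nat\<Rightarrow>nat)" and l[measurable]: "l \<in> borel_measurable M"
    and lim: "AE x in M. (\<lambda>k. g (r k) x) \<longlonglongrightarrow> l x"
    using L1_Cauchy_AE_limit[OF i1 L1_Cauchy_of_gap[OF g gi gB gap]] by metis
  have limp: "AE x in M. (\<lambda>k. norm (g (r k) x) powr p) \<longlonglongrightarrow> norm (l x) powr p"
    using lim by eventually_elim (intro tendsto_powr2 tendsto_intros, use p in auto)
  have li: "integrable M (\<lambda>x. norm (l x) powr p)"
    by (rule integrable_Fatou(1)[OF _ _ _ limp, where B=B]) (use gi gB in auto)
  have gl: "integrable M (gap (g k) l)" for k by (intro gap_integrable g l gi li)
  \<comment> \<open>Fatou in the second index: the Cauchy property of the gap becomes convergence of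
    the gap to the limit field.\<close>
  have tg: "(\<lambda>k. integral\<^sup>L M (gap (g (r k)) l)) \<longlonglongrightarrow> 0"
  proof (rule LIMSEQ_I)
    fix e :: real assume e: "0 < e"
    then obtain N where N: "\<forall>i\<ge>N. \<forall>j\<ge>N. integral\<^sup>L M (gap (g i) (g j)) < e / 2" using gap[of "e / 2"] by auto
    have "norm (integral\<^sup>L M (gap (g (r k)) l) - 0) < e" if k: "k \<ge> N" for k
    proof -
      have rk: "r k \<ge> N" using k seq_suble[OF r, of k] by linarith
      have "integral\<^sup>L M (gap (g (r k)) l) \<le> e / 2"
      proof (rule integrable_Fatou(2)[of M "\<lambda>j. gap (g (r k)) (g (r j))"])
        show "integrable M (gap (g (r k)) (g (r j)))" for j by (intro gap_integrable g gi)
        show "0 \<le> gap (g (r k)) (g (r j)) x" for j x by (simp add: gap_def)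
        show "gap (g (r k)) l \<in> borel_measurable M" by (intro gap_measurable g l)
        show "AE x in M. (\<lambda>j. gap (g (r k)) (g (r j)) x) \<longlonglongrightarrow> gap (g (r k)) l x"
          using lim norms
        proof eventually_elim
          case (elim x)
          interpret N: finsler_norm "H x" p kappa nu by (rule elim(2))
          have "(\<lambda>j. N.A (g (r j) x)) \<longlonglongrightarrow> N.A (l x)"
            by (rule filterlim_compose[OF N.tendsto_flux elim(1)])
          then show ?case unfolding gap_def by (intro tendsto_intros elim(1))
        qed
        show "eventually (\<lambda>j. integral\<^sup>L M (gap (g (r k)) (g (r j))) \<le> e / 2) sequentially"
          using eventually_ge_at_top[of N]
        proof eventually_elim
          case (elim j)
          then have "r j \<ge> N" using seq_suble[OF r, of j] by linarith
          then show ?case using N rk by (meson less_imp_le)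
        qed
      qed
      moreover have "0 \<le> integral\<^sup>L M (gap (g (r k)) l)" by (rule integral_nonneg_AE) (simp add: gap_def)
      ultimately show ?thesis using e by simp
    qed
    then show "\<exists>no. \<forall>k\<ge>no. norm (integral\<^sup>L M (gap (g (r k)) l) - 0) < e" by blast
  qed
  define c where "c = kappa powr p / 2"
  define C where "C = ((1/4) powr (1 - p) + 4 powr (1 / (p - 1))) * nu powr p"
  have C: "0 \<le> C" by (simp add: C_def)
  show thesis
  \<comment> \<open>If the whole space is null, the almost everywhere assumption says nothing about
    \<open>kappa\<close>, but all integrals vanish.\<close>
  proof (cases "AE x in M. False")
    case True
    have "(LINT x|M. norm (g (r k) x - l x) powr p) = 0" for k
      using True by (intro integral_eq_zero_AE) (auto elim!: eventually_mono)
    then show ?thesis using that[OF r l li lim] by simp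
  next
    case False
    have "0 < kappa"
    proof (rule ccontr)
      assume "\<not> 0 < kappa"
      then have "AE x in M. False" using norms by (auto elim!: eventually_mono simp: finsler_norm_def)
      then show False using False by simp
    qed
    then have c: "0 < c" by (simp add: c_def)
    \<comment> \<open>By coercivity the p-th power of the difference is at most a multiple of the
      gap, which vanishes in L^1, plus a fixed integrable function of l.\<close>
    have "(\<lambda>k. LINT x|M. norm (g (r k) x - l x) powr p) \<longlonglongrightarrow> 0"
    proof (rule dominated_convergence_L1_perturbed[where a="\<lambda>k x. 2 powr p / c * gap (g (r k)) l x" and b="\<lambda>x. 2 powr p * (C / c + 1) * norm (l x) powr p"])
      let ?a = "\<lambda>k x. 2 powr p / c * gap (g (r k)) l x"
      let ?b = "\<lambda>x. 2 powr p * (C / c + 1) * norm (l x) powr p"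
      show "integrable M (?a k)" for k using gl by simp
      show "integrable M ?b" using li by simp
      show "0 \<le> ?a k x" for k x using c by (simp add: gap_def)
      show "0 \<le> ?b x" for x using c C by simp
      have "(\<lambda>k. 2 powr p / c * integral\<^sup>L M (gap (g (r k)) l)) \<longlonglongrightarrow> 2 powr p / c * 0"
        by (intro tendsto_intros tg)
      then show "(\<lambda>k. integral\<^sup>L M (?a k)) \<longlonglongrightarrow> 0" by simp
      show "AE x in M. norm (g (r k) x - l x) powr p \<le> ?a k x + ?b x" for k
        using norms
      proof eventually_elim
        case (elim x)
        interpret N: finsler_norm "H x" p kappa nu by (rule elim)
        have "c * norm (g (r k) x) powr p \<le> gap (g (r k)) l x + C * norm (l x) powr p"
          using N.coercive[of "g (r k) x" "l x"] unfolding gap_def c_def C_def by linarith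
        then have "norm (g (r k) x) powr p \<le> gap (g (r k)) l x / c + C / c * norm (l x) powr p"
          using c by (simp add: field_simps)
        then have "2 powr p * (norm (g (r k) x) powr p + norm (l x) powr p)
           \<le> 2 powr p * ((gap (g (r k)) l x / c + C / c * norm (l x) powr p) + norm (l x) powr p)"
          by (intro mult_left_mono add_right_mono) auto
        moreover have "\<dots> = ?a k x + ?b x" by (simp add: algebra_simps)
        ultimately show ?case using norm_diff_powr_le[of p "g (r k) x" "l x"] p by linarith
      qed
      show "AE x in M. (\<lambda>k. norm (g (r k) x - l x) powr p) \<longlonglongrightarrow> 0"
        using lim
      proof eventually_elim
        case (elim x)
        have "(\<lambda>k. norm (g (r k) x - l x) powr p) \<longlonglongrightarrow> norm (l x - l x) powr p"
          by (intro tendsto_powr2 tendsto_intros elim) (use p in auto)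
        then show ?case by simp
      qed
    qed auto
    then show ?thesis using that[OF r l li lim] by simp
  qed
qed

end

section \<open>Measurability of the composed flux\<close>

lemma borel_measurable_lebesgue_on_AE_eq:
  fixes f g :: "'a::euclidean_space \<Rightarrow> 'b::topological_space"
  assumes S: "S \<in> sets lebesgue" and f: "f \<in> borel_measurable (lebesgue_on S)"
    and eq: "AE x in lebesgue_on S. f x = g x"
  shows "g \<in> borel_measurable (lebesgue_on S)"
proof (rule measurableI)
  obtain N where N: "N \<in> null_sets (lebesgue_on S)" "{x \<in> space (lebesgue_on S). f x \<noteq> g x} \<subseteq> N"
    using eq by (auto elim!: AE_E simp: null_sets_def)
  fix B :: "'b set" assume B: "B \<in> sets borel"
  let ?X = "g -` B \<inter> space (lebesgue_on S)"
  \<comment> \<open>A subset of a Lebesgue null set is measurable by completeness, so the values of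
    g on it do not matter.\<close>
  have "?X \<inter> N \<in> sets (lebesgue_on S)"
  proof -
    have NS: "N \<subseteq> S" "N \<in> null_sets lebesgue" using N(1) null_sets_restrict_space[OF S, of N] by blast+
    have "?X \<inter> N \<in> null_sets lebesgue" by (rule completion.complete2[OF _ NS(2)]) blast
    then show ?thesis using S \<open>N \<subseteq> S\<close> by (auto simp: sets_restrict_space_iff null_sets_def)
  qed
  moreover have "?X - N = (f -` B \<inter> space (lebesgue_on S)) - N" using N(2) by auto
  moreover have "(f -` B \<inter> space (lebesgue_on S)) - N \<in> sets (lebesgue_on S)"
    using measurable_sets[OF f B] N(1) by auto
  ultimately have "(?X \<inter> N) \<union> (?X - N) \<in> sets (lebesgue_on S)" by auto
  then show "?X \<in> sets (lebesgue_on S)" by (simp add: Int_Diff_Un)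
qed auto

lemma borel_measurable_lebesgue_on_AE_LIMSEQ:
  fixes f :: "nat \<Rightarrow> 'a::euclidean_space \<Rightarrow> real"
  assumes S: "S \<in> sets lebesgue" and [measurable]: "\<And>i. f i \<in> borel_measurable (lebesgue_on S)"
    and lim: "AE x in lebesgue_on S. (\<lambda>i. f i x) \<longlonglongrightarrow> g x"
  shows "g \<in> borel_measurable (lebesgue_on S)"
proof (rule borel_measurable_lebesgue_on_AE_eq[OF S])
  show "(\<lambda>x. lim (\<lambda>i. f i x)) \<in> borel_measurable (lebesgue_on S)" by (rule borel_measurable_lim_metric) measurable
  show "AE x in lebesgue_on S. lim (\<lambda>i. f i x) = g x" using lim by eventually_elim (rule limI)
qed

text \<open>For simple h the composition is a finite sum of sections of H cut off to level sets;
  continuity in the second variable passes to the limit.\<close>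

lemma borel_measurable_Caratheodory:
  fixes H :: "'a::euclidean_space \<Rightarrow> 'b::euclidean_space \<Rightarrow> real"
  assumes S: "S \<in> sets lebesgue" and H[measurable]: "\<And>xi. (\<lambda>x. H x xi) \<in> borel_measurable (lebesgue_on S)"
    and cont: "AE x in lebesgue_on S. continuous_on UNIV (H x)" and h: "h \<in> borel_measurable (lebesgue_on S)"
  shows "(\<lambda>x. H x (h x)) \<in> borel_measurable (lebesgue_on S)"
proof -
  obtain F where F: "\<And>i. simple_function (lebesgue_on S) (F i)" "\<And>x. x \<in> space (lebesgue_on S) \<Longrightarrow> (\<lambda>i. F i x) \<longlonglongrightarrow> h x"
    using borel_measurable_implies_sequence_metric[OF h, of 0] by blast
  have m: "(\<lambda>x. H x (F i x)) \<in> borel_measurable (lebesgue_on S)" for i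
  proof -
    let ?R = "F i ` space (lebesgue_on S)"
    have fin: "finite ?R" using F(1) by (rule simple_functionD)
    have [measurable]: "F i -` {y} \<inter> space (lebesgue_on S) \<in> sets (lebesgue_on S)" for y
      using F(1) by (rule simple_functionD)
    have "H x (F i x) = (\<Sum>y\<in>?R. indicator (F i -` {y} \<inter> space (lebesgue_on S)) x * H x y)" if x: "x \<in> space (lebesgue_on S)" for x
    proof -
      have "(\<Sum>y\<in>?R. indicator (F i -` {y} \<inter> space (lebesgue_on S)) x * H x y) = (\<Sum>y\<in>?R. if y = F i x then H x (F i x) else 0)"
        using x by (intro sum.cong) (auto simp: indicator_def)
      also have "\<dots> = H x (F i x)" using fin x by (subst sum.delta) auto
      finally show ?thesis by simp
    qed
    then show ?thesis by (subst measurable_cong) (assumption, measurable)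
  qed
  show ?thesis
  proof (rule borel_measurable_lebesgue_on_AE_LIMSEQ[OF S m])
    show "AE x in lebesgue_on S. (\<lambda>i. H x (F i x)) \<longlonglongrightarrow> H x (h x)"
      using cont AE_space
    proof eventually_elim
      case (elim x)
      then have "isCont (H x) (h x)" by (simp add: continuous_on_eq_continuous_at)
      then show ?case using F(2)[OF elim(2)] by (rule isCont_tendsto_compose)
    qed
  qed
qed

text \<open>Each component is almost everywhere a limit of difference quotients of measurable
  compositions. Where H (x, .) is not a norm the description operator may return anything, which
  completeness absorbs.\<close>

lemma flux_measurable_lebesgue_on:
  fixes H :: "'a::euclidean_space \<Rightarrow> 'b::euclidean_space \<Rightarrow> real"
  assumes S: "S \<in> sets lebesgue" and H: "\<And>xi. (\<lambda>x. H x xi) \<in> borel_measurable (lebesgue_on S)"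
    and norms: "AE x in lebesgue_on S. finsler_norm (H x) p kappa nu" and h[measurable]: "h \<in> borel_measurable (lebesgue_on S)"
  shows "(\<lambda>x. flux (H x) p (h x)) \<in> borel_measurable (lebesgue_on S)"
proof -
  have cont: "AE x in lebesgue_on S. continuous_on UNIV (H x)"
    using norms by eventually_elim (rule finsler_norm.continuous_N)
  have [measurable]: "(\<lambda>x. H x (k x)) \<in> borel_measurable (lebesgue_on S)" if "k \<in> borel_measurable (lebesgue_on S)" for k
    by (rule borel_measurable_Caratheodory[OF S H cont that])
  define t where "t j = inverse (real (Suc j))" for j
  have t: "t j \<noteq> 0" for j by (simp add: t_def)
  have t0: "t \<longlonglongrightarrow> 0" unfolding t_def by (rule LIMSEQ_inverse_real_of_nat)
  have "(\<lambda>x. flux (H x) p (h x) \<bullet> b) \<in> borel_measurable (lebesgue_on S)" for b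
  proof (rule borel_measurable_lebesgue_on_AE_LIMSEQ[OF S])
    show "(\<lambda>x. (H x (h x + t j *\<^sub>R b) powr p / p - H x (h x) powr p / p) / t j) \<in> borel_measurable (lebesgue_on S)" for j
      by measurable
    show "AE x in lebesgue_on S. (\<lambda>j. (H x (h x + t j *\<^sub>R b) powr p / p - H x (h x) powr p / p) / t j) \<longlonglongrightarrow> flux (H x) p (h x) \<bullet> b"
      using norms by eventually_elim (rule finsler_norm.difference_quotients[OF _ t t0])
  qed
  then show ?thesis by (subst borel_measurable_euclidean_space) auto
qed

section \<open>Products with a weight, estimated by Young's inequality\<close>

lemma weighted_product_integrable:
  fixes f h W :: "'a \<Rightarrow> real"
  assumes [measurable]: "W \<in> borel_measurable M" "f \<in> borel_measurable M" "h \<in> borel_measurable M"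
    and W: "\<And>x. 0 \<le> W x" and nn: "\<And>x. 0 \<le> f x" "\<And>x. 0 \<le> h x" and p: "1 < p"
    and fi: "integrable M (\<lambda>x. W x * f x powr p)" and hi: "integrable M (\<lambda>x. W x * h x powr p)"
  shows "integrable M (\<lambda>x. W x * (f x powr (p - 1) * h x))"
    and "\<And>e. 0 < e \<Longrightarrow> (LINT x|M. W x * (f x powr (p - 1) * h x)) \<le> e * (LINT x|M. W x * f x powr p) + e powr (1 - p) * (LINT x|M. W x * h x powr p)"
proof -
  have Y: "W x * (f x powr (p - 1) * h x) \<le> e * (W x * f x powr p) + e powr (1 - p) * (W x * h x powr p)" if "0 < e" for e x
    using mult_left_mono[OF Young_powr[OF nn(1)[of x] nn(2)[of x] that p] W[of x]] by (simp add: algebra_simps)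
  have b: "integrable M (\<lambda>x. e * (W x * f x powr p) + e powr (1 - p) * (W x * h x powr p))" for e using fi hi by simp
  show i: "integrable M (\<lambda>x. W x * (f x powr (p - 1) * h x))"
    by (rule Bochner_Integration.integrable_bound[OF b[of 1]]) (use Y[of 1] W nn in \<open>auto simp: abs_mult\<close>)
  fix e :: real assume e: "0 < e"
  have "(LINT x|M. W x * (f x powr (p - 1) * h x)) \<le> (LINT x|M. e * (W x * f x powr p) + e powr (1 - p) * (W x * h x powr p))"
    by (rule integral_mono[OF i b Y[OF e]])
  also have "\<dots> = e * (LINT x|M. W x * f x powr p) + e powr (1 - p) * (LINT x|M. W x * h x powr p)" using fi hi by simp
  finally show "(LINT x|M. W x * (f x powr (p - 1) * h x)) \<le> e * (LINT x|M. W x * f x powr p) + e powr (1 - p) * (LINT x|M. W x * h x powr p)" .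
qed

text \<open>The bounded factor receives a small coefficient d from Young's inequality, the vanishing
  one the then fixed d^(1-p). A general filter covers both sequences and pairs of indices.\<close>

lemma weighted_product_tendsto_0:
  fixes f h :: "'i \<Rightarrow> 'a \<Rightarrow> real" and W :: "'a \<Rightarrow> real"
  assumes m: "W \<in> borel_measurable M" "\<And>i. f i \<in> borel_measurable M" "\<And>i. h i \<in> borel_measurable M"
    and W: "\<And>x. 0 \<le> W x" and nn: "\<And>i x. 0 \<le> f i x" "\<And>i x. 0 \<le> h i x" and p: "1 < p"
    and fi: "\<And>i. integrable M (\<lambda>x. W x * f i x powr p)" and hi: "\<And>i. integrable M (\<lambda>x. W x * h i x powr p)"
    and B: "\<And>i. (LINT x|M. W x * f i x powr p) \<le> B" and lim: "((\<lambda>i. LINT x|M. W x * h i x powr p) \<longlongrightarrow> 0) F"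
  shows "((\<lambda>i. LINT x|M. W x * (f i x powr (p - 1) * h i x)) \<longlongrightarrow> 0) F"
proof (rule tendstoI)
  fix e :: real assume e: "0 < e"
  define d where "d = e / (2 * (\<bar>B\<bar> + 1))"
  have d: "0 < d" using e by (simp add: d_def)
  have dB: "d * B \<le> e / 2"
  proof -
    have "d * B \<le> d * (\<bar>B\<bar> + 1)" using d by (intro mult_left_mono) auto
    also have "\<dots> = e / 2" by (simp add: d_def field_simps)
    finally show ?thesis .
  qed
  have "((\<lambda>i. d powr (1 - p) * (LINT x|M. W x * h i x powr p)) \<longlongrightarrow> d powr (1 - p) * 0) F" by (intro tendsto_intros lim)
  then have "eventually (\<lambda>i. d powr (1 - p) * (LINT x|M. W x * h i x powr p) < e / 2) F"
    using e by (intro order_tendstoD(2)) auto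
  then show "eventually (\<lambda>i. dist (LINT x|M. W x * (f i x powr (p - 1) * h i x)) 0 < e) F"
  proof eventually_elim
    case (elim i)
    have "(LINT x|M. W x * (f i x powr (p - 1) * h i x)) \<le> d * (LINT x|M. W x * f i x powr p) + d powr (1 - p) * (LINT x|M. W x * h i x powr p)"
      by (rule weighted_product_integrable(2)[OF m(1) m(2) m(3) W nn p fi hi d])
    also have "d * (LINT x|M. W x * f i x powr p) \<le> d * B" using B d by (intro mult_left_mono) auto
    finally have "(LINT x|M. W x * (f i x powr (p - 1) * h i x)) < e" using elim dB by linarith
    moreover have "0 \<le> (LINT x|M. W x * (f i x powr (p - 1) * h i x))"
      using W nn by (intro integral_nonneg_AE) auto
    ultimately show ?case by simp
  qed
qed

text \<open>The constant 1 serves as the bounded factor of the product, which is where finiteness of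
  the measure enters.\<close>

lemma (in finite_measure) Lp_tendsto_L1:
  fixes f :: "'i \<Rightarrow> 'a \<Rightarrow> real"
  assumes m[measurable]: "\<And>i. f i \<in> borel_measurable M" and nn: "\<And>i x. 0 \<le> f i x" and p: "1 < p"
    and fi: "\<And>i. integrable M (\<lambda>x. f i x powr p)" and lim: "((\<lambda>i. LINT x|M. f i x powr p) \<longlongrightarrow> 0) F"
  shows "\<And>i. integrable M (f i)" "((\<lambda>i. LINT x|M. f i x) \<longlongrightarrow> 0) F"
proof -
  show "integrable M (f i)" for i
    by (rule Bochner_Integration.integrable_bound[of M "\<lambda>x. 1 + f i x powr p"])
      (use fi powr_le_one_add[OF nn, of p i] p nn in auto)
  have "((\<lambda>i. LINT x|M. 1 * (1 powr (p - 1) * f i x)) \<longlongrightarrow> 0) F"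
    by (rule weighted_product_tendsto_0[where B="LINT x|M. 1 * 1 powr p" and f="\<lambda>_ _. 1"]) (use nn p fi lim in auto)
  then show "((\<lambda>i. LINT x|M. f i x) \<longlongrightarrow> 0) F" by simp
qed

text \<open>A limit is first found through L^1, which finiteness of the measure allows, and then
  recognised as the limit in L^p.\<close>

lemma (in finite_measure) Lp_complete:
  fixes u :: "nat \<Rightarrow> 'a \<Rightarrow> real"
  assumes m[measurable]: "\<And>n. u n \<in> borel_measurable M" and p: "1 < p" and int: "\<And>n. integrable M (\<lambda>x. \<bar>u n x\<bar> powr p)"
    and C: "((\<lambda>z. LINT x|M. \<bar>u (fst z) x - u (snd z) x\<bar> powr p) \<longlongrightarrow> 0) (sequentially \<times>\<^sub>F sequentially)"
  obtains l where "l \<in> borel_measurable M" "integrable M (\<lambda>x. \<bar>l x\<bar> powr p)" "(\<lambda>n. LINT x|M. \<bar>u n x - l x\<bar> powr p) \<longlonglongrightarrow> 0"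
proof -
  have id: "integrable M (\<lambda>x. \<bar>u i x - u j x\<bar> powr p)" for i j
    using integrable_norm_powr_diff[OF m[of i] m[of j], of p] int p by simp
  have cau: "\<exists>N. \<forall>i\<ge>N. \<forall>j\<ge>N. X i j < e" if "((\<lambda>z. X (fst z) (snd z)) \<longlongrightarrow> 0) (sequentially \<times>\<^sub>F sequentially)" "0 < e" for X :: "nat \<Rightarrow> nat \<Rightarrow> real" and e
  proof -
    have "eventually (\<lambda>z. X (fst z) (snd z) < e) (sequentially \<times>\<^sub>F sequentially)" using that by (rule order_tendstoD)
    then show ?thesis unfolding eventually_prod_sequentially by auto
  qed
  have L1: "((\<lambda>z. LINT x|M. \<bar>u (fst z) x - u (snd z) x\<bar>) \<longlongrightarrow> 0) (sequentially \<times>\<^sub>F sequentially)"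
    by (rule Lp_tendsto_L1(2)[OF _ _ p _ C]) (use id in auto)
  have i1: "integrable M (u n)" for n
    by (rule Bochner_Integration.integrable_bound[of M "\<lambda>x. 1 + \<bar>u n x\<bar> powr p"])
      (use int powr_le_one_add[of "\<bar>u n _\<bar>" p] p in auto)
  obtain r l where r: "strict_mono (r::nat\<Rightarrow>nat)" "l \<in> borel_measurable M" "AE x in M. (\<lambda>i. u (r i) x) \<longlonglongrightarrow> l x"
  proof (rule L1_Cauchy_AE_limit[OF i1])
    fix e :: real assume "e > 0"
    from cau[OF L1 this] show "\<exists>N. \<forall>i\<ge>N. \<forall>j\<ge>N. (LINT x|M. norm (u i x - u j x)) < e" by simp
  qed
  show thesis
  proof (rule that[OF r(2)])
    have C': "\<And>e. e > 0 \<Longrightarrow> \<exists>N. \<forall>i\<ge>N. \<forall>j\<ge>N. (LINT x|M. norm (u i x - u j x) powr p) < e"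
      using cau[OF C] by simp
    have int': "integrable M (\<lambda>x. norm (u n x) powr p)" for n using int by simp
    have p0: "0 < p" using p by simp
    show "integrable M (\<lambda>x. \<bar>l x\<bar> powr p)" "(\<lambda>n. LINT x|M. \<bar>u n x - l x\<bar> powr p) \<longlonglongrightarrow> 0"
      using Lp_Cauchy_limit[OF m r(2) int' p0 C' r(1,3)] by simp_all
  qed
qed

text \<open>At a = 0 both sides vanish because \<open>0 powr s = 0\<close> for every s; this gives
  |v|^(p-2) v the value 0 at zeros of v also when p < 2.\<close>

lemma abs_signed_powr: "\<bar>\<bar>a\<bar> powr (p - 2) * a\<bar> = \<bar>a :: real\<bar> powr (p - 1)"
  using powr_add[of "\<bar>a\<bar>" "p - 2" 1] by (cases "a = 0") (auto simp: abs_mult)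

text \<open>For p < 2 the factor |x|^(p-2) is singular at 0, so convergence to 0 is read off from
  the absolute value, whose exponent p - 1 is positive.\<close>

lemma tendsto_signed_powr:
  fixes x :: real
  assumes "1 < p" "(f \<longlongrightarrow> x) F"
  shows "((\<lambda>k. \<bar>f k\<bar> powr (p - 2) * f k) \<longlongrightarrow> \<bar>x\<bar> powr (p - 2) * x) F"
proof (cases "x = 0")
  case False
  then show ?thesis using assms by (intro tendsto_intros) auto
next
  case True
  have "((\<lambda>k. \<bar>f k\<bar> powr (p - 1)) \<longlongrightarrow> \<bar>x\<bar> powr (p - 1)) F"
    using assms by (intro tendsto_powr2 tendsto_intros) auto
  then have "((\<lambda>k. \<bar>\<bar>f k\<bar> powr (p - 2) * f k\<bar>) \<longlongrightarrow> 0) F" using True by (simp only: abs_signed_powr) simp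
  then show ?thesis using True by (simp add: tendsto_rabs_zero_iff)
qed

section \<open>Sobolev functions and the eigenvalue equation\<close>

lemma pd_eqI:
  assumes "((\<lambda>t. f (x + t *\<^sub>R b)) has_real_derivative D) (at 0)"
  shows "pd b f x = D"
  unfolding pd_def using assms by (rule the_equality) (rule DERIV_unique[OF _ assms])

text \<open>Prepares the normalisation of eigenfunctions; differences of test functions are formed
  in the C^1 class instead.\<close>

lemma smooth_fun_scale:
  assumes f: "smooth_fun f"
  shows "smooth_fun (\<lambda>x. c * f x)" "\<And>b x. b \<in> Basis \<Longrightarrow> pd b (\<lambda>x. c * f x) x = c * pd b f x"
proof -
  have s: "continuous_on UNIV (dpartial bs f)" "\<And>x b. b \<in> Basis \<Longrightarrow> ((\<lambda>t. dpartial bs f (x + t *\<^sub>R b)) has_real_derivative pd b (dpartial bs f) x) (at 0)"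
    if "set bs \<subseteq> Basis" for bs
    using f that by (auto simp: smooth_fun_def)
  have d: "((\<lambda>t. c * dpartial bs f (x + t *\<^sub>R b)) has_real_derivative c * pd b (dpartial bs f) x) (at 0)"
    if "set bs \<subseteq> Basis" "b \<in> Basis" for bs b x
    by (rule DERIV_cmult[OF s(2)[OF that]])
  have dp: "dpartial bs (\<lambda>x. c * f x) = (\<lambda>x. c * dpartial bs f x)" if "set bs \<subseteq> Basis" for bs
    using that
  proof (induction bs)
    case (Cons b bs)
    then show ?case using d[of bs b] by (auto intro!: ext pd_eqI)
  qed simp
  show "smooth_fun (\<lambda>x. c * f x)"
    unfolding smooth_fun_def
  proof (intro allI impI conjI ballI)
    fix bs :: "'a list" assume bs: "set bs \<subseteq> Basis"
    show "continuous_on UNIV (dpartial bs (\<lambda>x. c * f x))" unfolding dp[OF bs] by (intro continuous_intros s bs)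
    fix x b :: 'a assume b: "b \<in> Basis"
    show "((\<lambda>t. dpartial bs (\<lambda>x. c * f x) (x + t *\<^sub>R b)) has_real_derivative pd b (dpartial bs (\<lambda>x. c * f x)) x) (at 0)"
      unfolding dp[OF bs] using d[OF bs b, of x] pd_eqI[of "\<lambda>x. c * dpartial bs f x" x b, OF d[OF bs b, of x]] by simp
  qed
  show "pd b (\<lambda>x. c * f x) x = c * pd b f x" if "b \<in> Basis" for b x
    using d[of "[]" b x] that by (intro pd_eqI) simp
qed

lemma test_fun_scale:
  assumes "test_fun w f" "c \<noteq> 0"
  shows "test_fun w (\<lambda>x. c * f x)" "grad (\<lambda>x. c * f x) = (\<lambda>x. c *\<^sub>R grad f x)"
proof -
  have "smooth_fun f" using assms by (simp add: test_fun_def)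
  note s = smooth_fun_scale[where c=c, OF this]
  show "test_fun w (\<lambda>x. c * f x)" using assms s by (simp add: test_fun_def)
  show "grad (\<lambda>x. c * f x) = (\<lambda>x. c *\<^sub>R grad f x)"
    using s by (auto simp: grad_def scaleR_sum_right intro!: ext sum.cong)
qed

lemma W1p0_scale:
  assumes W: "W1p0 p w v g" and c: "0 < c"
  shows "W1p0 p w (\<lambda>x. c * v x) (\<lambda>x. c *\<^sub>R g x)"
proof -
  have m[measurable]: "v \<in> borel_measurable (lebesgue_on w)" "g \<in> borel_measurable (lebesgue_on w)"
    and i: "integrable (lebesgue_on w) (\<lambda>x. \<bar>v x\<bar> powr p)" "integrable (lebesgue_on w) (\<lambda>x. norm (g x) powr p)" and wg: "weak_grad w v g"
    using W by (auto simp: W1p0_def W1p_def Lp_fun_def Lp_vec_def)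
  obtain ph where ph: "\<And>k. test_fun w (ph k)"
    and l: "(\<lambda>k. LINT x|lebesgue_on w. \<bar>ph k x - v x\<bar> powr p) \<longlonglongrightarrow> 0" "(\<lambda>k. LINT x|lebesgue_on w. norm (grad (ph k) x - g x) powr p) \<longlonglongrightarrow> 0"
    using W by (auto simp: W1p0_def)
  have c0: "c \<noteq> 0" using c by simp
  have e1: "\<bar>c * a\<bar> powr p = c powr p * \<bar>a\<bar> powr p" for a using c by (simp add: abs_mult powr_mult)
  have e2: "norm (c *\<^sub>R a) powr p = c powr p * norm a powr p" for a :: 'a using c by (simp add: powr_mult)
  have wg': "weak_grad w (\<lambda>x. c * v x) (\<lambda>x. c *\<^sub>R g x)"
    using wg by (auto simp: weak_grad_def mult.assoc)
  have "integrable (lebesgue_on w) (\<lambda>x. \<bar>c * v x\<bar> powr p)" "integrable (lebesgue_on w) (\<lambda>x. norm (c *\<^sub>R g x) powr p)"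
    unfolding e1 e2 using i by simp_all
  then have "W1p p w (\<lambda>x. c * v x) (\<lambda>x. c *\<^sub>R g x)"
    unfolding W1p_def Lp_fun_def Lp_vec_def by (intro conjI wg') auto
  moreover have "(\<lambda>k. LINT x|lebesgue_on w. \<bar>c * ph k x - c * v x\<bar> powr p) \<longlonglongrightarrow> 0"
  proof -
    have "(LINT x|lebesgue_on w. \<bar>c * ph k x - c * v x\<bar> powr p) = c powr p * (LINT x|lebesgue_on w. \<bar>ph k x - v x\<bar> powr p)" for k
      by (simp only: right_diff_distrib[symmetric] e1 integral_mult_right_zero)
    then show ?thesis using tendsto_mult_left[OF l(1), of "c powr p"] by simp
  qed
  moreover have "(\<lambda>k. LINT x|lebesgue_on w. norm (grad (\<lambda>x. c * ph k x) x - c *\<^sub>R g x) powr p) \<longlonglongrightarrow> 0"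
  proof -
    have "(LINT x|lebesgue_on w. norm (grad (\<lambda>x. c * ph k x) x - c *\<^sub>R g x) powr p) = c powr p * (LINT x|lebesgue_on w. norm (grad (ph k) x - g x) powr p)" for k
      unfolding test_fun_scale(2)[OF ph c0] by (simp only: scaleR_diff_right[symmetric] e2 integral_mult_right_zero)
    then show ?thesis using tendsto_mult_left[OF l(2), of "c powr p"] by simp
  qed
  ultimately show ?thesis
    unfolding W1p0_def by (intro conjI exI[of _ "\<lambda>k x. c * ph k x"] allI test_fun_scale(1)[OF ph c0])
qed

lemma C1c_Lp:
  assumes u: "C1c w u G" and w: "open w" and p: "0 < p"
  shows "Lp_fun p w u" "Lp_vec p w G"
proof -
  have "continuous_on UNIV G" using u by (simp add: C1c_def)
  then show "Lp_fun p w u" "Lp_vec p w G"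
    using C1c_integrals[OF u w p] C1c_continuous[OF u]
    by (auto simp: Lp_fun_def Lp_vec_def intro!: borel_measurable_lebesgue_on borel_measurable_continuous_onI)
qed

lemma C1c_bounded:
  assumes u: "C1c w u G"
  obtains K where "0 \<le> K" "\<And>x. \<bar>u x\<bar> \<le> K" "\<And>x. norm (G x) \<le> K"
proof -
  let ?S = "closure {x. u x \<noteq> 0}"
  have S: "compact ?S" and cG: "continuous_on UNIV G" using u by (auto simp: C1c_def)
  have "bounded (u ` ?S)" "bounded (G ` ?S)"
    by (intro compact_imp_bounded compact_continuous_image S continuous_on_subset[OF C1c_continuous[OF u]] continuous_on_subset[OF cG] subset_UNIV)+
  then obtain K1 K2 where K: "\<And>x. x \<in> ?S \<Longrightarrow> \<bar>u x\<bar> \<le> K1" "\<And>x. x \<in> ?S \<Longrightarrow> norm (G x) \<le> K2"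
    by (auto simp: bounded_iff)
  have "\<bar>u x\<bar> \<le> max 0 (max K1 K2)" for x
    using K(1)[of x] C1c_support(1)[OF u] by (cases "u x = 0") (auto simp: le_max_iff_disj)
  moreover have "norm (G x) \<le> max 0 (max K1 K2)" for x
    using K(2)[of x] C1c_support(2)[OF u] by (cases "G x = 0") (auto simp: le_max_iff_disj)
  ultimately show thesis by (intro that[of "max 0 (max K1 K2)"]) auto
qed

text \<open>The approximants are only $C^1$, which makes the class closed under differences at no cost.\<close>
definition W0 :: "real \<Rightarrow> 'a::euclidean_space set \<Rightarrow> ('a \<Rightarrow> real) \<Rightarrow> ('a \<Rightarrow> 'a) \<Rightarrow> bool" where
  "W0 p w u g \<longleftrightarrow> Lp_fun p w u \<and> Lp_vec p w g \<and> (\<exists>ph G. (\<forall>k::nat. C1c w (ph k) (G k)) \<and>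
     (\<lambda>k. LINT x|lebesgue_on w. \<bar>ph k x - u x\<bar> powr p) \<longlonglongrightarrow> 0 \<and>
     (\<lambda>k. LINT x|lebesgue_on w. norm (G k x - g x) powr p) \<longlonglongrightarrow> 0)"

lemma W1p0_W0:
  assumes "W1p0 p w u g"
  shows "W0 p w u g"
proof -
  obtain ph where "\<And>k. test_fun w (ph k)"
    "(\<lambda>k. LINT x|lebesgue_on w. \<bar>ph k x - u x\<bar> powr p) \<longlonglongrightarrow> 0" "(\<lambda>k. LINT x|lebesgue_on w. norm (grad (ph k) x - g x) powr p) \<longlonglongrightarrow> 0"
    using assms by (auto simp: W1p0_def)
  then show ?thesis using assms test_fun_C1c unfolding W0_def W1p0_def W1p_def
    by (intro conjI exI[of _ ph] exI[of _ "\<lambda>k. grad (ph k)"]) auto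
qed

lemma C1c_W0:
  assumes "C1c w u G" "open w" "0 < p"
  shows "W0 p w u G"
  unfolding W0_def using C1c_Lp[OF assms] assms by (auto intro!: exI[of _ "\<lambda>_. u"] exI[of _ "\<lambda>_. G"])

lemma Lp_tendsto_diff:
  fixes f h :: "nat \<Rightarrow> 'a \<Rightarrow> 'b::euclidean_space"
  assumes [measurable]: "\<And>k. f k \<in> borel_measurable M" "\<And>k. h k \<in> borel_measurable M" and p: "0 \<le> p"
    and i: "\<And>k. integrable M (\<lambda>x. norm (f k x) powr p)" "\<And>k. integrable M (\<lambda>x. norm (h k x) powr p)"
    and l: "(\<lambda>k. LINT x|M. norm (f k x) powr p) \<longlonglongrightarrow> 0" "(\<lambda>k. LINT x|M. norm (h k x) powr p) \<longlonglongrightarrow> 0"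
  shows "(\<lambda>k. LINT x|M. norm (f k x - h k x) powr p) \<longlonglongrightarrow> 0"
proof (rule tendsto_sandwich[OF _ _ tendsto_const])
  show "(\<lambda>k. 2 powr p * ((LINT x|M. norm (f k x) powr p) + (LINT x|M. norm (h k x) powr p))) \<longlonglongrightarrow> 0"
    using tendsto_mult_left[OF tendsto_add[OF l], of "2 powr p"] by simp
  show "eventually (\<lambda>k. 0 \<le> (LINT x|M. norm (f k x - h k x) powr p)) sequentially"
    by (auto intro!: always_eventually integral_nonneg_AE)
  have "(LINT x|M. norm (f k x - h k x) powr p) \<le> (LINT x|M. 2 powr p * (norm (f k x) powr p + norm (h k x) powr p))" for k
    by (rule integral_mono') (use i norm_diff_powr_le[OF p] in auto)
  then show "eventually (\<lambda>k. (LINT x|M. norm (f k x - h k x) powr p) \<le> 2 powr p * ((LINT x|M. norm (f k x) powr p) + (LINT x|M. norm (h k x) powr p))) sequentially"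
    using i by (auto intro!: always_eventually)
qed

lemma W0_diff:
  assumes w: "open w" and p: "0 < p" and u: "W0 p w u g" and v: "W0 p w v h"
  shows "W0 p w (\<lambda>x. u x - v x) (\<lambda>x. g x - h x)"
proof -
  let ?M = "lebesgue_on w"
  have p0: "0 \<le> p" using p by simp
  have m[measurable]: "u \<in> borel_measurable ?M" "v \<in> borel_measurable ?M" "g \<in> borel_measurable ?M" "h \<in> borel_measurable ?M"
    and i: "integrable ?M (\<lambda>x. norm (u x) powr p)" "integrable ?M (\<lambda>x. norm (v x) powr p)" "integrable ?M (\<lambda>x. norm (g x) powr p)" "integrable ?M (\<lambda>x. norm (h x) powr p)"
    using u v by (auto simp: W0_def Lp_fun_def Lp_vec_def)
  obtain ph G where a: "\<And>k::nat. C1c w (ph k) (G k)" "(\<lambda>k. LINT x|?M. norm (ph k x - u x) powr p) \<longlonglongrightarrow> 0" "(\<lambda>k. LINT x|?M. norm (G k x - g x) powr p) \<longlonglongrightarrow> 0"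
    using u by (auto simp: W0_def)
  obtain ps F where b: "\<And>k::nat. C1c w (ps k) (F k)" "(\<lambda>k. LINT x|?M. norm (ps k x - v x) powr p) \<longlonglongrightarrow> 0" "(\<lambda>k. LINT x|?M. norm (F k x - h x) powr p) \<longlonglongrightarrow> 0"
    using v by (auto simp: W0_def)
  have Lp: "ph k \<in> borel_measurable ?M" "integrable ?M (\<lambda>x. norm (ph k x) powr p)" "G k \<in> borel_measurable ?M" "integrable ?M (\<lambda>x. norm (G k x) powr p)"
     "ps k \<in> borel_measurable ?M" "integrable ?M (\<lambda>x. norm (ps k x) powr p)" "F k \<in> borel_measurable ?M" "integrable ?M (\<lambda>x. norm (F k x) powr p)" for k
    using C1c_Lp[OF a(1) w p, of k] C1c_Lp[OF b(1) w p, of k] by (auto simp: Lp_fun_def Lp_vec_def)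
  note [measurable] = Lp(1,3,5,7)
  have j: "integrable ?M (\<lambda>x. norm (ph k x - u x) powr p)" "integrable ?M (\<lambda>x. norm (ps k x - v x) powr p)"
    "integrable ?M (\<lambda>x. norm (G k x - g x) powr p)" "integrable ?M (\<lambda>x. norm (F k x - h x) powr p)" for k
    by (intro integrable_norm_powr_diff m Lp i p0)+
  have "(\<lambda>k. LINT x|?M. norm ((ph k x - u x) - (ps k x - v x)) powr p) \<longlonglongrightarrow> 0"
    by (rule Lp_tendsto_diff[OF _ _ p0 _ _ a(2) b(2)]) (measurable, fact j, fact j)
  moreover have "(\<lambda>k. LINT x|?M. norm ((G k x - g x) - (F k x - h x)) powr p) \<longlonglongrightarrow> 0"
    by (rule Lp_tendsto_diff[OF _ _ p0 _ _ a(3) b(3)]) (measurable, fact j, fact j)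
  moreover have "(ph k x - u x) - (ps k x - v x) = (ph k x - ps k x) - (u x - v x)" "(G k x - g x) - (F k x - h x) = (G k x - F k x) - (g x - h x)" for k x
    by (auto simp: algebra_simps)
  ultimately have "(\<lambda>k. LINT x|?M. \<bar>(ph k x - ps k x) - (u x - v x)\<bar> powr p) \<longlonglongrightarrow> 0" "(\<lambda>k. LINT x|?M. norm ((G k x - F k x) - (g x - h x)) powr p) \<longlonglongrightarrow> 0"
    by simp_all
  moreover have "Lp_fun p w (\<lambda>x. u x - v x)" "Lp_vec p w (\<lambda>x. g x - h x)"
    using integrable_norm_powr_diff[OF m(1,2) i(1,2) p0] integrable_norm_powr_diff[OF m(3,4) i(3,4) p0]
    by (auto simp: Lp_fun_def Lp_vec_def)
  ultimately show ?thesis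
    unfolding W0_def using C1c_diff[OF a(1) b(1)] by (intro conjI exI[of _ "\<lambda>k x. ph k x - ps k x"] exI[of _ "\<lambda>k x. G k x - F k x"]) auto
qed

section \<open>A fixed subdomain: weight and trace inequality\<close>

locale eigen_setting =
  fixes H :: "'a::euclidean_space \<Rightarrow> 'a \<Rightarrow> real" and V :: "'a \<Rightarrow> real" and w :: "'a set" and p q kappa nu :: real
  assumes dim: "2 \<le> DIM('a)" and p: "1 < p" and w: "open w" "bounded w" "w \<noteq> {}" and V: "morrey p q w V"
    and norms: "AE x in lebesgue_on w. finsler_norm (H x) p kappa nu"
    and H_meas: "\<And>xi. (\<lambda>x. H x xi) \<in> borel_measurable (lebesgue_on w)" and kappa: "0 < kappa"
begin

abbreviation "M \<equiv> lebesgue_on w"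

sublocale finsler_field M H p kappa nu
proof (intro finsler_field.intro finsler_field_axioms.intro)
  show "finite_measure M" using w by (intro finite_measure_lebesgue_on bounded_set_imp_lmeasurable) auto
  have S: "w \<in> sets lebesgue" using w by auto
  show "(\<lambda>x. flux (H x) p (h x)) \<in> borel_measurable M" if "h \<in> borel_measurable M" for h
    by (rule flux_measurable_lebesgue_on[OF S H_meas norms that])
qed (fact p norms)+

lemma p0: "0 < p" "0 \<le> p" using p by auto

lemma V_integrable: "integrable M V"
  using V by (auto simp: morrey_def Let_def split: if_splits)

lemma V_measurable [measurable]: "V \<in> borel_measurable M"
  using V_integrable by auto

text \<open>One weight for all eigenvalues: it dominates |V| and, being at least 1, also constants,
  so |V - lambda| is at most (1 + |lambda|) times it.\<close>

definition wt :: "'a \<Rightarrow> real" where "wt x = \<bar>V x\<bar> + 1"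

lemma wt_ge: "1 \<le> wt x" "0 \<le> wt x" "\<bar>V x\<bar> \<le> wt x" by (auto simp: wt_def)

lemma wt_integrable: "integrable M wt"
  unfolding wt_def using V_integrable by auto

lemma wt_measurable [measurable]: "wt \<in> borel_measurable M"
  using wt_integrable by auto

lemma V_diff_le: "\<bar>V x - lam\<bar> \<le> (1 + \<bar>lam\<bar>) * wt x"
proof -
  have "\<bar>V x - lam\<bar> \<le> \<bar>V x\<bar> + \<bar>lam\<bar>" by linarith
  also have "\<dots> \<le> wt x + \<bar>lam\<bar> * wt x" using wt_ge[of x] mult_left_mono[of 1 "wt x" "\<bar>lam\<bar>"] by (intro add_mono) auto
  finally show ?thesis by (simp add: algebra_simps)
qed

lemma W0_D:
  assumes "W0 p w u g"
  shows "u \<in> borel_measurable M" "g \<in> borel_measurable M" "integrable M (\<lambda>x. \<bar>u x\<bar> powr p)" "integrable M (\<lambda>x. norm (g x) powr p)"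
  using assms by (auto simp: W0_def Lp_fun_def Lp_vec_def)

text \<open>Carried over from C^1 functions by Fatou along an almost everywhere convergent
  subsequence of approximants; this also yields finiteness of the weighted integral, which is not
  part of the definition of \<open>W0\<close>. The summand 1 in the final constant comes from the 1
  in the weight.\<close>

lemma trace:
  assumes d: "0 < d"
  shows "\<exists>C\<ge>0. \<forall>u g. W0 p w u g \<longrightarrow> integrable M (\<lambda>x. wt x * \<bar>u x\<bar> powr p) \<and>
    (LINT x|M. wt x * \<bar>u x\<bar> powr p) \<le> d * (LINT x|M. norm (g x) powr p) + C * (LINT x|M. \<bar>u x\<bar> powr p)"
proof -
  \<comment> \<open>Makes room for the factor 2^p incurred when approximants are compared with
    u.\<close>
  define d' where "d' = d / 2 powr p"
  have d': "0 < d'" using d by (simp add: d'_def)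
  obtain C where C: "0 \<le> C" "\<And>u G. C1c w u G \<Longrightarrow> integrable M (\<lambda>x. \<bar>V x\<bar> * \<bar>u x\<bar> powr p) \<and>
     (LINT x|M. \<bar>V x\<bar> * \<bar>u x\<bar> powr p) \<le> d' * (LINT x|M. norm (G x) powr p) + C * (LINT x|M. \<bar>u x\<bar> powr p)"
    using Morrey_trace[OF dim p w V d'] by blast
  show ?thesis
  proof (intro exI[of _ "2 powr p * C + 1"] conjI allI impI)
    show "0 \<le> 2 powr p * C + 1" using C by simp
    fix u g assume u: "W0 p w u g"
    note um[measurable] = W0_D(1,2)[OF u] and ui = W0_D(3,4)[OF u]
    obtain ph G where ph: "\<And>k::nat. C1c w (ph k) (G k)" and lu: "(\<lambda>k. LINT x|M. \<bar>ph k x - u x\<bar> powr p) \<longlonglongrightarrow> 0"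
      and lg: "(\<lambda>k. LINT x|M. norm (G k x - g x) powr p) \<longlonglongrightarrow> 0"
      using u unfolding W0_def by blast
    have Lp: "ph k \<in> borel_measurable M" "integrable M (\<lambda>x. \<bar>ph k x\<bar> powr p)" "G k \<in> borel_measurable M" "integrable M (\<lambda>x. norm (G k x) powr p)" for k
      using C1c_Lp[OF ph w(1) p0(1), of k] by (auto simp: Lp_fun_def Lp_vec_def)
    note [measurable] = Lp(1,3)
    have id: "integrable M (\<lambda>x. norm (ph k x - u x) powr p)" "integrable M (\<lambda>x. norm (G k x - g x) powr p)" for k
      by (intro integrable_norm_powr_diff um Lp p0, use ui Lp in simp_all)+
    have lu': "(\<lambda>n. LINT x|M. norm (ph n x - u x) powr p) \<longlonglongrightarrow> 0" using lu by simp
    obtain r where r: "strict_mono (r::nat\<Rightarrow>nat)" "AE x in M. (\<lambda>k. ph (r k) x) \<longlonglongrightarrow> u x"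
      using Lp_tendsto_AE_subseq[of M ph u p, OF id(1) p0(1) lu'] by blast
    let ?g = "LINT x|M. norm (g x) powr p" and ?u = "LINT x|M. \<bar>u x\<bar> powr p"
    have bound: "(LINT x|M. \<bar>V x\<bar> * \<bar>ph k x\<bar> powr p)
       \<le> d * (LINT x|M. norm (G k x - g x) powr p) + d * ?g + 2 powr p * C * (LINT x|M. \<bar>ph k x - u x\<bar> powr p) + 2 powr p * C * ?u" for k
    proof -
      have n1: "norm (G k x) powr p \<le> 2 powr p * (norm (G k x - g x) powr p + norm (g x) powr p)" for x
        using norm_add_powr_le[OF p0(2), of "G k x - g x" "g x"] by simp
      have n2: "\<bar>ph k x\<bar> powr p \<le> 2 powr p * (\<bar>ph k x - u x\<bar> powr p + \<bar>u x\<bar> powr p)" for x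
        using norm_add_powr_le[OF p0(2), of "ph k x - u x" "u x"] by simp
      have 1: "(LINT x|M. norm (G k x) powr p) \<le> 2 powr p * ((LINT x|M. norm (G k x - g x) powr p) + ?g)"
      proof -
        have "(LINT x|M. norm (G k x) powr p) \<le> (LINT x|M. 2 powr p * (norm (G k x - g x) powr p + norm (g x) powr p))"
          by (rule integral_mono'[OF _ n1]) (use id ui in auto)
        then show ?thesis using id ui by simp
      qed
      have 2: "(LINT x|M. \<bar>ph k x\<bar> powr p) \<le> 2 powr p * ((LINT x|M. \<bar>ph k x - u x\<bar> powr p) + ?u)"
      proof -
        have "(LINT x|M. \<bar>ph k x\<bar> powr p) \<le> (LINT x|M. 2 powr p * (\<bar>ph k x - u x\<bar> powr p + \<bar>u x\<bar> powr p))"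
          by (rule integral_mono'[OF _ n2]) (use id(1)[of k] ui in auto)
        then show ?thesis using id(1)[of k] ui by simp
      qed
      have "(LINT x|M. \<bar>V x\<bar> * \<bar>ph k x\<bar> powr p) \<le> d' * (LINT x|M. norm (G k x) powr p) + C * (LINT x|M. \<bar>ph k x\<bar> powr p)"
        using C(2)[OF ph] by blast
      also have "\<dots> \<le> d' * (2 powr p * ((LINT x|M. norm (G k x - g x) powr p) + ?g)) + C * (2 powr p * ((LINT x|M. \<bar>ph k x - u x\<bar> powr p) + ?u))"
        using d' C(1) by (intro add_mono mult_left_mono 1 2) auto
      also have "\<dots> = d * (LINT x|M. norm (G k x - g x) powr p) + d * ?g + 2 powr p * C * (LINT x|M. \<bar>ph k x - u x\<bar> powr p) + 2 powr p * C * ?u"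
        by (simp add: d'_def algebra_simps)
      finally show ?thesis .
    qed
    \<comment> \<open>The slack e takes up the approximation errors in \<open>bound\<close>; it is
      removed afterwards by letting e tend to 0.\<close>
    have iV: "integrable M (\<lambda>x. \<bar>V x\<bar> * \<bar>u x\<bar> powr p) \<and> (LINT x|M. \<bar>V x\<bar> * \<bar>u x\<bar> powr p) \<le> d * ?g + 2 powr p * C * ?u + e" if e: "0 < e" for e
    proof -
      have "(\<lambda>k. d * (LINT x|M. norm (G k x - g x) powr p) + 2 powr p * C * (LINT x|M. \<bar>ph k x - u x\<bar> powr p)) \<longlonglongrightarrow> d * 0 + 2 powr p * C * 0"
        by (intro tendsto_intros lu lg)
      then have "eventually (\<lambda>k. d * (LINT x|M. norm (G k x - g x) powr p) + 2 powr p * C * (LINT x|M. \<bar>ph k x - u x\<bar> powr p) < e) sequentially"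
        using e by (intro order_tendstoD(2)) auto
      then have "eventually (\<lambda>k. (LINT x|M. \<bar>V x\<bar> * \<bar>ph k x\<bar> powr p) \<le> d * ?g + 2 powr p * C * ?u + e) sequentially"
      proof eventually_elim
        case (elim k) then show ?case using bound[of k] by linarith
      qed
      then have ev: "eventually (\<lambda>k. (LINT x|M. \<bar>V x\<bar> * \<bar>ph (r k) x\<bar> powr p) \<le> d * ?g + 2 powr p * C * ?u + e) sequentially"
        by (rule eventually_subseq[OF r(1)])
      have lim: "AE x in M. (\<lambda>k. \<bar>V x\<bar> * \<bar>ph (r k) x\<bar> powr p) \<longlonglongrightarrow> \<bar>V x\<bar> * \<bar>u x\<bar> powr p"
        using r(2) by eventually_elim (intro tendsto_intros tendsto_powr2, use p0 in auto)
      show ?thesis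
        using integrable_Fatou[OF _ _ _ lim ev] C(2)[OF ph] by auto
    qed
    have i1: "integrable M (\<lambda>x. \<bar>V x\<bar> * \<bar>u x\<bar> powr p)" using iV[of 1] by simp
    have b1: "(LINT x|M. \<bar>V x\<bar> * \<bar>u x\<bar> powr p) \<le> d * ?g + 2 powr p * C * ?u"
      by (rule field_le_epsilon) (use iV in blast)
    have eq: "(\<lambda>x. wt x * \<bar>u x\<bar> powr p) = (\<lambda>x. \<bar>V x\<bar> * \<bar>u x\<bar> powr p + \<bar>u x\<bar> powr p)" by (auto simp: wt_def algebra_simps)
    show "integrable M (\<lambda>x. wt x * \<bar>u x\<bar> powr p)" unfolding eq using i1 ui by simp
    show "(LINT x|M. wt x * \<bar>u x\<bar> powr p) \<le> d * ?g + (2 powr p * C + 1) * ?u"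
      unfolding eq using i1 ui b1 by (simp add: algebra_simps)
  qed
qed

lemma W0_weight:
  assumes "W0 p w u g"
  shows "integrable M (\<lambda>x. wt x * \<bar>u x\<bar> powr p)"
  using trace[OF zero_less_one] assms by blast

text \<open>First d is chosen against the gradient bound, then the constant C belonging to d is
  beaten by the decay in L^p.\<close>

lemma weight_tendsto_0:
  fixes u :: "'i \<Rightarrow> 'a \<Rightarrow> real"
  assumes W: "\<And>i. W0 p w (u i) (g i)" and B: "\<And>i. (LINT x|M. norm (g i x) powr p) \<le> B"
    and lim: "((\<lambda>i. LINT x|M. \<bar>u i x\<bar> powr p) \<longlongrightarrow> 0) F"
  shows "((\<lambda>i. LINT x|M. wt x * \<bar>u i x\<bar> powr p) \<longlongrightarrow> 0) F"
proof (rule tendstoI)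
  fix e :: real assume e: "0 < e"
  define d where "d = e / (2 * (\<bar>B\<bar> + 1))"
  have d: "0 < d" using e by (simp add: d_def)
  obtain C where C: "0 \<le> C" "\<And>u g. W0 p w u g \<Longrightarrow> integrable M (\<lambda>x. wt x * \<bar>u x\<bar> powr p) \<and>
    (LINT x|M. wt x * \<bar>u x\<bar> powr p) \<le> d * (LINT x|M. norm (g x) powr p) + C * (LINT x|M. \<bar>u x\<bar> powr p)"
    using trace[OF d] by blast
  have dB: "d * B \<le> e / 2"
  proof -
    have "d * B \<le> d * (\<bar>B\<bar> + 1)" using d by (intro mult_left_mono) auto
    also have "\<dots> = e / 2" by (simp add: d_def field_simps)
    finally show ?thesis .
  qed
  have "((\<lambda>i. C * (LINT x|M. \<bar>u i x\<bar> powr p)) \<longlongrightarrow> C * 0) F" by (intro tendsto_intros lim)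
  then have "eventually (\<lambda>i. C * (LINT x|M. \<bar>u i x\<bar> powr p) < e / 2) F" using e by (intro order_tendstoD(2)) auto
  then show "eventually (\<lambda>i. dist (LINT x|M. wt x * \<bar>u i x\<bar> powr p) 0 < e) F"
  proof eventually_elim
    case (elim i)
    have "(LINT x|M. wt x * \<bar>u i x\<bar> powr p) \<le> d * (LINT x|M. norm (g i x) powr p) + C * (LINT x|M. \<bar>u i x\<bar> powr p)" using C(2)[OF W] by blast
    also have "d * (LINT x|M. norm (g i x) powr p) \<le> d * B" using B d by (intro mult_left_mono) auto
    finally have "(LINT x|M. wt x * \<bar>u i x\<bar> powr p) < e" using elim dB by linarith
    moreover have "0 \<le> (LINT x|M. wt x * \<bar>u i x\<bar> powr p)" using wt_ge by (intro integral_nonneg_AE) auto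
    ultimately show ?case by simp
  qed
qed

section \<open>The weak form of the equation and its admissible test functions\<close>

definition pairing :: "('a \<Rightarrow> real) \<Rightarrow> ('a \<Rightarrow> 'a) \<Rightarrow> real \<Rightarrow> ('a \<Rightarrow> real) \<Rightarrow> ('a \<Rightarrow> 'a) \<Rightarrow> real" where
  "pairing v g lam psi h = (LINT x|M. A x (g x) \<bullet> h x) + (LINT x|M. (V x - lam) * (\<bar>v x\<bar> powr (p - 2)) * v x * psi x)"

lemma reaction_le: "\<bar>(V x - lam) * (\<bar>a\<bar> powr (p - 2)) * a * b\<bar> \<le> (1 + \<bar>lam\<bar>) * (wt x * (\<bar>a\<bar> powr (p - 1) * \<bar>b\<bar>))"
proof -
  have "\<bar>(V x - lam) * (\<bar>a\<bar> powr (p - 2)) * a * b\<bar> = \<bar>V x - lam\<bar> * (\<bar>\<bar>a\<bar> powr (p - 2) * a\<bar> * \<bar>b\<bar>)"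
    by (simp add: abs_mult)
  also have "\<dots> = \<bar>V x - lam\<bar> * (\<bar>a\<bar> powr (p - 1) * \<bar>b\<bar>)" by (simp only: abs_signed_powr)
  also have "\<dots> \<le> (1 + \<bar>lam\<bar>) * wt x * (\<bar>a\<bar> powr (p - 1) * \<bar>b\<bar>)"
    by (intro mult_right_mono V_diff_le) auto
  finally show ?thesis by (simp only: mult.assoc)
qed

lemma flux_inner_le: "AE x in M. \<bar>A x (g x) \<bullet> h x\<bar> \<le> nu powr p * (norm (g x) powr (p - 1) * norm (h x))"
  using norms
proof eventually_elim
  case (elim x)
  have "\<bar>A x (g x) \<bullet> h x\<bar> \<le> norm (A x (g x)) * norm (h x)" by (rule Cauchy_Schwarz_ineq2)
  also have "\<dots> \<le> nu powr p * norm (g x) powr (p - 1) * norm (h x)"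
    by (intro mult_right_mono finsler_norm.norm_flux_le[OF elim]) auto
  finally show ?case by (simp only: mult.assoc)
qed

lemma unweighted_product:
  assumes "g \<in> borel_measurable M" "h \<in> borel_measurable M" "integrable M (\<lambda>x. norm (g x) powr p)" "integrable M (\<lambda>x. norm (h x) powr p)"
  shows "integrable M (\<lambda>x. norm (g x) powr (p - 1) * norm (h x))"
  using weighted_product_integrable(1)[of "\<lambda>_. 1" M "\<lambda>x. norm (g x)" "\<lambda>x. norm (h x)" p] assms p by simp

lemma weighted_product:
  assumes v: "W0 p w v g" and psi: "W0 p w psi h"
  shows "integrable M (\<lambda>x. wt x * (\<bar>v x\<bar> powr (p - 1) * \<bar>psi x\<bar>))"
  using W0_D(1)[OF v] W0_D(1)[OF psi] W0_weight[OF v] W0_weight[OF psi] wt_ge p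
  by (intro weighted_product_integrable(1)) auto

text \<open>The bound is by products, one factor from the solution and one from the test function,
  so that it vanishes as soon as the test functions do.\<close>

lemma pairing_integrable:
  assumes v: "W0 p w v g" and psi: "W0 p w psi h"
  shows "integrable M (\<lambda>x. A x (g x) \<bullet> h x)" "integrable M (\<lambda>x. (V x - lam) * (\<bar>v x\<bar> powr (p - 2)) * v x * psi x)"
    "\<bar>pairing v g lam psi h\<bar> \<le> nu powr p * (LINT x|M. norm (g x) powr (p - 1) * norm (h x)) + (1 + \<bar>lam\<bar>) * (LINT x|M. wt x * (\<bar>v x\<bar> powr (p - 1) * \<bar>psi x\<bar>))"
proof -
  note [measurable] = W0_D(1,2)[OF v] W0_D(1,2)[OF psi] flux_measurable[OF W0_D(2)[OF v]]
  have i1: "integrable M (\<lambda>x. norm (g x) powr (p - 1) * norm (h x))"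
    by (intro unweighted_product W0_D[OF v] W0_D[OF psi])
  have i2: "integrable M (\<lambda>x. wt x * (\<bar>v x\<bar> powr (p - 1) * \<bar>psi x\<bar>))" by (rule weighted_product[OF v psi])
  show a: "integrable M (\<lambda>x. A x (g x) \<bullet> h x)"
    by (rule Bochner_Integration.integrable_bound[OF integrable_mult_right[OF i1, of "nu powr p"]])
      (use flux_inner_le[of g h] in \<open>auto elim!: eventually_mono\<close>)
  show b: "integrable M (\<lambda>x. (V x - lam) * (\<bar>v x\<bar> powr (p - 2)) * v x * psi x)"
  proof (rule Bochner_Integration.integrable_bound[OF integrable_mult_right[OF i2, of "1 + \<bar>lam\<bar>"]])
    show "AE x in M. norm ((V x - lam) * (\<bar>v x\<bar> powr (p - 2)) * v x * psi x) \<le> norm ((1 + \<bar>lam\<bar>) * (wt x * (\<bar>v x\<bar> powr (p - 1) * \<bar>psi x\<bar>)))"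
      unfolding real_norm_def by (intro AE_I2 order_trans[OF reaction_le]) (rule abs_ge_self)
  qed measurable
  have "\<bar>LINT x|M. A x (g x) \<bullet> h x\<bar> \<le> (LINT x|M. \<bar>A x (g x) \<bullet> h x\<bar>)" by (rule integral_abs_bound)
  also have "\<dots> \<le> (LINT x|M. nu powr p * (norm (g x) powr (p - 1) * norm (h x)))"
    using a i1 by (intro integral_mono_AE flux_inner_le) auto
  finally have A1: "\<bar>LINT x|M. A x (g x) \<bullet> h x\<bar> \<le> nu powr p * (LINT x|M. norm (g x) powr (p - 1) * norm (h x))" by simp
  have "\<bar>LINT x|M. (V x - lam) * (\<bar>v x\<bar> powr (p - 2)) * v x * psi x\<bar> \<le> (LINT x|M. \<bar>(V x - lam) * (\<bar>v x\<bar> powr (p - 2)) * v x * psi x\<bar>)" by (rule integral_abs_bound)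
  also have "\<dots> \<le> (LINT x|M. (1 + \<bar>lam\<bar>) * (wt x * (\<bar>v x\<bar> powr (p - 1) * \<bar>psi x\<bar>)))"
    by (rule integral_mono[OF _ _ reaction_le]) (use b i2 in \<open>auto simp del: abs_mult\<close>)
  finally have A2: "\<bar>LINT x|M. (V x - lam) * (\<bar>v x\<bar> powr (p - 2)) * v x * psi x\<bar> \<le> (1 + \<bar>lam\<bar>) * (LINT x|M. wt x * (\<bar>v x\<bar> powr (p - 1) * \<bar>psi x\<bar>))" by simp
  show "\<bar>pairing v g lam psi h\<bar> \<le> nu powr p * (LINT x|M. norm (g x) powr (p - 1) * norm (h x)) + (1 + \<bar>lam\<bar>) * (LINT x|M. wt x * (\<bar>v x\<bar> powr (p - 1) * \<bar>psi x\<bar>))"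
    unfolding pairing_def by (intro order_trans[OF abs_triangle_ineq] add_mono A1 A2)
qed

lemma pairing_diff:
  assumes v: "W0 p w v g" and psi: "W0 p w psi h" and psi': "W0 p w psi' h'"
  shows "pairing v g lam (\<lambda>x. psi x - psi' x) (\<lambda>x. h x - h' x) = pairing v g lam psi h - pairing v g lam psi' h'"
  unfolding pairing_def inner_diff_right right_diff_distrib
  using pairing_integrable(1)[OF v psi] pairing_integrable(1)[OF v psi'] pairing_integrable(2)[OF v psi, of lam] pairing_integrable(2)[OF v psi', of lam] by simp

text \<open>Test functions are dense by definition of W^{1,p}_0. The potential term passes to the
  limit because the approximation errors have bounded gradients and vanish in L^p, hence also in the
  weighted norm.\<close>

lemma pairing_extend:
  assumes v: "W0 p w v g" and eq: "\<And>phi. test_fun w phi \<Longrightarrow> pairing v g lam phi (grad phi) = 0" and psi: "W1p0 p w psi h"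
  shows "pairing v g lam psi h = 0"
proof -
  obtain ph where ph: "\<And>k. test_fun w (ph k)"
    and l: "(\<lambda>k. LINT x|M. \<bar>ph k x - psi x\<bar> powr p) \<longlonglongrightarrow> 0" "(\<lambda>k. LINT x|M. norm (grad (ph k) x - h x) powr p) \<longlonglongrightarrow> 0"
    using psi by (auto simp: W1p0_def)
  have Wpsi: "W0 p w psi h" by (rule W1p0_W0[OF psi])
  have Wph: "W0 p w (ph k) (grad (ph k))" for k by (rule C1c_W0[OF test_fun_C1c[OF ph] w(1) p0(1)])
  have Wd: "W0 p w (\<lambda>x. ph k x - psi x) (\<lambda>x. grad (ph k) x - h x)" for k by (rule W0_diff[OF w(1) p0(1) Wph Wpsi])
  have bd: "Bseq (\<lambda>k. LINT x|M. norm (grad (ph k) x - h x) powr p)" using l(2) by (intro convergent_imp_Bseq) (auto simp: convergent_def)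
  then obtain B where B: "\<And>k. (LINT x|M. norm (grad (ph k) x - h x) powr p) \<le> B"
    by (auto simp: Bseq_def abs_le_iff)
  have lw: "(\<lambda>k. LINT x|M. wt x * \<bar>ph k x - psi x\<bar> powr p) \<longlonglongrightarrow> 0"
    by (rule weight_tendsto_0[OF Wd B l(1)])
  note mv = W0_D[OF v] and md = W0_D[OF Wd]
  have t1: "(\<lambda>k. LINT x|M. 1 * (norm (g x) powr (p - 1) * norm (grad (ph k) x - h x))) \<longlonglongrightarrow> 0"
    by (rule weighted_product_tendsto_0[where B="LINT x|M. 1 * norm (g x) powr p" and f="\<lambda>_ x. norm (g x)"])
      (use mv md p l(2) in auto)
  have t2: "(\<lambda>k. LINT x|M. wt x * (\<bar>v x\<bar> powr (p - 1) * \<bar>ph k x - psi x\<bar>)) \<longlonglongrightarrow> 0"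
    by (rule weighted_product_tendsto_0[where B="LINT x|M. wt x * \<bar>v x\<bar> powr p" and f="\<lambda>_ x. \<bar>v x\<bar>"])
      (use mv md p lw wt_ge W0_weight[OF v] W0_weight[OF Wd] in auto)
  have "(\<lambda>k. nu powr p * (LINT x|M. 1 * (norm (g x) powr (p - 1) * norm (grad (ph k) x - h x))) + (1 + \<bar>lam\<bar>) * (LINT x|M. wt x * (\<bar>v x\<bar> powr (p - 1) * \<bar>ph k x - psi x\<bar>))) \<longlonglongrightarrow> nu powr p * 0 + (1 + \<bar>lam\<bar>) * 0"
    by (intro tendsto_intros t1 t2)
  moreover have "\<bar>pairing v g lam psi h\<bar> \<le> nu powr p * (LINT x|M. 1 * (norm (g x) powr (p - 1) * norm (grad (ph k) x - h x))) + (1 + \<bar>lam\<bar>) * (LINT x|M. wt x * (\<bar>v x\<bar> powr (p - 1) * \<bar>ph k x - psi x\<bar>))" for k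
  proof -
    have "\<bar>pairing v g lam psi h\<bar> = \<bar>pairing v g lam (\<lambda>x. ph k x - psi x) (\<lambda>x. grad (ph k) x - h x)\<bar>"
      unfolding pairing_diff[OF v Wph Wpsi] eq[OF ph] by simp
    then show ?thesis using pairing_integrable(3)[where lam=lam, OF v Wd[of k]] by simp
  qed
  ultimately have "\<bar>pairing v g lam psi h\<bar> \<le> nu powr p * 0 + (1 + \<bar>lam\<bar>) * 0"
    by (intro LIMSEQ_le_const) auto
  then show ?thesis by simp
qed

lemma eigenvalue_iff:
  "is_eigenvalue H p V w lam \<longleftrightarrow> (\<exists>v g. W1p0 p w v g \<and> \<not> (AE x in M. v x = 0) \<and> (\<forall>phi. test_fun w phi \<longrightarrow> pairing v g lam phi (grad phi) = 0))"
  unfolding is_eigenvalue_def pairing_def Aop_eq_flux ..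

text \<open>Flux and reaction term are both homogeneous of degree p - 1, so a positive multiple of
  an eigenfunction solves the same equation.\<close>

lemma normalized_eigenfunction:
  assumes "is_eigenvalue H p V w lam"
  obtains v g where "W1p0 p w v g" "(LINT x|M. \<bar>v x\<bar> powr p) = 1" "\<And>phi. test_fun w phi \<Longrightarrow> pairing v g lam phi (grad phi) = 0"
proof -
  obtain v g where v: "W1p0 p w v g" "\<not> (AE x in M. v x = 0)" and eq: "\<And>phi. test_fun w phi \<Longrightarrow> pairing v g lam phi (grad phi) = 0"
    using assms unfolding eigenvalue_iff by blast
  note m = W0_D[OF W1p0_W0[OF v(1)]]
  define I where "I = (LINT x|M. \<bar>v x\<bar> powr p)"
  have "I \<noteq> 0"
  proof
    assume "I = 0"
    then have "AE x in M. \<bar>v x\<bar> powr p = 0" using integral_nonneg_eq_0_iff_AE[OF m(3)] by (simp add: I_def)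
    then show False using v(2) by simp
  qed
  moreover have "0 \<le> I" unfolding I_def by (rule integral_nonneg_AE) auto
  ultimately have I: "0 < I" by simp
  define c where "c = I powr (- 1 / p)"
  have c: "0 < c" using I by (simp add: c_def)
  have cp: "c powr p = 1 / I" proof -
    have "c powr p = I powr (- 1)" unfolding c_def powr_powr using p by simp
    then show ?thesis using I by (simp add: powr_minus_divide)
  qed
  show thesis
  proof (rule that[OF W1p0_scale[OF v(1) c]])
    have "(LINT x|M. \<bar>c * v x\<bar> powr p) = c powr p * I" 
    proof -
      have "\<bar>c * a\<bar> powr p = c powr p * \<bar>a\<bar> powr p" for a using c by (simp add: abs_mult powr_mult)
      then show ?thesis by (simp only: integral_mult_right_zero I_def)
    qed
    then show "(LINT x|M. \<bar>c * v x\<bar> powr p) = 1" using cp I by simp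
    fix phi assume phi: "test_fun w phi"
    have cc: "c powr (p - 2) * c = c powr (p - 1)" using c powr_add[of c "p - 2" 1] by simp
    have 1: "(LINT x|M. A x (c *\<^sub>R g x) \<bullet> grad phi x) = c powr (p - 1) * (LINT x|M. A x (g x) \<bullet> grad phi x)"
    proof -
      have gp: "grad phi \<in> borel_measurable M"
        using C1c_Lp(2)[OF test_fun_C1c[OF phi] w(1) p0(1)] by (simp add: Lp_vec_def)
      have [measurable]: "(\<lambda>x. A x (c *\<^sub>R g x)) \<in> borel_measurable M" "(\<lambda>x. A x (g x)) \<in> borel_measurable M" "grad phi \<in> borel_measurable M"
        using m(2) gp by (auto intro!: flux_measurable)
      have "(LINT x|M. A x (c *\<^sub>R g x) \<bullet> grad phi x) = (LINT x|M. c powr (p - 1) * (A x (g x) \<bullet> grad phi x))"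
        using norms by (intro integral_cong_AE, measurable, eventually_elim) (simp add: finsler_norm.flux_scale[OF _ c])
      then show ?thesis by simp
    qed
    have 2: "(V x - lam) * (\<bar>c * v x\<bar> powr (p - 2)) * (c * v x) * phi x = c powr (p - 1) * ((V x - lam) * (\<bar>v x\<bar> powr (p - 2)) * v x * phi x)" for x
    proof -
      have "\<bar>c * v x\<bar> powr (p - 2) = c powr (p - 2) * \<bar>v x\<bar> powr (p - 2)" using c by (simp add: abs_mult powr_mult)
      then show ?thesis by (simp only: cc[symmetric] mult_ac)
    qed
    have "pairing (\<lambda>x. c * v x) (\<lambda>x. c *\<^sub>R g x) lam phi (grad phi) = c powr (p - 1) * pairing v g lam phi (grad phi)"
      unfolding pairing_def 1 2 integral_mult_right_zero distrib_left ..
    then show "pairing (\<lambda>x. c * v x) (\<lambda>x. c *\<^sub>R g x) lam phi (grad phi) = 0" using eq[OF phi] by simp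
  qed
qed

text \<open>The eigenfunction tests its own equation; Euler's identity bounds the flux term from
  below by kappa^p |g|^p.\<close>

lemma energy_identity_bound:
  assumes v: "W1p0 p w v g" "(LINT x|M. \<bar>v x\<bar> powr p) = 1" and eq: "\<And>phi. test_fun w phi \<Longrightarrow> pairing v g lam phi (grad phi) = 0"
  shows "kappa powr p * (LINT x|M. norm (g x) powr p) \<le> (1 + \<bar>lam\<bar>) * (LINT x|M. wt x * \<bar>v x\<bar> powr p)"
proof -
  have W: "W0 p w v g" by (rule W1p0_W0[OF v(1)])
  note m = W0_D[OF W]
  have i: "integrable M (\<lambda>x. A x (g x) \<bullet> g x)" "integrable M (\<lambda>x. (V x - lam) * (\<bar>v x\<bar> powr (p - 2)) * v x * v x)"
    by (rule pairing_integrable(1,2)[OF W W])+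
  have "kappa powr p * (LINT x|M. norm (g x) powr p) = (LINT x|M. kappa powr p * norm (g x) powr p)" by simp
  also have "\<dots> \<le> (LINT x|M. A x (g x) \<bullet> g x)"
  proof (rule integral_mono_AE)
    show "AE x in M. kappa powr p * norm (g x) powr p \<le> A x (g x) \<bullet> g x"
      using norms
    proof eventually_elim
      case (elim x)
      have "(kappa * norm (g x)) powr p \<le> H x (g x) powr p"
        using finsler_norm.lower[OF elim] kappa p by (intro powr_mono2) auto
      then show ?case using kappa by (simp add: powr_mult finsler_norm.flux_self[OF elim])
    qed
  qed (use m i in auto)
  also have "\<dots> = - (LINT x|M. (V x - lam) * (\<bar>v x\<bar> powr (p - 2)) * v x * v x)"
    using pairing_extend[OF W eq v(1)] by (simp add: pairing_def)
  also have "\<dots> \<le> (LINT x|M. \<bar>(V x - lam) * (\<bar>v x\<bar> powr (p - 2)) * v x * v x\<bar>)"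
    using integral_abs_bound[of M "\<lambda>x. (V x - lam) * (\<bar>v x\<bar> powr (p - 2)) * v x * v x"] by linarith
  also have "\<dots> \<le> (LINT x|M. (1 + \<bar>lam\<bar>) * (wt x * (\<bar>v x\<bar> powr (p - 1) * \<bar>v x\<bar>)))"
    by (rule integral_mono[OF _ _ reaction_le]) (use i weighted_product[OF W W] in \<open>auto simp del: abs_mult\<close>)
  also have "\<dots> = (1 + \<bar>lam\<bar>) * (LINT x|M. wt x * \<bar>v x\<bar> powr p)"
  proof -
    have "\<bar>a\<bar> powr (p - 1) * \<bar>a\<bar> = \<bar>a\<bar> powr p" for a :: real using powr_add[of "\<bar>a\<bar>" "p - 1" 1] by (cases "a = 0") auto
    then show ?thesis by simp
  qed
  finally show ?thesis .
qed

text \<open>Both equations are tested with v - v' and subtracted. The two reaction terms are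
  estimated separately: each already contains the factor v - v', so the eigenvalues enter only
  through their size.\<close>

lemma gap_integral_le:
  assumes v: "W1p0 p w v g" "\<And>phi. test_fun w phi \<Longrightarrow> pairing v g lam phi (grad phi) = 0"
    and v': "W1p0 p w v' g'" "\<And>phi. test_fun w phi \<Longrightarrow> pairing v' g' lam' phi (grad phi) = 0"
  shows "integral\<^sup>L M (gap g g') \<le> (1 + \<bar>lam\<bar>) * (LINT x|M. wt x * (\<bar>v x\<bar> powr (p - 1) * \<bar>v x - v' x\<bar>))
    + (1 + \<bar>lam'\<bar>) * (LINT x|M. wt x * (\<bar>v' x\<bar> powr (p - 1) * \<bar>v x - v' x\<bar>))"
proof -
  have W: "W0 p w v g" "W0 p w v' g'" using v v' by (auto intro: W1p0_W0)
  have Wd: "W0 p w (\<lambda>x. v x - v' x) (\<lambda>x. g x - g' x)" by (rule W0_diff[OF w(1) p0(1) W])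
  let ?R = "\<lambda>v lam x. (V x - lam) * (\<bar>v x\<bar> powr (p - 2)) * v x * (v x - v' x)"
  have e1: "pairing v g lam (\<lambda>x. v x - v' x) (\<lambda>x. g x - g' x) = 0"
    using pairing_diff[OF W(1) W] pairing_extend[OF W(1) v(2) v(1)] pairing_extend[OF W(1) v(2) v'(1)] by simp
  have e2: "pairing v' g' lam' (\<lambda>x. v x - v' x) (\<lambda>x. g x - g' x) = 0"
    using pairing_diff[OF W(2) W] pairing_extend[OF W(2) v'(2) v(1)] pairing_extend[OF W(2) v'(2) v'(1)] by simp
  have rb: "\<bar>LINT x|M. (V x - l) * (\<bar>u x\<bar> powr (p - 2)) * u x * (v x - v' x)\<bar> \<le> (1 + \<bar>l\<bar>) * (LINT x|M. wt x * (\<bar>u x\<bar> powr (p - 1) * \<bar>v x - v' x\<bar>))"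
    if u: "W0 p w u h" for u h l
  proof -
    have "\<bar>LINT x|M. (V x - l) * (\<bar>u x\<bar> powr (p - 2)) * u x * (v x - v' x)\<bar> \<le> (LINT x|M. \<bar>(V x - l) * (\<bar>u x\<bar> powr (p - 2)) * u x * (v x - v' x)\<bar>)" by (rule integral_abs_bound)
    also have "\<dots> \<le> (LINT x|M. (1 + \<bar>l\<bar>) * (wt x * (\<bar>u x\<bar> powr (p - 1) * \<bar>v x - v' x\<bar>)))"
      by (rule integral_mono[OF _ _ reaction_le]) (use pairing_integrable(2)[OF u Wd] weighted_product[OF u Wd] in \<open>auto simp del: abs_mult\<close>)
    finally show ?thesis by simp
  qed
  note m = W0_D[OF W(1)] W0_D[OF W(2)]
  note [measurable] = m(2,6) flux_measurable[OF m(2)] flux_measurable[OF m(6)]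
  have "integral\<^sup>L M (gap g g') = (LINT x|M. A x (g x) \<bullet> (g x - g' x) - A x (g' x) \<bullet> (g x - g' x))"
    unfolding gap_def using norms
    by (intro integral_cong_AE, measurable, eventually_elim) (simp add: finsler_norm.monotone inner_diff_left[symmetric])
  also have "\<dots> = (LINT x|M. A x (g x) \<bullet> (g x - g' x)) - (LINT x|M. A x (g' x) \<bullet> (g x - g' x))"
    by (intro Bochner_Integration.integral_diff pairing_integrable(1)[OF W(1) Wd] pairing_integrable(1)[OF W(2) Wd])
  also have "\<dots> = - (LINT x|M. (V x - lam) * (\<bar>v x\<bar> powr (p - 2)) * v x * (v x - v' x)) + (LINT x|M. (V x - lam') * (\<bar>v' x\<bar> powr (p - 2)) * v' x * (v x - v' x))"
    using e1 e2 unfolding pairing_def by linarith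
  also have "\<dots> \<le> (1 + \<bar>lam\<bar>) * (LINT x|M. wt x * (\<bar>v x\<bar> powr (p - 1) * \<bar>v x - v' x\<bar>))
    + (1 + \<bar>lam'\<bar>) * (LINT x|M. wt x * (\<bar>v' x\<bar> powr (p - 1) * \<bar>v x - v' x\<bar>))"
    using rb[OF W(1), of lam] rb[OF W(2), of lam'] by linarith
  finally show ?thesis .
qed

section \<open>Compactness and strong limits in W^{1,p}_0\<close>

lemma tendsto_pair_fst:
  fixes a :: "nat \<Rightarrow> real"
  assumes "a \<longlonglongrightarrow> 0"
  shows "((\<lambda>z. a (fst z)) \<longlongrightarrow> 0) (sequentially \<times>\<^sub>F sequentially)" "((\<lambda>z. a (snd z)) \<longlongrightarrow> 0) (sequentially \<times>\<^sub>F sequentially)"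
  by (rule filterlim_compose[OF assms filterlim_fst], rule filterlim_compose[OF assms filterlim_snd])

lemma Lp_triangle:
  fixes f h :: "'a \<Rightarrow> 'b::euclidean_space"
  assumes "f \<in> borel_measurable M" "h \<in> borel_measurable M" "integrable M (\<lambda>x. norm (f x) powr p)" "integrable M (\<lambda>x. norm (h x) powr p)"
  shows "(LINT x|M. norm (f x - h x) powr p) \<le> 2 powr p * ((LINT x|M. norm (f x) powr p) + (LINT x|M. norm (h x) powr p))"
    "(LINT x|M. norm (f x + h x) powr p) \<le> 2 powr p * ((LINT x|M. norm (f x) powr p) + (LINT x|M. norm (h x) powr p))"
proof -
  have "(LINT x|M. norm (f x - h x) powr p) \<le> (LINT x|M. 2 powr p * (norm (f x) powr p + norm (h x) powr p))"
    by (rule integral_mono'[OF _ norm_diff_powr_le[OF p0(2)]]) (use assms in auto)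
  then show "(LINT x|M. norm (f x - h x) powr p) \<le> 2 powr p * ((LINT x|M. norm (f x) powr p) + (LINT x|M. norm (h x) powr p))"
    using assms by simp
  have "(LINT x|M. norm (f x + h x) powr p) \<le> (LINT x|M. 2 powr p * (norm (f x) powr p + norm (h x) powr p))"
    by (rule integral_mono'[OF _ norm_add_powr_le[OF p0(2)]]) (use assms in auto)
  then show "(LINT x|M. norm (f x + h x) powr p) \<le> 2 powr p * ((LINT x|M. norm (f x) powr p) + (LINT x|M. norm (h x) powr p))"
    using assms by simp
qed

text \<open>Diagonal choice: the k-th test function lies within 1 / (k + 1) of v_k, so it inherits
  the bounds, and its compactness transfers back. The same test functions later approximate the
  limit function.\<close>

lemma Rellich_W1p0:
  assumes W: "\<And>k. W1p0 p w (v k) (g k)" and vB: "\<And>k. (LINT x|M. \<bar>v k x\<bar> powr p) \<le> B" and gB: "\<And>k. (LINT x|M. norm (g k x) powr p) \<le> B"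
  obtains ph rho where "\<And>k::nat. test_fun w (ph k)"
    "(\<lambda>k. LINT x|M. \<bar>ph k x - v k x\<bar> powr p) \<longlonglongrightarrow> 0" "(\<lambda>k. LINT x|M. norm (grad (ph k) x - g k x) powr p) \<longlonglongrightarrow> 0"
    "strict_mono (rho::nat\<Rightarrow>nat)"
    "((\<lambda>z. LINT x|M. \<bar>v (rho (fst z)) x - v (rho (snd z)) x\<bar> powr p) \<longlongrightarrow> 0) (sequentially \<times>\<^sub>F sequentially)"
proof -
  define a b where "a f k = (LINT x|M. norm (f x - v k x) powr p)" and "b f k = (LINT x|M. norm (grad f x - g k x) powr p)" for f k
  have ex: "\<exists>f. test_fun w f \<and> a f k < 1 / real (Suc k) \<and> b f k < 1 / real (Suc k)" for k
  proof -
    obtain ps where ps: "\<And>j. test_fun w (ps j)" "(\<lambda>j. a (ps j) k) \<longlonglongrightarrow> 0" "(\<lambda>j. b (ps j) k) \<longlonglongrightarrow> 0"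
      using W[of k] by (auto simp: W1p0_def a_def b_def)
    have "eventually (\<lambda>j. a (ps j) k < 1 / real (Suc k) \<and> b (ps j) k < 1 / real (Suc k)) sequentially"
      using ps(2,3) by (intro eventually_conj order_tendstoD(2)) auto
    from eventually_happens'[OF sequentially_bot this] obtain j where "a (ps j) k < 1 / real (Suc k) \<and> b (ps j) k < 1 / real (Suc k)" by blast
    then show ?thesis using ps(1) by blast
  qed
  then have "\<exists>ph. \<forall>k. test_fun w (ph k) \<and> a (ph k) k < 1 / real (Suc k) \<and> b (ph k) k < 1 / real (Suc k)"
    by (intro choice allI)
  then obtain ph where ph: "\<And>k. test_fun w (ph k)" and ab: "\<And>k. a (ph k) k < 1 / real (Suc k)" "\<And>k. b (ph k) k < 1 / real (Suc k)"
    by blast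
  have inv: "(\<lambda>k. 1 / real (Suc k)) \<longlonglongrightarrow> 0" using LIMSEQ_inverse_real_of_nat by (simp add: inverse_eq_divide)
  have la: "(\<lambda>k. a (ph k) k) \<longlonglongrightarrow> 0"
  proof (rule tendsto_sandwich[OF _ _ tendsto_const inv])
    show "eventually (\<lambda>k. 0 \<le> a (ph k) k) sequentially" unfolding a_def by (auto intro!: always_eventually integral_nonneg_AE)
    show "eventually (\<lambda>k. a (ph k) k \<le> 1 / real (Suc k)) sequentially" by (intro always_eventually allI less_imp_le ab(1))
  qed
  have lb: "(\<lambda>k. b (ph k) k) \<longlonglongrightarrow> 0"
  proof (rule tendsto_sandwich[OF _ _ tendsto_const inv])
    show "eventually (\<lambda>k. 0 \<le> b (ph k) k) sequentially" unfolding b_def by (auto intro!: always_eventually integral_nonneg_AE)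
    show "eventually (\<lambda>k. b (ph k) k \<le> 1 / real (Suc k)) sequentially" by (intro always_eventually allI less_imp_le ab(2))
  qed
  have C: "C1c w (ph k) (grad (ph k))" for k by (rule test_fun_C1c[OF ph])
  have Wp: "W0 p w (ph k) (grad (ph k))" for k by (rule C1c_W0[OF C w(1) p0(1)])
  have Wv: "W0 p w (v k) (g k)" for k by (rule W1p0_W0[OF W])
  note md = W0_D[OF W0_diff[OF w(1) p0(1) Wp Wv]]
  note mv = W0_D[OF Wv] and mp = W0_D[OF Wp]
  have one: "1 / real (Suc k) \<le> 1" for k by simp
  have a1: "(LINT x|M. norm (ph k x - v k x) powr p) \<le> 1" "(LINT x|M. norm (grad (ph k) x - g k x) powr p) \<le> 1" for k
    using less_le_trans[OF ab(1)[of k] one] less_le_trans[OF ab(2)[of k] one] unfolding a_def b_def by (auto intro: less_imp_le)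
  have B1: "(LINT x|M. \<bar>ph k x\<bar> powr p) \<le> 2 powr p * (1 + B)" for k
  proof -
    have "(LINT x|M. norm ((ph k x - v k x) + v k x) powr p) \<le> 2 powr p * ((LINT x|M. norm (ph k x - v k x) powr p) + (LINT x|M. norm (v k x) powr p))"
      by (rule Lp_triangle(2)) (use md(1,3)[of k k] mv(1,3)[of k] in auto)
    also have "\<dots> \<le> 2 powr p * (1 + B)"
      using vB[of k] by (intro mult_left_mono add_mono a1) auto
    finally show ?thesis by simp
  qed
  have B2: "(LINT x|M. norm (grad (ph k) x) powr p) \<le> 2 powr p * (1 + B)" for k
  proof -
    have "(LINT x|M. norm ((grad (ph k) x - g k x) + g k x) powr p) \<le> 2 powr p * ((LINT x|M. norm (grad (ph k) x - g k x) powr p) + (LINT x|M. norm (g k x) powr p))"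
      by (rule Lp_triangle(2)) (use md(2,4)[of k k] mv(2,4)[of k] in auto)
    also have "\<dots> \<le> 2 powr p * (1 + B)"
      using gB[of k] by (intro mult_left_mono add_mono a1) auto
    finally show ?thesis by simp
  qed
  have "\<exists>rho. strict_mono (rho::nat\<Rightarrow>nat) \<and> (\<forall>e>0. \<exists>N. \<forall>i\<ge>N. \<forall>j\<ge>N. (LINT x|M. \<bar>ph (rho i) x - ph (rho j) x\<bar> powr p) < e)"
  proof (rule Rellich_C1c[OF dim p w(1,2) C B1 B2])
    fix rho :: "nat \<Rightarrow> nat" assume r1: "strict_mono rho"
      and r2: "\<And>e. e > 0 \<Longrightarrow> \<exists>N. \<forall>i\<ge>N. \<forall>j\<ge>N. (LINT x|M. \<bar>ph (rho i) x - ph (rho j) x\<bar> powr p) < e"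
    show ?thesis by (rule exI[of _ rho], rule conjI, rule r1, rule allI, rule impI, rule r2)
  qed
  then obtain rho where rho: "strict_mono (rho::nat\<Rightarrow>nat)"
    "\<forall>e>0. \<exists>N. \<forall>i\<ge>N. \<forall>j\<ge>N. (LINT x|M. \<bar>ph (rho i) x - ph (rho j) x\<bar> powr p) < e"
    by (elim exE conjE)
  let ?P = "sequentially \<times>\<^sub>F (sequentially :: nat filter)"
  have lp: "((\<lambda>z. LINT x|M. norm (ph (rho (fst z)) x - ph (rho (snd z)) x) powr p) \<longlongrightarrow> 0) ?P"
  proof (rule tendstoI)
    fix e :: real assume "0 < e"
    then obtain N where N: "\<forall>i\<ge>N. \<forall>j\<ge>N. (LINT x|M. \<bar>ph (rho i) x - ph (rho j) x\<bar> powr p) < e" using rho(2) by blast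
    have nn: "0 \<le> (LINT x|M. \<bar>ph (rho i) x - ph (rho j) x\<bar> powr p)" for i j by (rule integral_nonneg_AE) auto
    show "eventually (\<lambda>z. dist (LINT x|M. norm (ph (rho (fst z)) x - ph (rho (snd z)) x) powr p) 0 < e) ?P"
      unfolding eventually_prod_sequentially using N nn by (intro exI[of _ N]) (auto simp: dist_real_def)
  qed
  have la': "(\<lambda>k. a (ph (rho k)) (rho k)) \<longlonglongrightarrow> 0"
    using LIMSEQ_subseq_LIMSEQ[OF la rho(1)] by (simp add: o_def)
  define U where "U z = 2 powr p * (2 powr p * (a (ph (rho (fst z))) (rho (fst z)) + a (ph (rho (snd z))) (rho (snd z)))
       + (LINT x|M. norm (ph (rho (fst z)) x - ph (rho (snd z)) x) powr p))" for z :: "nat \<times> nat"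
  have "(U \<longlongrightarrow> 2 powr p * (2 powr p * (0 + 0) + 0)) ?P"
    unfolding U_def by (intro tendsto_intros lp tendsto_pair_fst[OF la'])
  then have U0: "(U \<longlongrightarrow> 0) ?P" by simp
  have le: "(LINT x|M. \<bar>v (rho i) x - v (rho j) x\<bar> powr p) \<le> U (i, j)" for i j
  proof -
    let ?f = "\<lambda>x. (ph (rho j) x - v (rho j) x) - (ph (rho i) x - v (rho i) x)" and ?h = "\<lambda>x. ph (rho i) x - ph (rho j) x"
    have Wf: "W0 p w ?f (\<lambda>x. (grad (ph (rho j)) x - g (rho j) x) - (grad (ph (rho i)) x - g (rho i) x))"
      by (intro W0_diff w p0 Wp Wv)
    have Wh: "W0 p w ?h (\<lambda>x. grad (ph (rho i)) x - grad (ph (rho j)) x)"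
      by (intro W0_diff w p0 Wp)
    have "(LINT x|M. \<bar>v (rho i) x - v (rho j) x\<bar> powr p) = (LINT x|M. norm (?f x + ?h x) powr p)"
      by (intro Bochner_Integration.integral_cong) (auto simp: algebra_simps)
    also have "\<dots> \<le> 2 powr p * ((LINT x|M. norm (?f x) powr p) + (LINT x|M. norm (?h x) powr p))"
      by (rule Lp_triangle(2)) (use W0_D[OF Wf] W0_D[OF Wh] in auto)
    also have "(LINT x|M. norm (?f x) powr p) \<le> 2 powr p * ((LINT x|M. norm (ph (rho j) x - v (rho j) x) powr p) + (LINT x|M. norm (ph (rho i) x - v (rho i) x) powr p))"
      by (rule Lp_triangle(1)) (use md(1,3)[of "rho i" "rho i"] md(1,3)[of "rho j" "rho j"] in auto)
    finally show ?thesis by (simp add: U_def a_def add.commute mult_left_mono)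
  qed
  have "((\<lambda>z. LINT x|M. \<bar>v (rho (fst z)) x - v (rho (snd z)) x\<bar> powr p) \<longlongrightarrow> 0) ?P"
  proof (rule tendsto_sandwich[OF _ _ tendsto_const U0])
    show "eventually (\<lambda>z. 0 \<le> (LINT x|M. \<bar>v (rho (fst z)) x - v (rho (snd z)) x\<bar> powr p)) ?P"
      by (auto intro!: always_eventually integral_nonneg_AE)
    show "eventually (\<lambda>z. (LINT x|M. \<bar>v (rho (fst z)) x - v (rho (snd z)) x\<bar> powr p) \<le> U z) ?P"
      using le by (intro always_eventually) (metis prod.collapse)
  qed
  then show thesis using la lb by (intro that[OF ph _ _ rho(1)]) (auto simp: a_def b_def)
qed

text \<open>The test functions close to v_k also approach the limit. The weak gradient identity
  survives because L^p convergence on a set of finite measure gives L^1 convergence, and the test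
  factors are bounded.\<close>

lemma W1p0_limit:
  assumes W: "\<And>k. W1p0 p w (v k) (g k)"
    and u[measurable]: "u \<in> borel_measurable M" and ui: "integrable M (\<lambda>x. \<bar>u x\<bar> powr p)"
    and l[measurable]: "l \<in> borel_measurable M" and li: "integrable M (\<lambda>x. norm (l x) powr p)"
    and vu: "(\<lambda>k. LINT x|M. \<bar>v k x - u x\<bar> powr p) \<longlonglongrightarrow> 0" and gl: "(\<lambda>k. LINT x|M. norm (g k x - l x) powr p) \<longlonglongrightarrow> 0"
    and ph: "\<And>k. test_fun w (ph k)" and pv: "(\<lambda>k. LINT x|M. \<bar>ph k x - v k x\<bar> powr p) \<longlonglongrightarrow> 0"
    and pg: "(\<lambda>k. LINT x|M. norm (grad (ph k) x - g k x) powr p) \<longlonglongrightarrow> 0"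
  shows "W1p0 p w u l"
proof -
  have Wv: "W0 p w (v k) (g k)" for k by (rule W1p0_W0[OF W])
  have Wp: "W0 p w (ph k) (grad (ph k))" for k by (rule C1c_W0[OF test_fun_C1c[OF ph] w(1) p0(1)])
  note [measurable] = W0_D(1,2)[OF Wv] W0_D(1,2)[OF Wp]
  have ivu: "integrable M (\<lambda>x. norm (v k x - u x) powr p)" for k
    using W0_D[OF Wv, of k] ui by (intro integrable_norm_powr_diff p0) auto
  have iuv: "integrable M (\<lambda>x. norm (u x - v k x) powr p)" for k
    using ivu[of k] by (simp only: norm_minus_commute)
  have igl: "integrable M (\<lambda>x. norm (g k x - l x) powr p)" for k
    using W0_D[OF Wv, of k] li by (intro integrable_norm_powr_diff p0) auto
  have ilg: "integrable M (\<lambda>x. norm (l x - g k x) powr p)" for k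
    using igl[of k] by (simp only: norm_minus_commute)
  have md: "integrable M (\<lambda>x. norm (ph k x - v k x) powr p)" "integrable M (\<lambda>x. norm (grad (ph k) x - g k x) powr p)" for k
    using W0_D[OF W0_diff[OF w(1) p0(1) Wp[of k] Wv[of k]]] by auto
  have "(\<lambda>k. LINT x|M. norm ((ph k x - v k x) - (u x - v k x)) powr p) \<longlonglongrightarrow> 0"
    by (rule Lp_tendsto_diff[OF _ _ p0(2) md(1) iuv]) (use pv vu in \<open>auto simp: abs_minus_commute\<close>)
  then have c1: "(\<lambda>k. LINT x|M. \<bar>ph k x - u x\<bar> powr p) \<longlonglongrightarrow> 0" by simp
  have "(\<lambda>k. LINT x|M. norm ((grad (ph k) x - g k x) - (l x - g k x)) powr p) \<longlonglongrightarrow> 0"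
    by (rule Lp_tendsto_diff[OF _ _ p0(2) md(2) ilg]) (use pg gl in \<open>auto simp: norm_minus_commute\<close>)
  then have c2: "(\<lambda>k. LINT x|M. norm (grad (ph k) x - l x) powr p) \<longlonglongrightarrow> 0" by simp
  have L1v: "(\<lambda>k. LINT x|M. \<bar>v k x - u x\<bar>) \<longlonglongrightarrow> 0" and iv1: "\<And>k. integrable M (\<lambda>x. \<bar>v k x - u x\<bar>)"
    using Lp_tendsto_L1[of "\<lambda>k x. \<bar>v k x - u x\<bar>" p sequentially] ivu vu p by auto
  have L1g: "(\<lambda>k. LINT x|M. norm (g k x - l x)) \<longlonglongrightarrow> 0" and ig1: "\<And>k. integrable M (\<lambda>x. norm (g k x - l x))"
    using Lp_tendsto_L1[of "\<lambda>k x. norm (g k x - l x)" p sequentially] igl gl p by auto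
  have one: "integrable M f" if "f \<in> borel_measurable M" "integrable M (\<lambda>x. norm (f x) powr p)" for f :: "'a \<Rightarrow> real"
    by (rule Bochner_Integration.integrable_bound[of M "\<lambda>x. 1 + norm (f x) powr p"]) (use that powr_le_one_add[of "\<bar>f _\<bar>" p] p in auto)
  have lim_test: "(\<lambda>k. LINT x|M. f k x * psi x) \<longlonglongrightarrow> (LINT x|M. f0 x * psi x)"
    if [measurable]: "\<And>k. f k \<in> borel_measurable M" "f0 \<in> borel_measurable M" "psi \<in> borel_measurable M"
      and fi: "\<And>k. integrable M (f k)" "integrable M f0" and l1: "(\<lambda>k. LINT x|M. \<bar>f k x - f0 x\<bar>) \<longlonglongrightarrow> 0"
      and K: "\<And>x. \<bar>psi x\<bar> \<le> K" for f :: "nat \<Rightarrow> 'a \<Rightarrow> real" and f0 psi K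
  proof (rule Lim_null[THEN iffD2], rule tendsto_rabs_zero_cancel, rule tendsto_sandwich[OF _ _ tendsto_const])
    have K0: "0 \<le> K" using K[of undefined] abs_ge_zero order_trans by blast
    have ib: "integrable M (\<lambda>x. h x * psi x)" if "integrable M h" for h :: "'a \<Rightarrow> real"
    proof (rule Bochner_Integration.integrable_bound[OF integrable_mult_right[OF that, of K]])
      have "h \<in> borel_measurable M" using that by auto
      then show "(\<lambda>x. h x * psi x) \<in> borel_measurable M" by measurable
      show "AE x in M. norm (h x * psi x) \<le> norm (K * h x)"
        using K K0 by (intro AE_I2) (simp add: abs_mult mult.commute[of K] mult_left_mono)
    qed
    show "(\<lambda>k. K * (LINT x|M. \<bar>f k x - f0 x\<bar>)) \<longlonglongrightarrow> 0" using tendsto_mult_left[OF l1, of K] by simp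
    show "eventually (\<lambda>k. 0 \<le> \<bar>(LINT x|M. f k x * psi x) - (LINT x|M. f0 x * psi x)\<bar>) sequentially" by simp
    have "\<bar>(LINT x|M. f k x * psi x) - (LINT x|M. f0 x * psi x)\<bar> \<le> K * (LINT x|M. \<bar>f k x - f0 x\<bar>)" for k
    proof -
      have "(LINT x|M. f k x * psi x) - (LINT x|M. f0 x * psi x) = (LINT x|M. (f k x - f0 x) * psi x)"
        using ib[OF fi(1)] ib[OF fi(2)] by (simp add: left_diff_distrib)
      also have "\<bar>\<dots>\<bar> \<le> (LINT x|M. \<bar>(f k x - f0 x) * psi x\<bar>)" by (rule integral_abs_bound)
      also have "\<dots> \<le> (LINT x|M. K * \<bar>f k x - f0 x\<bar>)"
      proof (rule integral_mono')
        show "integrable M (\<lambda>x. K * \<bar>f k x - f0 x\<bar>)" using fi by auto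
        show "\<bar>(f k x - f0 x) * psi x\<bar> \<le> K * \<bar>f k x - f0 x\<bar>" for x
          using K by (simp add: abs_mult mult.commute[of K] mult_left_mono)
        show "0 \<le> K * \<bar>f k x - f0 x\<bar>" for x using K0 by simp
      qed
      finally show ?thesis by simp
    qed
    then show "eventually (\<lambda>k. \<bar>(LINT x|M. f k x * psi x) - (LINT x|M. f0 x * psi x)\<bar> \<le> K * (LINT x|M. \<bar>f k x - f0 x\<bar>)) sequentially"
      by (intro always_eventually) auto
  qed
  have "weak_grad w u l"
    unfolding weak_grad_def
  proof (intro allI impI ballI)
    fix phi and b :: 'a assume phi: "test_fun w phi" and b: "b \<in> Basis"
    note C = test_fun_C1c[OF phi]
    obtain K where K: "0 \<le> K" "\<And>x. \<bar>phi x\<bar> \<le> K" "\<And>x. norm (grad phi x) \<le> K" using C1c_bounded[OF C] by blast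
    have pdg: "pd b phi x = grad phi x \<bullet> b" for x
    proof -
      have "grad phi x \<bullet> b = (\<Sum>c\<in>Basis. if c = b then pd b phi x else 0)"
        unfolding grad_def inner_sum_left using b by (intro sum.cong) (auto simp: inner_Basis)
      then show ?thesis using b by (simp add: sum.delta)
    qed
    have mph[measurable]: "phi \<in> borel_measurable M" "grad phi \<in> borel_measurable M"
      using C1c_Lp[OF C w(1) p0(1)] by (auto simp: Lp_fun_def Lp_vec_def)
    have Kb: "\<bar>pd b phi x\<bar> \<le> K" for x
      unfolding pdg using Basis_le_norm[OF b, of "grad phi x"] K(3)[of x] by linarith
    have vi: "integrable M (v k)" for k by (rule one[OF W0_D(1)[OF Wv]]) (use W0_D(3)[OF Wv, of k] in simp)
    have uI: "integrable M u" by (rule one[OF u]) (use ui in simp)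
    have gI: "integrable M (\<lambda>x. f x \<bullet> b)" if [measurable]: "f \<in> borel_measurable M" and fi: "integrable M (\<lambda>x. norm (f x) powr p)" for f :: "'a \<Rightarrow> 'a"
    proof (rule Bochner_Integration.integrable_bound[of M "\<lambda>x. 1 + norm (f x) powr p"])
      show "AE x in M. norm (f x \<bullet> b) \<le> norm (1 + norm (f x) powr p)"
      proof (rule AE_I2)
        fix x
        show "norm (f x \<bullet> b) \<le> norm (1 + norm (f x) powr p)"
          using Basis_le_norm[OF b, of "f x"] powr_le_one_add[of "norm (f x)" p] p by simp
      qed
    qed (use fi in auto)
    have t1: "(\<lambda>k. LINT x|M. v k x * pd b phi x) \<longlonglongrightarrow> (LINT x|M. u x * pd b phi x)"
      by (rule lim_test[OF _ _ _ vi uI L1v Kb]) (auto simp: pdg)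
    have "(\<lambda>k. LINT x|M. \<bar>g k x \<bullet> b - l x \<bullet> b\<bar>) \<longlonglongrightarrow> 0"
    proof (rule tendsto_sandwich[OF _ _ tendsto_const L1g])
      have "(LINT x|M. \<bar>g k x \<bullet> b - l x \<bullet> b\<bar>) \<le> (LINT x|M. norm (g k x - l x))" for k
        by (rule integral_mono'[OF ig1]) (use Basis_le_norm[OF b] in \<open>auto simp: inner_diff_left[symmetric]\<close>)
      then show "eventually (\<lambda>k. (LINT x|M. \<bar>g k x \<bullet> b - l x \<bullet> b\<bar>) \<le> (LINT x|M. norm (g k x - l x))) sequentially"
        by (intro always_eventually) auto
      show "eventually (\<lambda>k. 0 \<le> (LINT x|M. \<bar>g k x \<bullet> b - l x \<bullet> b\<bar>)) sequentially"
        by (auto intro!: always_eventually integral_nonneg_AE)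
    qed
    then have t2: "(\<lambda>k. LINT x|M. (g k x \<bullet> b) * phi x) \<longlonglongrightarrow> (LINT x|M. (l x \<bullet> b) * phi x)"
      by (intro lim_test[OF _ _ _ gI gI _ K(2)]) (use W0_D[OF Wv] li in auto)
    have "(LINT x|M. v k x * pd b phi x) = - (LINT x|M. (g k x \<bullet> b) * phi x)" for k
      using W[of k] phi b by (auto simp: W1p0_def W1p_def weak_grad_def)
    then show "(LINT x|M. u x * pd b phi x) = - (LINT x|M. (l x \<bullet> b) * phi x)"
      using t1 tendsto_minus[OF t2] by (simp add: LIMSEQ_unique)
  qed
  then show ?thesis
    unfolding W1p0_def W1p_def Lp_fun_def Lp_vec_def using ui li ph c1 c2 by (intro conjI exI[of _ ph]) auto
qed

section \<open>Closedness of the set of eigenvalues\<close>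

text \<open>The fluxes are bounded in L^s with s = p / (p - 1) > 1 and converge almost everywhere;
  together this gives L^1 convergence, which is enough against a bounded gradient.\<close>

lemma flux_tendsto_integral:
  assumes W: "\<And>k. W0 p w (v k) (g k)" and gB: "\<And>k. (LINT x|M. norm (g k x) powr p) \<le> B"
    and Wu: "W0 p w u l" and lim: "AE x in M. (\<lambda>k. g k x) \<longlonglongrightarrow> l x" and phi: "test_fun w phi"
  shows "(\<lambda>k. LINT x|M. A x (g k x) \<bullet> grad phi x) \<longlonglongrightarrow> (LINT x|M. A x (l x) \<bullet> grad phi x)"
proof -
  define s where "s = p / (p - 1)"
  have s: "1 < s" "0 \<le> s" "(p - 1) * s = p" using p by (auto simp: s_def field_simps)
  note m = W0_D[OF W] and ml = W0_D[OF Wu]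
  note [measurable] = m(2) ml(2) flux_measurable[OF m(2)] flux_measurable[OF ml(2)]
  define h where "h k x = norm (A x (g k x) - A x (l x))" for k x
  have [measurable]: "h k \<in> borel_measurable M" for k unfolding h_def by measurable
  define K2 where "K2 = 2 powr s * (nu powr p) powr s"
  have hs: "AE x in M. h k x powr s \<le> K2 * (norm (g k x) powr p + norm (l x) powr p)" for k
    using norms
  proof eventually_elim
    case (elim x)
    have b: "norm (A x xi) powr s \<le> (nu powr p) powr s * norm xi powr p" for xi
    proof -
      have "norm (A x xi) powr s \<le> (nu powr p * norm xi powr (p - 1)) powr s"
        using s by (intro powr_mono2 finsler_norm.norm_flux_le[OF elim]) auto
      also have "\<dots> = (nu powr p) powr s * norm xi powr p" by (simp add: powr_mult powr_powr s(3))
      finally show ?thesis .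
    qed
    have "h k x powr s \<le> 2 powr s * (norm (A x (g k x)) powr s + norm (A x (l x)) powr s)"
      unfolding h_def by (rule norm_diff_powr_le[OF s(2)])
    also have "\<dots> \<le> 2 powr s * ((nu powr p) powr s * norm (g k x) powr p + (nu powr p) powr s * norm (l x) powr p)"
      by (intro mult_left_mono add_mono b) auto
    finally show ?case by (simp add: K2_def algebra_simps)
  qed
  have ib: "integrable M (\<lambda>x. K2 * (norm (g k x) powr p + norm (l x) powr p))" for k using m(4) ml(4) by auto
  have ih: "integrable M (\<lambda>x. h k x powr s)" for k
    by (rule Bochner_Integration.integrable_bound[OF ib[of k]]) (use hs[of k] in \<open>auto elim!: eventually_mono\<close>)
  have Bh: "(LINT x|M. h k x powr s) \<le> K2 * (B + (LINT x|M. norm (l x) powr p))" for k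
  proof -
    have "(LINT x|M. h k x powr s) \<le> (LINT x|M. K2 * (norm (g k x) powr p + norm (l x) powr p))"
      by (rule integral_mono_AE[OF ih ib hs])
    also have "\<dots> = K2 * ((LINT x|M. norm (g k x) powr p) + (LINT x|M. norm (l x) powr p))" using m(4) ml(4) by simp
    also have "\<dots> \<le> K2 * (B + (LINT x|M. norm (l x) powr p))" using gB by (intro mult_left_mono add_mono) (auto simp: K2_def)
    finally show ?thesis .
  qed
  have hl: "AE x in M. (\<lambda>k. h k x) \<longlonglongrightarrow> 0"
    using lim norms
  proof eventually_elim
    case (elim x)
    have "(\<lambda>k. A x (g k x)) \<longlonglongrightarrow> A x (l x)" by (rule filterlim_compose[OF finsler_norm.tendsto_flux[OF elim(2)] elim(1)])
    then have "(\<lambda>k. h k x) \<longlonglongrightarrow> norm (A x (l x) - A x (l x))" unfolding h_def by (intro tendsto_intros)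
    then show ?case by simp
  qed
  have hnn: "0 \<le> h k x" for k x by (simp add: h_def)
  have W1: "integrable M (\<lambda>_. 1 :: real)" "\<And>x::'a. 0 \<le> (1::real)" by simp_all
  have ih1: "integrable M (\<lambda>x. 1 * h k x powr s)" for k using ih by simp
  have Bh1: "(LINT x|M. 1 * h k x powr s) \<le> K2 * (B + (LINT x|M. norm (l x) powr p))" for k using Bh by simp
  note T = tendsto_L1_of_AE_bounded_powr[OF W1 \<open>\<And>k. h k \<in> borel_measurable M\<close> hnn hl s(1) ih1 Bh1]
  note hi = T(1) and h0 = T(2)
  obtain K where K: "0 \<le> K" "\<And>x. norm (grad phi x) \<le> K" "\<And>x. \<bar>phi x\<bar> \<le> K"
    using C1c_bounded[OF test_fun_C1c[OF phi]] by metis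
  have Wp: "W0 p w phi (grad phi)" by (rule C1c_W0[OF test_fun_C1c[OF phi] w(1) p0(1)])
  have ip: "integrable M (\<lambda>x. A x (g k x) \<bullet> grad phi x)" "integrable M (\<lambda>x. A x (l x) \<bullet> grad phi x)" for k
    by (rule pairing_integrable(1)[OF W Wp], rule pairing_integrable(1)[OF Wu Wp])
  have bound: "\<bar>(LINT x|M. A x (g k x) \<bullet> grad phi x) - (LINT x|M. A x (l x) \<bullet> grad phi x)\<bar> \<le> K * (LINT x|M. 1 * h k x)" for k
  proof -
    have "(LINT x|M. A x (g k x) \<bullet> grad phi x) - (LINT x|M. A x (l x) \<bullet> grad phi x) = (LINT x|M. (A x (g k x) - A x (l x)) \<bullet> grad phi x)"
      using ip by (simp add: inner_diff_left)
    also have "\<bar>\<dots>\<bar> \<le> (LINT x|M. \<bar>(A x (g k x) - A x (l x)) \<bullet> grad phi x\<bar>)" by (rule integral_abs_bound)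
    also have "\<dots> \<le> (LINT x|M. K * (1 * h k x))"
    proof (rule integral_mono')
      show "integrable M (\<lambda>x. K * (1 * h k x))" using hi[of k] by simp
      fix x
      have "\<bar>(A x (g k x) - A x (l x)) \<bullet> grad phi x\<bar> \<le> h k x * norm (grad phi x)" unfolding h_def by (rule Cauchy_Schwarz_ineq2)
      also have "\<dots> \<le> h k x * K" using K(2) by (intro mult_left_mono) (auto simp: h_def)
      finally show "\<bar>(A x (g k x) - A x (l x)) \<bullet> grad phi x\<bar> \<le> K * (1 * h k x)" by (simp add: mult.commute)
      show "0 \<le> K * (1 * h k x)" using K by (simp add: h_def)
    qed
    finally show ?thesis by simp
  qed
  have z: "(\<lambda>k. K * (LINT x|M. 1 * h k x)) \<longlonglongrightarrow> 0" using tendsto_mult_left[OF h0, of K] by simp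
  have "(\<lambda>k. (LINT x|M. A x (g k x) \<bullet> grad phi x) - (LINT x|M. A x (l x) \<bullet> grad phi x)) \<longlonglongrightarrow> 0"
    by (rule Lim_null_comparison[OF always_eventually z], unfold real_norm_def, rule allI, rule bound)
  then show ?thesis by (rule LIM_zero_cancel)
qed

text \<open>The flux argument with the weight |V| + 1: the signed power has degree p - 1 and is
  bounded in weighted L^s with s = p / (p - 1). The moving eigenvalue adds a term proportional to
  its distance from the limit.\<close>

lemma reaction_tendsto_integral:
  assumes W: "\<And>k. W0 p w (v k) (g k)" and vB: "\<And>k. (LINT x|M. wt x * \<bar>v k x\<bar> powr p) \<le> B"
    and Wu: "W0 p w u l" and lim: "AE x in M. (\<lambda>k. v k x) \<longlonglongrightarrow> u x" and phi: "test_fun w phi"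
    and lam: "mu \<longlonglongrightarrow> lam" and mu: "\<And>k. \<bar>mu k\<bar> \<le> L"
  shows "(\<lambda>k. LINT x|M. (V x - mu k) * (\<bar>v k x\<bar> powr (p - 2)) * v k x * phi x)
     \<longlonglongrightarrow> (LINT x|M. (V x - lam) * (\<bar>u x\<bar> powr (p - 2)) * u x * phi x)"
proof -
  define s where "s = p / (p - 1)"
  have s: "1 < s" "0 \<le> s" "(p - 1) * s = p" using p by (auto simp: s_def field_simps)
  note m = W0_D[OF W] and mu' = W0_D[OF Wu]
  note [measurable] = m(1) mu'(1)
  define F where "F a = \<bar>a\<bar> powr (p - 2) * a" for a :: real
  have Fs: "\<bar>F a\<bar> powr s = \<bar>a\<bar> powr p" for a unfolding F_def abs_signed_powr by (simp add: powr_powr s(3))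
  define h where "h k x = \<bar>F (v k x) - F (u x)\<bar>" for k x
  have [measurable]: "h k \<in> borel_measurable M" for k unfolding h_def F_def by measurable
  note iv = W0_weight[OF W] and iu = W0_weight[OF Wu]
  have hs: "wt x * h k x powr s \<le> 2 powr s * (wt x * \<bar>v k x\<bar> powr p + wt x * \<bar>u x\<bar> powr p)" for k x
  proof -
    have "h k x powr s \<le> 2 powr s * (\<bar>v k x\<bar> powr p + \<bar>u x\<bar> powr p)"
      using norm_diff_powr_le[OF s(2), of "F (v k x)" "F (u x)"] unfolding real_norm_def Fs h_def .
    from mult_left_mono[OF this wt_ge(2)[of x]] show ?thesis by (simp add: algebra_simps)
  qed
  have ib: "integrable M (\<lambda>x. 2 powr s * (wt x * \<bar>v k x\<bar> powr p + wt x * \<bar>u x\<bar> powr p))" for k using iv iu by auto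
  have ih: "integrable M (\<lambda>x. wt x * h k x powr s)" for k
  proof (rule Bochner_Integration.integrable_bound[OF ib[of k]])
    show "AE x in M. norm (wt x * h k x powr s) \<le> norm (2 powr s * (wt x * \<bar>v k x\<bar> powr p + wt x * \<bar>u x\<bar> powr p))"
      using hs[of _ k] wt_ge(2) by (intro AE_I2) (simp only: real_norm_def abs_of_nonneg mult_nonneg_nonneg add_nonneg_nonneg powr_ge_zero)
  qed measurable
  have Bh: "(LINT x|M. wt x * h k x powr s) \<le> 2 powr s * (B + (LINT x|M. wt x * \<bar>u x\<bar> powr p))" for k
  proof -
    have "(LINT x|M. wt x * h k x powr s) \<le> (LINT x|M. 2 powr s * (wt x * \<bar>v k x\<bar> powr p + wt x * \<bar>u x\<bar> powr p))"
      by (rule integral_mono[OF ih ib hs])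
    also have "\<dots> = 2 powr s * ((LINT x|M. wt x * \<bar>v k x\<bar> powr p) + (LINT x|M. wt x * \<bar>u x\<bar> powr p))" using iv iu by simp
    also have "\<dots> \<le> 2 powr s * (B + (LINT x|M. wt x * \<bar>u x\<bar> powr p))" using vB by (intro mult_left_mono add_mono) auto
    finally show ?thesis .
  qed
  have hl: "AE x in M. (\<lambda>k. h k x) \<longlonglongrightarrow> 0"
    using lim
  proof eventually_elim
    case (elim x)
    have "(\<lambda>k. F (v k x)) \<longlonglongrightarrow> F (u x)" unfolding F_def by (rule tendsto_signed_powr[OF p elim])
    then have "(\<lambda>k. h k x) \<longlonglongrightarrow> \<bar>F (u x) - F (u x)\<bar>" unfolding h_def by (intro tendsto_intros)
    then show ?case by simp
  qed
  have hnn: "0 \<le> h k x" for k x by (simp add: h_def)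
  note T = tendsto_L1_of_AE_bounded_powr[OF wt_integrable wt_ge(2) \<open>\<And>k. h k \<in> borel_measurable M\<close> hnn hl s(1) ih Bh]
  obtain K where K: "0 \<le> K" "\<And>x. \<bar>phi x\<bar> \<le> K" "\<And>x. norm (grad phi x) \<le> K"
    using C1c_bounded[OF test_fun_C1c[OF phi]] by metis
  have Wp: "W0 p w phi (grad phi)" by (rule C1c_W0[OF test_fun_C1c[OF phi] w(1) p0(1)])
  let ?Z = "LINT x|M. wt x * (\<bar>u x\<bar> powr (p - 1) * \<bar>phi x\<bar>)"
  have iZ: "integrable M (\<lambda>x. wt x * (\<bar>u x\<bar> powr (p - 1) * \<bar>phi x\<bar>))" by (rule weighted_product[OF Wu Wp])
  have L: "0 \<le> L" using mu[of 0] abs_ge_zero order_trans by blast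
  let ?a = "\<lambda>k x. (V x - mu k) * (\<bar>v k x\<bar> powr (p - 2)) * v k x * phi x" and ?b = "\<lambda>x. (V x - lam) * (\<bar>u x\<bar> powr (p - 2)) * u x * phi x"
  have ia: "integrable M (?a k)" for k by (rule pairing_integrable(2)[OF W Wp])
  have ibb: "integrable M ?b" by (rule pairing_integrable(2)[OF Wu Wp])
  have bound: "\<bar>integral\<^sup>L M (?a k) - integral\<^sup>L M ?b\<bar> \<le> (1 + L) * K * (LINT x|M. wt x * h k x) + \<bar>mu k - lam\<bar> * ?Z" for k
  proof -
    have pw: "\<bar>?a k x - ?b x\<bar> \<le> (1 + L) * K * (wt x * h k x) + \<bar>mu k - lam\<bar> * (wt x * (\<bar>u x\<bar> powr (p - 1) * \<bar>phi x\<bar>))" for x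
    proof -
      \<comment> \<open>One part compares signed powers, with a coefficient bounded by the weight;
        the other is the error in the eigenvalue.\<close>
      have "?a k x - ?b x = (V x - mu k) * (F (v k x) - F (u x)) * phi x + (lam - mu k) * F (u x) * phi x"
        by (simp add: F_def algebra_simps)
      then have "\<bar>?a k x - ?b x\<bar> \<le> \<bar>(V x - mu k) * (F (v k x) - F (u x)) * phi x\<bar> + \<bar>(lam - mu k) * F (u x) * phi x\<bar>"
        by (simp only: abs_triangle_ineq)
      moreover have "\<bar>(V x - mu k) * (F (v k x) - F (u x)) * phi x\<bar> \<le> (1 + L) * K * (wt x * h k x)"
      proof -
        have "\<bar>V x - mu k\<bar> \<le> (1 + L) * wt x"
          using V_diff_le[of x "mu k"] mult_right_mono[OF mu[of k] wt_ge(2)[of x]] by (simp add: algebra_simps)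
        then have "\<bar>V x - mu k\<bar> * h k x * \<bar>phi x\<bar> \<le> ((1 + L) * wt x) * h k x * K"
          using K wt_ge(2)[of x] hnn L by (intro mult_mono) auto
        then show ?thesis by (simp add: abs_mult h_def mult_ac)
      qed
      moreover have "\<bar>(lam - mu k) * F (u x) * phi x\<bar> \<le> \<bar>mu k - lam\<bar> * (wt x * (\<bar>u x\<bar> powr (p - 1) * \<bar>phi x\<bar>))"
      proof -
        have "\<bar>(lam - mu k) * F (u x) * phi x\<bar> = \<bar>mu k - lam\<bar> * (1 * (\<bar>u x\<bar> powr (p - 1) * \<bar>phi x\<bar>))"
          unfolding F_def abs_mult[of "_ * _"] abs_mult[of "lam - mu k"] abs_signed_powr by (simp add: abs_minus_commute)
        also have "\<dots> \<le> \<bar>mu k - lam\<bar> * (wt x * (\<bar>u x\<bar> powr (p - 1) * \<bar>phi x\<bar>))"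
          using wt_ge(1)[of x] by (intro mult_left_mono mult_right_mono) auto
        finally show ?thesis .
      qed
      ultimately show ?thesis by linarith
    qed
    have i1: "integrable M (\<lambda>x. (1 + L) * K * (wt x * h k x))" by (rule integrable_mult_right[OF T(1)])
    have i2: "integrable M (\<lambda>x. \<bar>mu k - lam\<bar> * (wt x * (\<bar>u x\<bar> powr (p - 1) * \<bar>phi x\<bar>)))" by (rule integrable_mult_right[OF iZ])
    have iab: "integrable M (\<lambda>x. ?a k x - ?b x)" by (rule Bochner_Integration.integrable_diff[OF ia ibb])
    have e: "integral\<^sup>L M (?a k) - integral\<^sup>L M ?b = (LINT x|M. ?a k x - ?b x)"
      by (rule Bochner_Integration.integral_diff[OF ia ibb, symmetric])
    have f1: "\<bar>LINT x|M. ?a k x - ?b x\<bar> \<le> (LINT x|M. \<bar>?a k x - ?b x\<bar>)" by (rule integral_abs_bound)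
    have f2: "(LINT x|M. \<bar>?a k x - ?b x\<bar>) \<le> (LINT x|M. (1 + L) * K * (wt x * h k x) + \<bar>mu k - lam\<bar> * (wt x * (\<bar>u x\<bar> powr (p - 1) * \<bar>phi x\<bar>)))"
    proof (rule integral_mono)
      show "integrable M (\<lambda>x. \<bar>?a k x - ?b x\<bar>)" by (rule integrable_abs[OF iab])
      show "integrable M (\<lambda>x. (1 + L) * K * (wt x * h k x) + \<bar>mu k - lam\<bar> * (wt x * (\<bar>u x\<bar> powr (p - 1) * \<bar>phi x\<bar>)))"
        by (rule Bochner_Integration.integrable_add[OF i1 i2])
      show "\<bar>?a k x - ?b x\<bar> \<le> (1 + L) * K * (wt x * h k x) + \<bar>mu k - lam\<bar> * (wt x * (\<bar>u x\<bar> powr (p - 1) * \<bar>phi x\<bar>))" for x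
        by (rule pw)
    qed
    have f3: "(LINT x|M. (1 + L) * K * (wt x * h k x) + \<bar>mu k - lam\<bar> * (wt x * (\<bar>u x\<bar> powr (p - 1) * \<bar>phi x\<bar>)))
      = (1 + L) * K * (LINT x|M. wt x * h k x) + \<bar>mu k - lam\<bar> * ?Z"
      unfolding Bochner_Integration.integral_add[OF i1 i2] integral_mult_right_zero ..
    show ?thesis unfolding e f3[symmetric] by (rule order_trans[OF f1 f2])
  qed
  have "(\<lambda>k. (1 + L) * K * (LINT x|M. wt x * h k x) + \<bar>mu k - lam\<bar> * ?Z) \<longlonglongrightarrow> (1 + L) * K * 0 + \<bar>lam - lam\<bar> * ?Z"
    by (intro tendsto_intros T(2) lam)
  then have z: "(\<lambda>k. (1 + L) * K * (LINT x|M. wt x * h k x) + \<bar>mu k - lam\<bar> * ?Z) \<longlonglongrightarrow> 0" by simp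
  have "(\<lambda>k. integral\<^sup>L M (?a k) - integral\<^sup>L M ?b) \<longlonglongrightarrow> 0"
    by (rule Lim_null_comparison[OF always_eventually z], unfold real_norm_def, rule allI, rule bound)
  then show ?thesis by (rule LIM_zero_cancel)
qed

text \<open>Compactness, the gap argument and almost everywhere convergence each pass to a further
  subsequence; \<open>sg\<close> is the composition along which all the limits hold at once.\<close>

lemma eigenvalue_limit:
  assumes ev: "\<And>k. is_eigenvalue H p V w (mu k)" and lam: "mu \<longlonglongrightarrow> lam"
  shows "is_eigenvalue H p V w lam"
proof -
  define Q where "Q k vg \<longleftrightarrow> W1p0 p w (fst vg) (snd vg) \<and> (LINT x|M. \<bar>fst vg x\<bar> powr p) = 1 \<and>
    (\<forall>phi. test_fun w phi \<longrightarrow> pairing (fst vg) (snd vg) (mu k) phi (grad phi) = 0)" for k vg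
  have "\<exists>vg. Q k vg" for k
  proof (rule normalized_eigenfunction[OF ev[of k]])
    fix v g assume "W1p0 p w v g" "(LINT x|M. \<bar>v x\<bar> powr p) = 1" "\<And>phi. test_fun w phi \<Longrightarrow> pairing v g (mu k) phi (grad phi) = 0"
    then show ?thesis unfolding Q_def by (intro exI[of _ "(v, g)"]) simp
  qed
  then have "\<exists>vg. \<forall>k. Q k (vg k)" by (intro choice allI)
  then obtain vg where vg: "\<And>k. Q k (vg k)" by blast
  define v g where "v k = fst (vg k)" and "g k = snd (vg k)" for k
  have W: "W1p0 p w (v k) (g k)" and n1: "(LINT x|M. \<bar>v k x\<bar> powr p) = 1"
    and eq: "\<And>phi. test_fun w phi \<Longrightarrow> pairing (v k) (g k) (mu k) phi (grad phi) = 0" for k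
    using vg[of k] by (auto simp: Q_def v_def g_def)
  have Wv: "W0 p w (v k) (g k)" for k by (rule W1p0_W0[OF W])
  have "Bseq mu" using lam by (intro convergent_imp_Bseq) (auto simp: convergent_def)
  then obtain L where L: "0 < L" "\<And>k. \<bar>mu k\<bar> \<le> L" by (auto simp: Bseq_def)
  \<comment> \<open>With (1 + L) d = kappa^p / 2, half of the gradient integral is absorbed in the
    energy bound.\<close>
  define d where "d = kappa powr p / 2 / (1 + L)"
  have kp: "0 < kappa powr p" using kappa by simp
  have d: "0 < d" using kp L by (simp add: d_def)
  have cancel: "b * (a / b) = a" if "0 < b" for a b :: real using that by simp
  have Ld: "(1 + L) * d = kappa powr p / 2" unfolding d_def using L(1) by (intro cancel) simp
  obtain C where C: "0 \<le> C" "\<And>u g. W0 p w u g \<Longrightarrow>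
    (LINT x|M. wt x * \<bar>u x\<bar> powr p) \<le> d * (LINT x|M. norm (g x) powr p) + C * (LINT x|M. \<bar>u x\<bar> powr p)"
    using trace[OF d] by blast
  \<comment> \<open>The maximum with 1 lets one constant bound functions and gradients
    alike.\<close>
  define B where "B = max 1 (2 * (1 + L) * C / kappa powr p)"
  have gB: "(LINT x|M. norm (g k x) powr p) \<le> B" for k
  proof -
    define G where "G = (LINT x|M. norm (g k x) powr p)"
    have "0 \<le> (LINT x|M. wt x * \<bar>v k x\<bar> powr p)" using wt_ge(2) by (intro integral_nonneg_AE) auto
    then have "(1 + \<bar>mu k\<bar>) * (LINT x|M. wt x * \<bar>v k x\<bar> powr p) \<le> (1 + L) * (LINT x|M. wt x * \<bar>v k x\<bar> powr p)"
      using L(2)[of k] by (intro mult_right_mono) auto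
    also have "\<dots> \<le> (1 + L) * (d * G + C)" using C(2)[OF Wv, of k] n1[of k] L(1) by (intro mult_left_mono) (auto simp: G_def)
    finally have "kappa powr p * G \<le> (1 + L) * (d * G + C)"
      using energy_identity_bound[OF W n1 eq, of k] unfolding G_def by linarith
    also have "\<dots> = ((1 + L) * d) * G + (1 + L) * C" by (simp add: algebra_simps)
    also have "(1 + L) * d = kappa powr p / 2" by (fact Ld)
    finally have "kappa powr p * G \<le> 2 * (1 + L) * C" by (simp add: algebra_simps)
    then have "G \<le> 2 * (1 + L) * C / kappa powr p" using kp by (simp add: pos_le_divide_eq mult.commute)
    then show ?thesis by (simp add: B_def G_def)
  qed
  have vB: "(LINT x|M. \<bar>v k x\<bar> powr p) \<le> B" for k using n1 by (simp add: B_def)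
  define BW where "BW = d * B + C"
  have vW: "(LINT x|M. wt x * \<bar>v k x\<bar> powr p) \<le> BW" for k
    using C(2)[OF Wv, of k] n1[of k] mult_left_mono[OF gB[of k] less_imp_le[OF d]] by (simp add: BW_def)
  note m = W0_D[OF Wv]
  show ?thesis
  proof (rule Rellich_W1p0[OF W vB gB])
    fix ph and rho :: "nat \<Rightarrow> nat"
    assume ph: "\<And>k. test_fun w (ph k)" and pv: "(\<lambda>k. LINT x|M. \<bar>ph k x - v k x\<bar> powr p) \<longlonglongrightarrow> 0"
      and pg: "(\<lambda>k. LINT x|M. norm (grad (ph k) x - g k x) powr p) \<longlonglongrightarrow> 0" and rho: "strict_mono rho"
      and cau: "((\<lambda>z. LINT x|M. \<bar>v (rho (fst z)) x - v (rho (snd z)) x\<bar> powr p) \<longlongrightarrow> 0) (sequentially \<times>\<^sub>F sequentially)"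
    let ?P = "sequentially \<times>\<^sub>F (sequentially :: nat filter)"
    have Wd: "W0 p w (\<lambda>x. v (rho (fst z)) x - v (rho (snd z)) x) (\<lambda>x. g (rho (fst z)) x - g (rho (snd z)) x)" for z
      by (rule W0_diff[OF w(1) p0(1) Wv Wv])
    note md = W0_D[OF Wd] and wd = W0_weight[OF Wd]
    have gd: "(LINT x|M. norm (g (rho (fst z)) x - g (rho (snd z)) x) powr p) \<le> 2 powr p * (B + B)" for z
    proof -
      have "(LINT x|M. norm (g (rho (fst z)) x - g (rho (snd z)) x) powr p) \<le> 2 powr p * ((LINT x|M. norm (g (rho (fst z)) x) powr p) + (LINT x|M. norm (g (rho (snd z)) x) powr p))"
        by (rule Lp_triangle(1)[OF m(2) m(2) m(4) m(4)])
      also have "\<dots> \<le> 2 powr p * (B + B)" by (intro mult_left_mono add_mono gB) auto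
      finally show ?thesis .
    qed
    have lw: "((\<lambda>z. LINT x|M. wt x * \<bar>v (rho (fst z)) x - v (rho (snd z)) x\<bar> powr p) \<longlongrightarrow> 0) ?P"
      by (rule weight_tendsto_0[OF Wd gd cau])
    \<comment> \<open>The map j stands for either projection, since the bounded factor may be either
      of the two eigenfunctions.\<close>
    have t: "((\<lambda>z. LINT x|M. wt x * (\<bar>v (rho (j z)) x\<bar> powr (p - 1) * \<bar>v (rho (fst z)) x - v (rho (snd z)) x\<bar>)) \<longlongrightarrow> 0) ?P" for j
      by (rule weighted_product_tendsto_0[where f="\<lambda>z x. \<bar>v (rho (j z)) x\<bar>" and h="\<lambda>z x. \<bar>v (rho (fst z)) x - v (rho (snd z)) x\<bar>" and B=BW])
        (use m(1) md(1) wt_ge(2) p W0_weight[OF Wv] wd vW lw in auto)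
    have gapt: "((\<lambda>z. integral\<^sup>L M (gap (g (rho (fst z))) (g (rho (snd z))))) \<longlongrightarrow> 0) ?P"
    proof (rule tendsto_sandwich[OF _ _ tendsto_const])
      let ?U = "\<lambda>j z. LINT x|M. wt x * (\<bar>v (rho (j z)) x\<bar> powr (p - 1) * \<bar>v (rho (fst z)) x - v (rho (snd z)) x\<bar>)"
      have "((\<lambda>z. (1 + L) * ?U fst z + (1 + L) * ?U snd z) \<longlongrightarrow> (1 + L) * 0 + (1 + L) * 0) ?P"
        by (intro tendsto_intros t)
      then show "((\<lambda>z. (1 + L) * ?U fst z + (1 + L) * ?U snd z) \<longlongrightarrow> 0) ?P" by simp
      show "eventually (\<lambda>z. 0 \<le> integral\<^sup>L M (gap (g (rho (fst z))) (g (rho (snd z))))) ?P"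
        by (intro always_eventually allI integral_nonneg_AE) (simp add: gap_def)
      have "integral\<^sup>L M (gap (g (rho (fst z))) (g (rho (snd z)))) \<le> (1 + L) * ?U fst z + (1 + L) * ?U snd z" for z
      proof -
        have U0: "0 \<le> ?U j z" for j using wt_ge(2) by (intro integral_nonneg_AE) auto
        have "integral\<^sup>L M (gap (g (rho (fst z))) (g (rho (snd z)))) \<le> (1 + \<bar>mu (rho (fst z))\<bar>) * ?U fst z + (1 + \<bar>mu (rho (snd z))\<bar>) * ?U snd z"
          by (rule gap_integral_le[OF W eq W eq])
        also have "\<dots> \<le> (1 + L) * ?U fst z + (1 + L) * ?U snd z"
          using L(2) by (intro add_mono mult_right_mono U0) auto
        finally show ?thesis .
      qed
      then show "eventually (\<lambda>z. integral\<^sup>L M (gap (g (rho (fst z))) (g (rho (snd z)))) \<le> (1 + L) * ?U fst z + (1 + L) * ?U snd z) ?P"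
        by (intro always_eventually allI)
    qed
    have gapC: "\<exists>N. \<forall>i\<ge>N. \<forall>j\<ge>N. integral\<^sup>L M (gap (g (rho i)) (g (rho j))) < e" if "e > 0" for e
      using order_tendstoD(2)[OF gapt that] unfolding eventually_prod_sequentially by auto
    show ?thesis
    proof (rule strong_convergence_of_gap[of "\<lambda>k. g (rho k)" B, OF m(2) m(4) gB gapC])
      fix r :: "nat \<Rightarrow> nat" and l
      assume r: "strict_mono r" and l: "l \<in> borel_measurable M" "integrable M (\<lambda>x. norm (l x) powr p)"
        and gAE: "AE x in M. (\<lambda>k. g (rho (r k)) x) \<longlonglongrightarrow> l x" and gLp: "(\<lambda>k. LINT x|M. norm (g (rho (r k)) x - l x) powr p) \<longlonglongrightarrow> 0"
      show ?thesis
      proof (rule Lp_complete[of "\<lambda>k. v (rho k)" p, OF m(1) p m(3) cau])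
        fix u assume u: "u \<in> borel_measurable M" "integrable M (\<lambda>x. \<bar>u x\<bar> powr p)" and vLp: "(\<lambda>n. LINT x|M. \<bar>v (rho n) x - u x\<bar> powr p) \<longlonglongrightarrow> 0"
        have iu: "integrable M (\<lambda>x. norm (v k x - u x) powr p)" for k
          using m(3)[of k] u(2) by (intro integrable_norm_powr_diff m u p0) auto
        have "(\<lambda>n. LINT x|M. norm (v (rho (r n)) x - u x) powr p) \<longlonglongrightarrow> 0"
          using LIMSEQ_subseq_LIMSEQ[OF vLp r] by (simp add: o_def)
        from Lp_tendsto_AE_subseq[of M "\<lambda>n. v (rho (r n))" u p, OF iu p0(1) this]
        obtain s where s: "strict_mono (s::nat\<Rightarrow>nat)" "AE x in M. (\<lambda>k. v (rho (r (s k))) x) \<longlonglongrightarrow> u x" by blast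
        define sg where "sg k = rho (r (s k))" for k
        have rs: "strict_mono (\<lambda>k. r (s k))" using strict_mono_o[OF r s(1)] by (simp add: o_def)
        have sg: "strict_mono sg" using strict_mono_o[OF rho rs] by (simp add: o_def sg_def[abs_def])
        have vAE: "AE x in M. (\<lambda>k. v (sg k) x) \<longlonglongrightarrow> u x" using s(2) by (simp add: sg_def)
        have gAE': "AE x in M. (\<lambda>k. g (sg k) x) \<longlonglongrightarrow> l x"
          using gAE
        proof eventually_elim
          case (elim x)
          from LIMSEQ_subseq_LIMSEQ[OF this s(1)] show ?case by (simp add: o_def sg_def)
        qed
        have vu: "(\<lambda>k. LINT x|M. \<bar>v (sg k) x - u x\<bar> powr p) \<longlonglongrightarrow> 0"
          using LIMSEQ_subseq_LIMSEQ[OF vLp rs] by (simp add: o_def sg_def)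
        have gl: "(\<lambda>k. LINT x|M. norm (g (sg k) x - l x) powr p) \<longlonglongrightarrow> 0"
          using LIMSEQ_subseq_LIMSEQ[OF gLp s(1)] by (simp add: o_def sg_def)
        have pv': "(\<lambda>k. LINT x|M. \<bar>ph (sg k) x - v (sg k) x\<bar> powr p) \<longlonglongrightarrow> 0"
          using LIMSEQ_subseq_LIMSEQ[OF pv sg] by (simp add: o_def)
        have pg': "(\<lambda>k. LINT x|M. norm (grad (ph (sg k)) x - g (sg k) x) powr p) \<longlonglongrightarrow> 0"
          using LIMSEQ_subseq_LIMSEQ[OF pg sg] by (simp add: o_def)
        have Wu: "W1p0 p w u l"
          by (rule W1p0_limit[OF W u l vu gl ph pv' pg'])
        have Wu0: "W0 p w u l" by (rule W1p0_W0[OF Wu])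
        \<comment> \<open>Strong convergence in L^p rules out a zero limit of functions of norm
          1.\<close>
        have nz: "\<not> (AE x in M. u x = 0)"
        proof
          assume z: "AE x in M. u x = 0"
          have "(LINT x|M. \<bar>v (sg k) x - u x\<bar> powr p) = (LINT x|M. \<bar>v (sg k) x\<bar> powr p)" for k
          proof (rule integral_cong_AE)
            show "AE x in M. \<bar>v (sg k) x - u x\<bar> powr p = \<bar>v (sg k) x\<bar> powr p" using z by eventually_elim simp
          qed (use m(1)[of "sg k"] u(1) in measurable)
          then have "(\<lambda>k. 1::real) \<longlonglongrightarrow> 0" using vu n1 by simp
          then show False using LIMSEQ_unique[OF tendsto_const, of "1::real" 0] by simp
        qed
        have "pairing u l lam phi (grad phi) = 0" if phi: "test_fun w phi" for phi
        proof -
          have ms: "(\<lambda>k. mu (sg k)) \<longlonglongrightarrow> lam" using LIMSEQ_subseq_LIMSEQ[OF lam sg] by (simp add: o_def)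
          have "(\<lambda>k. pairing (v (sg k)) (g (sg k)) (mu (sg k)) phi (grad phi)) \<longlonglongrightarrow> pairing u l lam phi (grad phi)"
            unfolding pairing_def
            by (intro tendsto_add flux_tendsto_integral[OF Wv gB Wu0 gAE' phi] reaction_tendsto_integral[OF Wv vW Wu0 vAE phi ms L(2)])
          then have "(\<lambda>k. 0) \<longlonglongrightarrow> pairing u l lam phi (grad phi)" by (simp only: eq[OF phi])
          then show ?thesis using LIMSEQ_unique tendsto_const by blast
        qed
        then show ?thesis unfolding eigenvalue_iff using Wu nz by blast
      qed
    qed
  qed
qed

end

text \<open>Compact closure of w in \<open>Omega\<close> makes w bounded and provides one pair of
  norm bounds; the almost everywhere assumptions restrict to w, and closedness is tested on
  sequences.\<close>

theorem theoremA12: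
  fixes H :: "'a::euclidean_space \<Rightarrow> 'a \<Rightarrow> real"
    and V :: "'a \<Rightarrow> real"
    and Omega w :: "'a set"
    and p q :: real
  assumes dim: "DIM('a) \<ge> 2"
    and p: "1 < p"
    and Omega: "is_domain Omega"
    and H_nonneg: "\<forall>x\<in>Omega. \<forall>xi. 0 \<le> H x xi"
    and H_norm: "AE x in lebesgue_on Omega. is_norm_fun (H x)"
    and H_meas: "\<forall>xi. (\<lambda>x. H x xi) \<in> borel_measurable (lebesgue_on Omega)"
    and H_bounds: "\<forall>w'. is_domain w' \<and> compactly_in w' Omega \<longrightarrow>
        (\<exists>kappa nu. 0 < kappa \<and> kappa \<le> nu \<and>
           (AE x in lebesgue_on w'. \<forall>xi. kappa * norm xi \<le> H x xi \<and> H x xi \<le> nu * norm xi))"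
    and H_uc: "AE x in lebesgue_on Omega. unif_convex (H x)"
    and H_diff: "AE x in lebesgue_on Omega. \<forall>xi. xi \<noteq> 0 \<longrightarrow> H x differentiable (at xi)"
    and V: "morrey_loc p q Omega V"
    and w: "is_domain w" "compactly_in w Omega"
  shows "closed {lam :: real. is_eigenvalue H p V w lam}"
proof -
  have wO: "w \<subseteq> Omega" using w(2) closure_subset[of w] by (auto simp: compactly_in_def)
  have w': "open w" "w \<noteq> {}" using w(1) by (auto simp: is_domain_def)
  have wb: "bounded w" using w(2) by (auto simp: compactly_in_def intro: bounded_subset[OF compact_imp_bounded closure_subset])
  have restrict: "AE x in lebesgue_on w. P x" if "AE x in lebesgue_on Omega. P x" for P
  proof -
    have "AE x in lebesgue. x \<in> Omega \<longrightarrow> P x"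
      using that Omega by (subst (asm) AE_restrict_space_iff) (auto simp: is_domain_def)
    then have "AE x in lebesgue. x \<in> w \<longrightarrow> P x" using wO by (auto elim!: eventually_mono)
    then show ?thesis using w' by (subst AE_restrict_space_iff) auto
  qed
  obtain kappa nu where kn: "0 < kappa" "AE x in lebesgue_on w. \<forall>xi. kappa * norm xi \<le> H x xi \<and> H x xi \<le> nu * norm xi"
    using H_bounds w by blast
  have norms: "AE x in lebesgue_on w. finsler_norm (H x) p kappa nu"
    using restrict[OF H_norm] restrict[OF H_uc] restrict[OF H_diff] kn(2)
  proof eventually_elim
    case (elim x)
    then show ?case using p kn(1) by unfold_locales auto
  qed
  interpret eigen_setting H V w p q kappa nu
  proof
    show "morrey p q w V" using V w by (auto simp: morrey_loc_def)
    show "(\<lambda>x. H x xi) \<in> borel_measurable (lebesgue_on w)" for xi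
      using H_meas wO by (blast intro: measurable_restrict_mono)
  qed (use dim p w' wb norms kn in auto)
  show ?thesis
    unfolding closed_sequential_limits using eigenvalue_limit by blast
qed

end
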